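(* Let $n\ge3$ be an integer, $2^*=2n/(n-2)$ and $d\mu(r)=r^{n-1}dr$ on $\mathbb{R}^+=(0,\infty)$. There exists a positive constant $C$ depending only on $n$ such that, for every $R>1$ and every $h$ with $h,\nabla h\in L^2(\mathbb{R}^n)$ and with support in the annulus $A(1/R,R)=\{\mathbf{x}\in\mathbb{R}^n:1/R\le|\mathbf{x}|\le R\}$, $$\|\mathcal{M}(h)\|^2_{L^{2^*}(\mathbb{R}^+;d\mu)}\le C(\ln R)^{\frac{2(n-1)}{n}}\left\{\|\nabla h\|^2_{L^2(\mathbb{R}^n)}-\frac{(n-2)^2}{4}\Big\|\frac{h}{|\cdot|}\Big\|^2_{L^2(\mathbb{R}^n)}\right\}.$$
   Context: $\mathcal{M}(h)(r)=\frac{1}{|\mathbb{S}^{n-1}|}\int_{\mathbb{S}^{n-1}}h(r\omega)\,d\omega$ is the integral mean of $h$ over the unit sphere $\mathbb{S}^{n-1}$, and $h/|\cdot|$ denotes the function $\mathbf{x}\mapsto h(\mathbf{x})/|\mathbf{x}|$. The norm is $\|H\|_{L^{2^*}(\mathbb{R}^+;d\mu)}=\big(\int_0^\infty|H(r)|^{2^*}r^{n-1}dr\big)^{1/2^*}$. *)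

theory Defs
  imports "HOL-Analysis.Analysis"
begin

definition in_Lp :: "'a measure \<Rightarrow> real \<Rightarrow> ('a \<Rightarrow> 'b::real_normed_vector) \<Rightarrow> bool" where
  "in_Lp M p f \<longleftrightarrow> f \<in> borel_measurable M \<and> integrable M (\<lambda>x. norm (f x) powr p)"

text \<open>The value is meaningful only when \<open>in_Lp M p f\<close> holds: the Bochner integral of a
  non-integrable function is 0.\<close>

definition Lp_norm :: "'a measure \<Rightarrow> real \<Rightarrow> ('a \<Rightarrow> 'b::real_normed_vector) \<Rightarrow> real" where
  "Lp_norm M p f = (\<integral>x. norm (f x) powr p \<partial>M) powr (1 / p)"

text \<open>Partial derivatives are directional derivatives along the standard basis vectors.\<close>

definition partial_deriv :: "'n \<Rightarrow> (real ^ 'n \<Rightarrow> real) \<Rightarrow> real ^ 'n \<Rightarrow> real" where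
  "partial_deriv i f x = frechet_derivative f (at x) (axis i 1)"

fun C_order :: "nat \<Rightarrow> (real ^ 'n \<Rightarrow> real) \<Rightarrow> bool" where
  "C_order 0 f \<longleftrightarrow> continuous_on UNIV f"
| "C_order (Suc k) f \<longleftrightarrow> (\<forall>x. f differentiable (at x)) \<and> (\<forall>i. C_order k (partial_deriv i f))"

definition test_function :: "(real ^ 'n \<Rightarrow> real) \<Rightarrow> bool" where
  "test_function \<phi> \<longleftrightarrow> (\<forall>k. C_order k \<phi>) \<and> compact (closure {x. \<phi> x \<noteq> 0})"

definition locally_integrable :: "(real ^ 'n \<Rightarrow> 'b::{banach, second_countable_topology}) \<Rightarrow> bool" where
  "locally_integrable f \<longleftrightarrow> (\<forall>K. compact K \<longrightarrow> set_integrable lebesgue K f)"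

text \<open>Testing with real-valued functions suffices for complex-valued \<open>h\<close>, by linearity.\<close>

definition has_weak_gradient :: "(real ^ 'n \<Rightarrow> complex) \<Rightarrow> (real ^ 'n \<Rightarrow> complex ^ 'n) \<Rightarrow> bool" where
  "has_weak_gradient h g \<longleftrightarrow> locally_integrable h \<and> locally_integrable g \<and>
     (\<forall>\<phi> i. test_function \<phi> \<longrightarrow>
        (\<integral>x. partial_deriv i \<phi> x *\<^sub>R h x \<partial>lebesgue) = - (\<integral>x. \<phi> x *\<^sub>R (g x $ i) \<partial>lebesgue))"

text \<open>The support of an almost-everywhere class: the complement of the largest open set on which
  the function vanishes almost everywhere.\<close>

definition ess_support :: "('a::euclidean_space \<Rightarrow> 'b::zero) \<Rightarrow> 'a set" where
  "ess_support h = - \<Union>{U. open U \<and> (AE x in lebesgue. x \<in> U \<longrightarrow> h x = 0)}"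

definition annulus :: "real \<Rightarrow> real \<Rightarrow> 'a::real_normed_vector set" where
  "annulus a b = {x. a \<le> norm x \<and> norm x \<le> b}"

text \<open>Surface measure on the unit sphere, normalised by polar coordinates: the measure of \<open>A\<close> is
  \<open>n\<close> times the volume of the cone \<open>{r \<omega> | 0 < r < 1, \<omega> \<in> A}\<close>, as made explicit in the lemma below.\<close>

definition sphere_measure :: "'a::euclidean_space measure" where
  "sphere_measure = scale_measure (of_nat DIM('a))
     (distr (restrict_space lborel (ball 0 1 - {0})) (restrict_space borel (sphere 0 1))
        (\<lambda>x. x /\<^sub>R norm x))"

lemma space_sphere_measure: "space (sphere_measure :: 'a::euclidean_space measure) = sphere 0 1"
  by (simp add: sphere_measure_def space_scale_measure space_restrict_space)

lemma emeasure_sphere_measure: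
  fixes A :: "'a::euclidean_space set"
  assumes "A \<in> sets borel" and "A \<subseteq> sphere 0 1"
  shows "emeasure sphere_measure A =
    of_nat DIM('a) * emeasure lborel {r *\<^sub>R \<omega> | r \<omega>. 0 < r \<and> r < 1 \<and> \<omega> \<in> A}"
proof -
  let ?B = "ball 0 1 - {0} :: 'a set" and ?f = "\<lambda>x::'a. x /\<^sub>R norm x"
  have m: "?f \<in> restrict_space lborel ?B \<rightarrow>\<^sub>M restrict_space borel (sphere 0 1)"
    by (rule measurable_restrict_space2)
       (auto simp: space_restrict_space intro!: measurable_restrict_space1)
  have A: "A \<in> sets (restrict_space borel (sphere 0 1))"
    using assms by (auto simp: sets_restrict_space_iff)
  have cone: "?f -` A \<inter> ?B = {r *\<^sub>R \<omega> | r \<omega>. 0 < r \<and> r < 1 \<and> \<omega> \<in> A}" (is "?L = ?R")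
  proof
    show "?L \<subseteq> ?R"
    proof
      fix x assume "x \<in> ?L"
      then show "x \<in> ?R"
        by (intro CollectI exI[of _ "norm x"] exI[of _ "?f x"]) auto
    qed
    show "?R \<subseteq> ?L"
      using assms(2) by (auto simp: subset_iff)
  qed
  have "emeasure sphere_measure A = of_nat DIM('a) *
      emeasure (restrict_space lborel ?B) (?f -` A \<inter> ?B)"
    by (simp add: sphere_measure_def emeasure_distr[OF m A] space_restrict_space)
  also have "emeasure (restrict_space lborel ?B) (?f -` A \<inter> ?B) = emeasure lborel (?f -` A \<inter> ?B)"
    by (rule emeasure_restrict_space) auto
  finally show ?thesis
    by (simp only: cone)
qed

text \<open>The completion is needed because \<open>h\<close> is only Lebesgue measurable: for almost every \<open>r\<close> its
  restriction to the sphere of radius \<open>r\<close> is then measurable for the completed measure.\<close>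

definition spherical_mean :: "('a::euclidean_space \<Rightarrow> complex) \<Rightarrow> real \<Rightarrow> complex" where
  "spherical_mean h r = (1 / measure sphere_measure (sphere (0::'a) 1)) *\<^sub>R
     (\<integral>\<omega>. h (r *\<^sub>R \<omega>) \<partial>(completion sphere_measure))"

definition radial_measure :: "nat \<Rightarrow> real measure" where
  "radial_measure n = density (restrict_space lebesgue {0<..}) (\<lambda>r. ennreal (r ^ (n - 1)))"

definition sobolev_exponent :: "nat \<Rightarrow> real" where
  "sobolev_exponent n = 2 * real n / (real n - 2)"

end

theory Submission
  imports Defs
begin

text \<open>Write \<open>n\<close> for the dimension and \<open>c = (n - 2) / 2\<close>. In the coordinates \<open>x = e\<^sup>t \<omega>\<close> the Hardy
  functional becomes the plain energy of a function on a cylinder. Put \<open>W(x) = |x|\<^sup>c h(x)\<close> and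
  \<open>V(x) = |x|\<^sup>c (c h(x) + x \<cdot> g(x))\<close>, where \<open>g\<close> is the gradient of \<open>h\<close>, and integrate against \<open>dx / |x|\<^sup>n\<close>,
  which is the product of \<open>dt\<close> and the surface measure. Then \<open>V\<close> is the derivative of \<open>W\<close> in \<open>t\<close>. The
  Cauchy--Schwarz inequality \<open>|x \<cdot> g| \<le> |x| |g|\<close> shows that the right-hand bracket \<open>D\<close> is at least
  \<open>\<integral>|V - c W|\<^sup>2 - c\<^sup>2 \<integral>|W|\<^sup>2 = \<integral>|V|\<^sup>2 - 2 c \<integral>\<langle>W, V\<rangle>\<close>, and the last integral vanishes because
  \<open>2 \<langle>W, V\<rangle>\<close> is the \<open>t\<close>-derivative of \<open>|W|\<^sup>2\<close>. Hence \<open>D \<ge> \<integral>|V|\<^sup>2\<close> (\<open>hardy_remainder_identity\<close>).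

  Since \<open>W\<close> lives on the strip \<open>|t| \<le> ln R\<close>, it is minus the integral of \<open>V\<close> over a \<open>t\<close>-interval of
  length comparable to \<open>ln R\<close> that ends outside the strip. The Cauchy--Schwarz inequality bounds the \<open>L\<^sup>2\<close> norm
  of \<open>W\<close> on every sphere by a multiple of \<open>D ln R\<close> (\<open>sphere_L2_bound\<close>), so the mean \<open>m\<close> of \<open>h\<close>
  satisfies \<open>|m(r)|\<^sup>2 \<le> const r\<^bsup>2 - n\<^esup> D ln R\<close> (\<open>spherical_mean_pointwise_bound\<close>). When this is raised to the
  power \<open>n / (n - 2)\<close> and multiplied by the density \<open>r\<^bsup>n - 1\<^esup>\<close>, only \<open>dr / r\<close> on \<open>[1/R, R]\<close> is left, which
  contributes one more factor \<open>(2 ln R)\<^bsup>(n - 2) / n\<^esup>\<close> (\<open>radial_Lp_bound\<close>). The exponents of \<open>ln R\<close> add up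
  to \<open>2 (n - 1) / n\<close>.

  For a weak gradient, the statement that \<open>V\<close> is the derivative of \<open>W\<close> is proved in integrated form: for each
  \<open>t \<ge> 0\<close>, \<open>W(e\<^sup>t x) - W(x) = \<integral> V(e\<^sup>s x) ds\<close> over \<open>0 \<le> s \<le> t\<close>, for almost every \<open>x\<close>
  (\<open>weak_dilation_flow\<close> and \<open>conformal_lift_flow\<close>). It is enough to test this with smooth functions of
  compact support, and a dilated test function is again a test function. The
  vanishing of \<open>\<integral>\<langle>W, V\<rangle>\<close> is then a fact about functions along an arbitrary measure-preserving flow
  (\<open>integral_inner_flow_derivative_eq_0\<close>), here the flow of dilations.\<close>

section \<open>Smooth functions and bump functions\<close>

lemma C_order_SucD: "C_order (Suc k) f \<Longrightarrow> C_order k f"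
proof (induction k arbitrary: f)
  case 0
  then show ?case
    by (auto intro!: continuous_at_imp_continuous_on differentiable_imp_continuous_within)
next
  case (Suc k)
  then show ?case by (meson C_order.simps(2))
qed

lemma C_order_continuous: "C_order k f \<Longrightarrow> continuous_on UNIV f"
  by (induction k) (auto dest: C_order_SucD simp del: C_order.simps(2))

lemma partial_deriv_eqI:
  "(f has_derivative f') (at x) \<Longrightarrow> partial_deriv i f x = f' (axis i 1)"
  unfolding partial_deriv_def by (metis frechet_derivative_at)

lemma C_order_SucI:
  assumes "\<And>x. (f has_derivative f' x) (at x)" and "\<And>i. C_order k (\<lambda>x. f' x (axis i 1))"
  shows "C_order (Suc k) f"
proof -
  have "partial_deriv i f = (\<lambda>x. f' x (axis i 1))" for i
    using partial_deriv_eqI[OF assms(1)] by auto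
  then show ?thesis
    using assms by (auto simp: differentiable_def)
qed

lemma has_derivative_frechet:
  "C_order (Suc k) f \<Longrightarrow> (f has_derivative frechet_derivative f (at x)) (at x)"
  by (simp add: frechet_derivative_works[symmetric])

lemma C_order_const: "C_order k (\<lambda>x. a)"
proof (induction k arbitrary: a)
  case (Suc k)
  then show ?case
    by (intro C_order_SucI[OF has_derivative_const]) auto
qed simp

lemma C_order_linear:
  assumes "bounded_linear f"
  shows "C_order k f"
proof (cases k)
  case 0
  then show ?thesis
    using assms by (simp add: linear_continuous_on)
next
  case (Suc j)
  then show ?thesis
    by (auto intro!: C_order_SucI bounded_linear_imp_has_derivative assms C_order_const
        simp del: C_order.simps(2))
qed

lemma C_order_add: "C_order k f \<Longrightarrow> C_order k g \<Longrightarrow> C_order k (\<lambda>x. f x + g x)"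
proof (induction k arbitrary: f g)
  case 0
  then show ?case by (auto intro: continuous_on_add)
next
  case (Suc k)
  show ?case
    by (rule C_order_SucI[OF has_derivative_add[OF Suc.prems[THEN has_derivative_frechet]]])
       (use Suc in \<open>auto simp: partial_deriv_def[abs_def]\<close>)
qed

lemma C_order_mult: "C_order k f \<Longrightarrow> C_order k g \<Longrightarrow> C_order k (\<lambda>x. f x * g x)"
proof (induction k arbitrary: f g)
  case 0
  then show ?case by (auto intro: continuous_on_mult)
next
  case (Suc k)
  show ?case
    by (rule C_order_SucI[OF has_derivative_mult[OF Suc.prems[THEN has_derivative_frechet]]])
       (use Suc Suc.prems[THEN C_order_SucD] in
         \<open>auto simp: partial_deriv_def[abs_def] simp del: C_order.simps(2) intro!: C_order_add Suc.IH,
          auto simp: partial_deriv_def[abs_def]\<close>)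
qed

lemma C_order_prod:
  "(\<And>i. i \<in> I \<Longrightarrow> C_order k (f i)) \<Longrightarrow> C_order k (\<lambda>x. \<Prod>i\<in>I. f i x)"
  by (induction I rule: infinite_finite_induct) (auto intro: C_order_const C_order_mult)

lemma has_derivative_scale:
  fixes f :: "real ^ 'n \<Rightarrow> real"
  assumes "f differentiable (at (a *\<^sub>R x))"
  shows "((\<lambda>x. f (a *\<^sub>R x)) has_derivative
           (\<lambda>v. a * frechet_derivative f (at (a *\<^sub>R x)) v)) (at x)"
proof -
  have d: "(f has_derivative frechet_derivative f (at (a *\<^sub>R x))) (at (a *\<^sub>R x))"
    using assms by (simp add: frechet_derivative_works[symmetric])
  have "((\<lambda>x. f (a *\<^sub>R x)) has_derivative
           (\<lambda>v. frechet_derivative f (at (a *\<^sub>R x)) (a *\<^sub>R v))) (at x)"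
    by (rule has_derivative_compose[where f="\<lambda>x. a *\<^sub>R x" and f'="\<lambda>v. a *\<^sub>R v", OF _ d])
       (auto intro!: derivative_eq_intros)
  then show ?thesis
    using d by (simp add: linear_cmul has_derivative_linear)
qed

lemma C_order_scale: "C_order k f \<Longrightarrow> C_order k (\<lambda>x. f (a *\<^sub>R x))"
proof (induction k arbitrary: f)
  case 0
  then show ?case by (auto intro!: continuous_on_compose2[of UNIV f] continuous_intros)
next
  case (Suc k)
  have "C_order k (\<lambda>x. a * partial_deriv i f (a *\<^sub>R x))" for i
    using Suc by (intro C_order_mult C_order_const Suc.IH) auto
  then show ?case
    by (intro C_order_SucI[OF has_derivative_scale])
       (use Suc.prems in \<open>auto simp: partial_deriv_def\<close>)
qed

text \<open>The functions \<open>x\<^bsup>-k\<^esup> exp (-1/x)\<close>, extended by zero, are closed under differentiation up to linear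
  combinations. All of them can therefore be proved smooth by a single induction, without a formula for
  the higher derivatives of \<open>exp (-1/x)\<close>.\<close>

definition flat_exp :: "nat \<Rightarrow> real \<Rightarrow> real" where
  "flat_exp k x = (if x \<le> 0 then 0 else inverse x ^ k * exp (- inverse x))"

lemma flat_exp_has_derivative:
  "(flat_exp k has_real_derivative (flat_exp (k + 2) x - real k * flat_exp (Suc k) x)) (at x)"
proof -
  consider "x < 0" | "x = 0" | "x > 0" by linarith
  then show ?thesis
  proof cases
    case 1
    have "((\<lambda>_. 0) has_real_derivative 0) (at x)" by simp
    then have "(flat_exp k has_real_derivative 0) (at x)"
      by (rule has_field_derivative_transform_within_open[where S="{..<0}"])
         (use 1 in \<open>auto simp: flat_exp_def\<close>)
    then show ?thesis using 1 by (simp add: flat_exp_def)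
  next
    case 3
    have "((\<lambda>x. inverse x ^ k * exp (- inverse x)) has_real_derivative
        (inverse x ^ (k + 2) * exp (- inverse x) - real k * (inverse x ^ Suc k * exp (- inverse x)))) (at x)"
    proof (cases k)
      case 0
      with 3 show ?thesis
        by (auto intro!: derivative_eq_intros simp: power2_eq_square field_simps)
    next
      case (Suc j)
      have "real (Suc j) * (- (inverse x ^ Suc (Suc 0)) * inverse x ^ j) * exp (- inverse x)
          + exp (- inverse x) * inverse x ^ Suc (Suc 0) * inverse x ^ Suc j
        = inverse x ^ (k + 2) * exp (- inverse x) - real k * (inverse x ^ Suc k * exp (- inverse x))"
        by (simp add: Suc algebra_simps)
      then show ?thesis
        using 3 by (auto intro!: derivative_eq_intros simp: Suc simp del: of_nat_Suc power_Suc)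
          (simp add: algebra_simps)
    qed
    then have "(flat_exp k has_real_derivative
        (inverse x ^ (k + 2) * exp (- inverse x) - real k * (inverse x ^ Suc k * exp (- inverse x)))) (at x)"
      by (rule has_field_derivative_transform_within_open[where S="{0<..}"])
         (use 3 in \<open>auto simp: flat_exp_def\<close>)
    then show ?thesis using 3 by (simp add: flat_exp_def)
  next
    case 2
    have "((\<lambda>y. y ^ Suc k / exp y) \<longlongrightarrow> (0::real)) at_top"
      by (rule tendsto_power_div_exp_0)
    then have "((\<lambda>y. inverse y ^ Suc k / exp (inverse y)) \<longlongrightarrow> (0::real)) (at_right 0)"
      by (rule filterlim_compose[OF _ filterlim_inverse_at_top_right])
    then have r: "((\<lambda>y. (flat_exp k y - flat_exp k 0) / (y - 0)) \<longlongrightarrow> 0) (at_right 0)"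
      by (rule Lim_transform_eventually)
         (auto simp: flat_exp_def eventually_at_right_field exp_minus field_simps intro!: exI[of _ 1])
    have "((\<lambda>y. 0::real) \<longlongrightarrow> 0) (at_left 0)" by simp
    then have l: "((\<lambda>y. (flat_exp k y - flat_exp k 0) / (y - 0)) \<longlongrightarrow> 0) (at_left 0)"
      by (rule Lim_transform_eventually)
         (auto simp: flat_exp_def eventually_at_left_field intro!: exI[of _ "-1"])
    have "((\<lambda>y. (flat_exp k y - flat_exp k 0) / (y - 0)) \<longlongrightarrow> 0) (at 0)"
      by (rule filterlim_split_at[OF l r])
    then show ?thesis using 2
      by (simp add: has_field_derivative_iff) (simp add: flat_exp_def)
  qed
qed

text \<open>The index \<open>k\<close> varies in the induction because differentiation replaces \<open>flat_exp k\<close> by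
  members of the family with larger index.\<close>

lemma C_order_flat_exp: "C_order j f \<Longrightarrow> C_order j (\<lambda>x. flat_exp k (f x))"
proof (induction j arbitrary: k)
  case 0
  have "continuous_on UNIV (flat_exp k)"
    by (meson DERIV_isCont flat_exp_has_derivative continuous_at_imp_continuous_on)
  with 0 show ?case
    by (auto intro!: continuous_on_compose2[of UNIV "flat_exp k"])
next
  case (Suc j)
  let ?d = "\<lambda>x. flat_exp (k + 2) (f x) - real k * flat_exp (Suc k) (f x)"
  have d: "((\<lambda>x. flat_exp k (f x)) has_derivative
          (\<lambda>v. ?d x * frechet_derivative f (at x) v)) (at x)" for x
    using has_derivative_compose[OF has_derivative_frechet[OF Suc.prems]
        flat_exp_has_derivative[unfolded has_field_derivative_def]] by simp
  have s: "C_order j f" using Suc.prems by (rule C_order_SucD)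
  have "C_order j (\<lambda>x. (flat_exp (k + 2) (f x) + (- real k) * flat_exp (Suc k) (f x)) * partial_deriv i f x)" for i
    using Suc.prems by (intro C_order_mult C_order_add C_order_const Suc.IH s) auto
  then show ?case
    by (intro C_order_SucI[OF d]) (auto simp: partial_deriv_def)
qed

text \<open>For \<open>t > 0\<close> the values \<open>exp (-1 / (j t))\<close> increase to 1 as \<open>j\<close> grows, so these products are smooth,
  vanish outside the box, and converge to its indicator.\<close>

definition box_bump :: "real ^ 'n \<Rightarrow> real ^ 'n \<Rightarrow> nat \<Rightarrow> real ^ 'n \<Rightarrow> real" where
  "box_bump a b j x = (\<Prod>i\<in>UNIV. flat_exp 0 (real (Suc j) * (x $ i - a $ i)) * flat_exp 0 (real (Suc j) * (b $ i - x $ i)))"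

lemma flat_exp_0_bounds: "0 \<le> flat_exp 0 x" "flat_exp 0 x \<le> 1"
  by (auto simp: flat_exp_def)

lemma box_bump_bounds: "0 \<le> box_bump a b j x" "box_bump a b j x \<le> 1"
  unfolding box_bump_def
  by (auto intro!: prod_nonneg prod_le_1 mult_le_one simp: flat_exp_0_bounds)

lemma box_bump_eq_0: "x \<notin> box a b \<Longrightarrow> box_bump a b j x = 0"
proof -
  assume "x \<notin> box a b"
  then obtain i where "x $ i - a $ i \<le> 0 \<or> b $ i - x $ i \<le> 0"
    by (auto simp: mem_box_cart not_less)
  then have "flat_exp 0 (real (Suc j) * (x $ i - a $ i)) * flat_exp 0 (real (Suc j) * (b $ i - x $ i)) = 0"
    by (auto simp: flat_exp_def mult_le_0_iff)
  then show ?thesis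
    unfolding box_bump_def by (intro prod_zero) auto
qed

lemma test_function_box_bump: "test_function (box_bump a b j)"
proof -
  have "C_order k (\<lambda>x. flat_exp 0 (real (Suc j) * (x $ i - a $ i)))"
    "C_order k (\<lambda>x. flat_exp 0 (real (Suc j) * (b $ i - x $ i)))" for k i
  proof -
    have *: "C_order k (\<lambda>x. r * (x $ i) + s)" for r s :: real
      by (intro C_order_add C_order_mult C_order_const C_order_linear bounded_linear_vec_nth)
    show "C_order k (\<lambda>x. flat_exp 0 (real (Suc j) * (x $ i - a $ i)))"
      using C_order_flat_exp[OF *[of "real (Suc j)" "- real (Suc j) * a $ i"]]
      by (simp add: algebra_simps)
    show "C_order k (\<lambda>x. flat_exp 0 (real (Suc j) * (b $ i - x $ i)))"
      using C_order_flat_exp[OF *[of "- real (Suc j)" "real (Suc j) * b $ i"]]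
      by (simp add: algebra_simps)
  qed
  then have "C_order k (box_bump a b j)" for k
    unfolding box_bump_def[abs_def] by (intro C_order_prod C_order_mult)
  moreover have "{x. box_bump a b j x \<noteq> 0} \<subseteq> box a b"
    using box_bump_eq_0 by blast
  ultimately show ?thesis
    unfolding test_function_def
    by (metis bounded_box bounded_subset compact_closure)
qed

lemma flat_exp_0_tendsto:
  "x > 0 \<Longrightarrow> (\<lambda>j. flat_exp 0 (real (Suc j) * x)) \<longlonglongrightarrow> 1"
proof -
  assume x: "x > 0"
  have "(\<lambda>j. exp (- (inverse (real (Suc j)) * inverse x))) \<longlonglongrightarrow> exp (- (0 * inverse x))"
    by (intro tendsto_intros LIMSEQ_inverse_real_of_nat)
  then show ?thesis
    using x by (simp add: flat_exp_def not_le mult_less_0_iff zero_less_mult_iff mult_le_0_iff del: of_nat_Suc)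
qed

lemma box_bump_tendsto: "(\<lambda>j. box_bump a b j x) \<longlonglongrightarrow> indicator (box a b) x"
proof (cases "x \<in> box a b")
  case True
  then have "x $ i - a $ i > 0" "b $ i - x $ i > 0" for i
    by (auto simp: mem_box_cart)
  then have "(\<lambda>j. box_bump a b j x) \<longlonglongrightarrow> (\<Prod>i\<in>(UNIV::'a set). 1 * 1)"
    unfolding box_bump_def by (intro tendsto_prod tendsto_mult flat_exp_0_tendsto)
  with True show ?thesis by simp
qed (simp add: box_bump_eq_0)

section \<open>Functions orthogonal to all test functions\<close>

lemma integral_test_function_box_limit:
  fixes f :: "real ^ 'n \<Rightarrow> 'b::{banach, second_countable_topology}"
  assumes "set_integrable lborel (box a b) f"
  shows "(\<lambda>j. \<integral>x. box_bump a b j x *\<^sub>R f x \<partial>lborel) \<longlonglongrightarrow> (\<integral>x\<in>box a b. f x \<partial>lborel)"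
proof -
  have int: "integrable lborel (\<lambda>x. indicator (box a b) x *\<^sub>R f x)"
    using assms by (simp add: set_integrable_def)
  have eq: "(\<lambda>x. box_bump a b j x *\<^sub>R f x) = (\<lambda>x. box_bump a b j x *\<^sub>R (indicator (box a b) x *\<^sub>R f x))" for j
    using box_bump_eq_0 by (fastforce simp: indicator_def fun_eq_iff)
  have [measurable]: "box_bump a b j \<in> borel_measurable borel" for j
    by (intro borel_measurable_continuous_onI C_order_continuous)
       (use test_function_box_bump in \<open>auto simp: test_function_def\<close>)
  have [measurable]: "(\<lambda>x. indicator (box a b) x *\<^sub>R f x) \<in> borel_measurable lborel"
    using int by auto
  show ?thesis
    unfolding set_lebesgue_integral_def eq
  proof (rule integral_dominated_convergence)
    show "integrable lborel (\<lambda>x. norm (indicator (box a b) x *\<^sub>R f x))"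
      using int by (rule integrable_norm)
    show "AE x in lborel. (\<lambda>j. box_bump a b j x *\<^sub>R indicator (box a b) x *\<^sub>R f x)
        \<longlonglongrightarrow> indicator (box a b) x *\<^sub>R f x"
    proof (rule AE_I2)
      fix x
      have "(\<lambda>j. box_bump a b j x *\<^sub>R indicator (box a b) x *\<^sub>R f x)
        \<longlonglongrightarrow> indicator (box a b) x *\<^sub>R indicator (box a b) x *\<^sub>R f x"
        by (intro tendsto_intros box_bump_tendsto)
      then show "(\<lambda>j. box_bump a b j x *\<^sub>R indicator (box a b) x *\<^sub>R f x)
        \<longlonglongrightarrow> indicator (box a b) x *\<^sub>R f x"
        by (auto simp: indicator_def split: if_splits)
    qed
    show "AE x in lborel. norm (box_bump a b j x *\<^sub>R indicator (box a b) x *\<^sub>R f x)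
        \<le> norm (indicator (box a b) x *\<^sub>R f x)" for j
      using box_bump_bounds[of a b j]
      by (intro AE_I2) (auto simp: indicator_def intro: mult_left_le_one_le)
  qed measurable
qed

text \<open>The measures with densities \<open>f\<^sup>+\<close> and \<open>f\<^sup>-\<close> are finite and equal on boxes, which form an
  intersection-stable generator of the Borel sets. So the measures coincide, and so do their densities.\<close>

lemma AE_eq_0_if_box_integrals_0:
  fixes f :: "'a::euclidean_space \<Rightarrow> real"
  assumes [measurable]: "f \<in> borel_measurable borel"
    and int: "\<And>a b. set_integrable lborel (box a b) f"
    and zero: "\<And>a b. (\<integral>x\<in>box a b. f x \<partial>lborel) = 0"
  shows "AE x in lborel. f x = 0"
proof -
  let ?P = "density lborel (\<lambda>x. ennreal (f x))" and ?N = "density lborel (\<lambda>x. ennreal (- f x))"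
  have eq: "emeasure ?P (box a b) = emeasure ?N (box a b)"
    and fin: "emeasure ?P (box a b) \<noteq> \<infinity>" for a b
  proof -
    let ?g = "\<lambda>x. indicator (box a b) x *\<^sub>R f x"
    have g: "integrable lborel ?g"
      using int by (simp add: set_integrable_def)
    have "emeasure ?P (box a b) = (\<integral>\<^sup>+x. ennreal (?g x) \<partial>lborel)"
      "emeasure ?N (box a b) = (\<integral>\<^sup>+x. ennreal (- ?g x) \<partial>lborel)"
      by (auto simp: emeasure_density intro!: nn_integral_cong split: split_indicator)
    moreover have "(\<integral>\<^sup>+x. ennreal (?g x) \<partial>lborel) \<noteq> \<infinity>" "(\<integral>\<^sup>+x. ennreal (- ?g x) \<partial>lborel) \<noteq> \<infinity>"
      using g by (simp_all add: real_integrable_def)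
    moreover have "enn2real (\<integral>\<^sup>+x. ennreal (?g x) \<partial>lborel) = enn2real (\<integral>\<^sup>+x. ennreal (- ?g x) \<partial>lborel)"
      using zero[of a b] real_lebesgue_integral_def[OF g]
      by (simp add: set_lebesgue_integral_def)
    ultimately show "emeasure ?P (box a b) = emeasure ?N (box a b)" "emeasure ?P (box a b) \<noteq> \<infinity>"
      by (metis ennreal_enn2real infinity_ennreal_def less_top)+
  qed
  have "?P = ?N"
  proof (rule measure_eqI_generator_eq)
    let ?E = "range (\<lambda>(a, b). box a b::'a set)"
    show "Int_stable ?E"
      by (auto simp: Int_stable_def box_Int_box)
    show "?E \<subseteq> Pow UNIV" "sets ?P = sigma_sets UNIV ?E" "sets ?N = sigma_sets UNIV ?E"
      by (simp_all add: borel_eq_box)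
    let ?A = "\<lambda>n::nat. box (- (real n *\<^sub>R One)) (real n *\<^sub>R One) :: 'a set"
    show "range ?A \<subseteq> ?E" "(\<Union>i. ?A i) = UNIV"
      unfolding UN_box_eq_UNIV by auto
    show "emeasure ?P (?A i) \<noteq> \<infinity>" for i by (rule fin)
    show "emeasure ?P X = emeasure ?N X" if "X \<in> ?E" for X
      using that eq by auto
  qed
  then have "AE x in lborel. ennreal (f x) = ennreal (- f x)"
    by (subst sigma_finite_measure.density_unique_iff[OF lborel.sigma_finite_measure_axioms, symmetric]) auto
  then show ?thesis
  proof eventually_elim
    case (elim x)
    then show ?case
      by (cases "f x \<ge> 0") (auto simp: ennreal_neg)
  qed
qed

text \<open>The fundamental lemma of the calculus of variations.\<close>

lemma AE_eq_0_if_orthogonal_to_test_functions: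
  fixes f :: "real ^ 'n \<Rightarrow> complex"
  assumes [measurable]: "f \<in> borel_measurable borel"
    and int: "\<And>a b. set_integrable lborel (box a b) f"
    and zero: "\<And>\<phi>. test_function \<phi> \<Longrightarrow> (\<integral>x. \<phi> x *\<^sub>R f x \<partial>lborel) = 0"
  shows "AE x in lborel. f x = 0"
proof -
  have box: "(\<integral>x\<in>box a b. f x \<partial>lborel) = 0" for a b
    using integral_test_function_box_limit[OF int, of a b] zero[OF test_function_box_bump]
    by (simp add: LIMSEQ_const_iff)
  have "AE x in lborel. Re (f x) = 0"
  proof (rule AE_eq_0_if_box_integrals_0)
    fix a b :: "real ^ 'n"
    show "set_integrable lborel (box a b) (\<lambda>x. Re (f x))"
      using integrable_Re[OF int[of a b, unfolded set_integrable_def]] by (simp add: set_integrable_def)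
    show "(\<integral>x\<in>box a b. Re (f x) \<partial>lborel) = 0"
      using integral_Re[OF int[of a b, unfolded set_integrable_def]] box[of a b]
      by (simp add: set_lebesgue_integral_def)
  qed measurable
  moreover have "AE x in lborel. Im (f x) = 0"
  proof (rule AE_eq_0_if_box_integrals_0)
    fix a b :: "real ^ 'n"
    show "set_integrable lborel (box a b) (\<lambda>x. Im (f x))"
      using integrable_Im[OF int[of a b, unfolded set_integrable_def]] by (simp add: set_integrable_def)
    show "(\<integral>x\<in>box a b. Im (f x) \<partial>lborel) = 0"
      using integral_Im[OF int[of a b, unfolded set_integrable_def]] box[of a b]
      by (simp add: set_lebesgue_integral_def)
  qed measurable
  ultimately show ?thesis
    by eventually_elim (simp add: complex_eq_iff)
qed

section \<open>Weak derivatives along dilations\<close>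

lemma distr_dilation:
  fixes a :: real
  assumes "a > 0"
  shows "distr lborel lborel (\<lambda>x::'a::euclidean_space. a *\<^sub>R x)
    = density lborel (\<lambda>_. ennreal (inverse a ^ DIM('a)))"
proof -
  let ?D = "distr lborel borel (\<lambda>x::'a. a *\<^sub>R x)"
  have "density lborel (\<lambda>_::'a. ennreal (inverse a ^ DIM('a)))
      = density (density ?D (\<lambda>_. ennreal (a ^ DIM('a)))) (\<lambda>_. ennreal (inverse a ^ DIM('a)))"
    using lborel_affine[of a "0::'a"] assms by simp
  also have "\<dots> = density ?D (\<lambda>_. 1)"
    using assms by (subst density_density_eq)
      (auto simp: ennreal_mult[symmetric] power_mult_distrib[symmetric])
  also have "\<dots> = distr lborel lborel (\<lambda>x::'a. a *\<^sub>R x)"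
    by (simp add: density_1 cong: distr_cong)
  finally show ?thesis ..
qed

lemma nn_integral_dilation:
  fixes f :: "'a::euclidean_space \<Rightarrow> ennreal"
  assumes "a > 0" and [measurable]: "f \<in> borel_measurable borel"
  shows "(\<integral>\<^sup>+x. f (a *\<^sub>R x) \<partial>lborel) = ennreal (inverse a ^ DIM('a)) * (\<integral>\<^sup>+x. f x \<partial>lborel)"
  using nn_integral_distr[of "\<lambda>x. a *\<^sub>R x" lborel lborel f]
  by (simp add: distr_dilation[OF assms(1)] nn_integral_density nn_integral_cmult)

lemma integral_dilation:
  fixes f :: "'a::euclidean_space \<Rightarrow> 'b::{banach, second_countable_topology}"
  assumes "a > 0" and [measurable]: "f \<in> borel_measurable borel"
  shows "(\<integral>x. f (a *\<^sub>R x) \<partial>lborel) = inverse a ^ DIM('a) *\<^sub>R (\<integral>x. f x \<partial>lborel)"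
  using integral_distr[of "\<lambda>x. a *\<^sub>R x" lborel lborel f] assms(1)
  by (simp add: distr_dilation integral_density)

lemma integrable_continuous_times_locally_integrable:
  fixes q :: "real ^ 'n \<Rightarrow> 'b::{banach, second_countable_topology}"
  assumes q: "locally_integrable q" "q \<in> borel_measurable borel"
    and f: "continuous_on UNIV f" "\<And>x. x \<notin> K \<Longrightarrow> f x = 0" "compact K"
  shows "integrable lborel (\<lambda>x. f x *\<^sub>R q x)"
proof -
  note [measurable] = q(2) borel_measurable_continuous_onI[OF f(1)]
  have K[measurable]: "K \<in> sets borel" using f(3) by (simp add: borel_compact)
  have "compact (f ` K)"
    using f by (meson compact_continuous_image continuous_on_subset subset_UNIV)
  then obtain B where B: "\<And>x. x \<in> K \<Longrightarrow> \<bar>f x\<bar> \<le> B"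
    by (metis bounded_real compact_imp_bounded imageI)
  have "set_integrable lebesgue K q"
    using q f(3) by (auto simp: locally_integrable_def)
  then have int: "integrable lborel (\<lambda>x. indicator K x *\<^sub>R q x)"
    unfolding set_integrable_def by (subst (asm) integrable_completion) auto
  show ?thesis
  proof (rule Bochner_Integration.integrable_bound[OF integrable_scaleR_right[OF int, of B]])
    show "AE x in lborel. norm (f x *\<^sub>R q x) \<le> norm (B *\<^sub>R indicator K x *\<^sub>R q x)"
    proof (rule AE_I2)
      fix x
      show "norm (f x *\<^sub>R q x) \<le> norm (B *\<^sub>R indicator K x *\<^sub>R q x)"
        using B[of x] f(2)[of x] by (cases "x \<in> K") (auto intro!: mult_right_mono)
    qed
  qed measurable
qed

text \<open>The derivative of \<open>\<phi>\<close> along the generator \<open>x\<close> of the dilations.\<close>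

definition euler_deriv :: "(real ^ 'n \<Rightarrow> real) \<Rightarrow> real ^ 'n \<Rightarrow> real" where
  "euler_deriv \<phi> x = (\<Sum>i\<in>UNIV. x $ i * partial_deriv i \<phi> x)"

text \<open>The bilinear product \<open>x \<cdot> v\<close> of a real and a complex vector, which is \<open>|x|\<close> times the radial component of \<open>v\<close>.\<close>

definition dot_complex :: "real ^ 'n \<Rightarrow> complex ^ 'n \<Rightarrow> complex" where
  "dot_complex x v = (\<Sum>i\<in>UNIV. (x $ i) *\<^sub>R (v $ i))"

lemma continuous_partial_deriv:
  "C_order (Suc 0) \<phi> \<Longrightarrow> continuous_on UNIV (partial_deriv i \<phi>)"
  by simp

lemma continuous_euler_deriv:
  "C_order (Suc 0) \<phi> \<Longrightarrow> continuous_on UNIV (euler_deriv \<phi>)"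
  unfolding euler_deriv_def[abs_def]
  by (intro continuous_intros continuous_partial_deriv bounded_linear.continuous_on[OF bounded_linear_vec_nth])

lemma frechet_derivative_eq_euler:
  assumes "C_order (Suc 0) \<phi>"
  shows "frechet_derivative \<phi> (at x) x = euler_deriv \<phi> x"
proof -
  have lin: "linear (frechet_derivative \<phi> (at x))"
    using assms by (simp add: linear_frechet_derivative)
  have "frechet_derivative \<phi> (at x) x = frechet_derivative \<phi> (at x) (\<Sum>i\<in>UNIV. (x $ i) *\<^sub>R axis i 1)"
    using basis_expansion[of x] by (simp add: scalar_mult_eq_scaleR)
  also have "\<dots> = euler_deriv \<phi> x"
    unfolding euler_deriv_def partial_deriv_def
    by (simp add: linear_sum[OF lin] linear_cmul[OF lin])
  finally show ?thesis .
qed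

lemma partial_deriv_eq_0_outside:
  assumes "closed K" "\<And>x. x \<notin> K \<Longrightarrow> \<phi> x = 0" "x \<notin> K"
  shows "partial_deriv i \<phi> x = 0"
proof -
  have "((\<lambda>_. 0::real) has_derivative (\<lambda>_. 0)) (at x)" by simp
  then have "(\<phi> has_derivative (\<lambda>_. 0)) (at x)"
    by (rule has_derivative_transform_within_open[where s="-K"]) (use assms in auto)
  then show ?thesis by (rule partial_deriv_eqI)
qed

lemma test_function_support:
  assumes "test_function \<phi>"
  obtains r where "r > 0" "\<And>x. x \<notin> cball 0 r \<Longrightarrow> \<phi> x = 0"
    "\<And>x i. x \<notin> cball 0 r \<Longrightarrow> partial_deriv i \<phi> x = 0"
proof -
  have "bounded {x. \<phi> x \<noteq> 0}"
    using assms unfolding test_function_def by (meson bounded_subset closure_subset compact_imp_bounded)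
  then obtain r where r: "r > 0" "\<And>x. \<phi> x \<noteq> 0 \<Longrightarrow> norm x \<le> r"
    by (auto simp: bounded_pos)
  have "\<phi> x = 0" if "x \<notin> cball 0 r" for x
    using that r by auto
  moreover from this have "partial_deriv i \<phi> x = 0" if "x \<notin> cball 0 r" for x i
    by (rule partial_deriv_eq_0_outside[OF closed_cball _ that]) auto
  ultimately show ?thesis
    using that r(1) by blast
qed

lemma test_functionI:
  assumes "\<And>k. C_order k \<phi>" "\<And>x. x \<notin> cball 0 r \<Longrightarrow> \<phi> x = 0"
  shows "test_function \<phi>"
proof -
  have "{x. \<phi> x \<noteq> 0} \<subseteq> cball 0 r" using assms(2) by blast
  then have "bounded {x. \<phi> x \<noteq> 0}" by (meson bounded_cball bounded_subset)
  then show ?thesis using assms(1) by (simp add: test_function_def)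
qed

lemma test_function_dilation:
  assumes "test_function \<phi>" "a > 0"
  shows "test_function (\<lambda>x. \<phi> (a *\<^sub>R x))"
proof -
  obtain r where r: "r > 0" "\<And>x. x \<notin> cball 0 r \<Longrightarrow> \<phi> x = 0"
    using test_function_support[OF assms(1)] by metis
  show ?thesis
  proof (rule test_functionI)
    show "C_order k (\<lambda>x. \<phi> (a *\<^sub>R x))" for k
      using assms(1) by (intro C_order_scale) (simp add: test_function_def)
    show "\<phi> (a *\<^sub>R x) = 0" if "x \<notin> cball 0 (r / a)" for x
      using that assms(2) by (intro r(2)) (auto simp: field_simps)
  qed
qed

lemma euler_deriv_dilation:
  assumes "C_order (Suc 0) \<phi>"
  shows "euler_deriv (\<lambda>x. \<phi> (a *\<^sub>R x)) x = euler_deriv \<phi> (a *\<^sub>R x)"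
proof -
  have "partial_deriv i (\<lambda>x. \<phi> (a *\<^sub>R x)) x = a * partial_deriv i \<phi> (a *\<^sub>R x)" for i
    using partial_deriv_eqI[OF has_derivative_scale[of \<phi> a x]] assms by (simp add: partial_deriv_def)
  then show ?thesis
    by (simp add: euler_deriv_def ac_simps)
qed

text \<open>The weak gradient is tested with the vector field \<open>\<phi>(x) x\<close>, whose divergence is \<open>n \<phi> + x \<cdot> \<nabla>\<phi>\<close>.
  This is the weak form of the statement that \<open>x \<cdot> g\<close> is the derivative of \<open>h\<close> along dilations.\<close>

lemma weak_euler_equation:
  fixes h :: "real ^ 'n \<Rightarrow> complex"
  assumes w: "has_weak_gradient h g" and [measurable]: "h \<in> borel_measurable borel" "g \<in> borel_measurable borel"
    and t: "test_function \<phi>"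
  shows "(\<integral>x. (real CARD('n) * \<phi> x + euler_deriv \<phi> x) *\<^sub>R h x \<partial>lborel)
     = - (\<integral>x. \<phi> x *\<^sub>R dot_complex x (g x) \<partial>lborel)"
proof -
  have C: "C_order k \<phi>" for k using t by (simp add: test_function_def)
  obtain r where r: "\<And>x. x \<notin> cball 0 r \<Longrightarrow> \<phi> x = 0"
    "\<And>x i. x \<notin> cball 0 r \<Longrightarrow> partial_deriv i \<phi> x = 0"
    using test_function_support[OF t] by metis
  have lin: "C_order k (\<lambda>x::real^'n. x $ i)" for i k
    by (intro C_order_linear bounded_linear_vec_nth)
  let ?\<psi> = "\<lambda>i x. x $ i * \<phi> x"
  have Cpsi: "C_order k (?\<psi> i)" for i k
    by (intro C_order_mult lin C)
  have tpsi: "test_function (?\<psi> i)" for i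
    by (rule test_functionI[where r=r]) (use Cpsi r in auto)
  have pd: "partial_deriv i (?\<psi> i) x = \<phi> x + x $ i * partial_deriv i \<phi> x" for i x
  proof -
    have "(?\<psi> i has_derivative (\<lambda>v. x $ i * frechet_derivative \<phi> (at x) v + v $ i * \<phi> x)) (at x)"
      by (intro has_derivative_mult has_derivative_frechet[OF C] bounded_linear_imp_has_derivative
          bounded_linear_vec_nth)
    from partial_deriv_eqI[OF this] show ?thesis
      by (simp add: partial_deriv_def)
  qed
  have locg: "locally_integrable (\<lambda>x. g x $ i)" for i
    unfolding locally_integrable_def
  proof (intro allI impI)
    fix K :: "(real ^ 'n) set"
    assume "compact K"
    then have "integrable lebesgue (\<lambda>x. indicator K x *\<^sub>R g x)"
      using w by (auto simp: has_weak_gradient_def locally_integrable_def set_integrable_def)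
    from integrable_bounded_linear[OF bounded_linear_vec_nth[of i] this]
    show "set_integrable lebesgue K (\<lambda>x. g x $ i)"
      by (simp add: set_integrable_def)
  qed
  have [measurable]: "(\<lambda>x. g x $ i) \<in> borel_measurable borel" for i
    by (rule measurable_compose[OF \<open>g \<in> _\<close> borel_measurable_continuous_onI])
       (intro bounded_linear.continuous_on[OF bounded_linear_vec_nth] continuous_on_id)
  have ih: "integrable lborel (\<lambda>x. partial_deriv i (?\<psi> i) x *\<^sub>R h x)" for i
  proof (rule integrable_continuous_times_locally_integrable[where K="cball 0 r"])
    show "continuous_on UNIV (partial_deriv i (?\<psi> i))"
      using Cpsi[of "Suc 0"] by simp
    show "partial_deriv i (?\<psi> i) x = 0" if "x \<notin> cball 0 r" for x
      using r that by (simp add: pd)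
  qed (use w in \<open>auto simp: has_weak_gradient_def\<close>)
  have ig: "integrable lborel (\<lambda>x. ?\<psi> i x *\<^sub>R (g x $ i))" for i
    by (rule integrable_continuous_times_locally_integrable[where K="cball 0 r"])
       (use locg C_order_continuous[OF Cpsi] r in auto)
  have weak: "(\<integral>x. partial_deriv i (?\<psi> i) x *\<^sub>R h x \<partial>lborel) = - (\<integral>x. ?\<psi> i x *\<^sub>R (g x $ i) \<partial>lborel)" for i
  proof -
    have "(\<integral>x. partial_deriv i (?\<psi> i) x *\<^sub>R h x \<partial>lebesgue) = - (\<integral>x. ?\<psi> i x *\<^sub>R (g x $ i) \<partial>lebesgue)"
      using w tpsi[of i] by (simp add: has_weak_gradient_def)
    then show ?thesis
      using borel_measurable_integrable[OF ih] borel_measurable_integrable[OF ig]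
      by (simp add: integral_completion)
  qed
  have "(\<integral>x. (real CARD('n) * \<phi> x + euler_deriv \<phi> x) *\<^sub>R h x \<partial>lborel)
      = (\<integral>x. (\<Sum>i\<in>UNIV. partial_deriv i (?\<psi> i) x *\<^sub>R h x) \<partial>lborel)"
    by (simp add: pd euler_deriv_def sum.distrib scaleR_sum_left[symmetric])
  also have "\<dots> = (\<Sum>i\<in>UNIV. - (\<integral>x. ?\<psi> i x *\<^sub>R (g x $ i) \<partial>lborel))"
    by (subst Bochner_Integration.integral_sum[OF ih]) (simp only: weak)
  also have "\<dots> = - (\<integral>x. (\<Sum>i\<in>UNIV. ?\<psi> i x *\<^sub>R (g x $ i)) \<partial>lborel)"
    by (subst Bochner_Integration.integral_sum[OF ig]) (simp only: sum_negf)
  also have "(\<lambda>x. \<Sum>i\<in>UNIV. ?\<psi> i x *\<^sub>R (g x $ i)) = (\<lambda>x. \<phi> x *\<^sub>R dot_complex x (g x))"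
    by (simp add: dot_complex_def scaleR_sum_right ac_simps)
  finally show ?thesis .
qed


lemma measurable_cutoff_norm:
  fixes q :: "'a::euclidean_space \<Rightarrow> 'b::{banach, second_countable_topology}"
  assumes "q \<in> borel_measurable borel"
  shows "(\<lambda>y. ennreal (indicator (cball 0 u) y * norm (q y))) \<in> borel_measurable borel"
proof -
  have "(\<lambda>y. norm (q y)) \<in> borel_measurable borel"
    using assms by measurable
  then show ?thesis
    by (intro measurable_compose[OF _ measurable_ennreal] borel_measurable_times
        borel_measurable_indicator) simp
qed

text \<open>For \<open>0 \<le> s \<le> t\<close> the dilation by \<open>e\<^sup>s\<close> maps the support of \<open>b\<close> into one fixed ball, on which \<open>q\<close> is
  integrable. This justifies exchanging the integrals over \<open>s\<close> and \<open>x\<close>.\<close>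

lemma integrable_dilated_kernel:
  fixes q :: "'a::euclidean_space \<Rightarrow> complex" and b :: "'a \<Rightarrow> real"
  assumes q[measurable]: "q \<in> borel_measurable borel" and qi: "\<And>r. set_integrable lborel (cball 0 r) q"
    and b[measurable]: "b \<in> borel_measurable borel" and bb: "\<And>x. \<bar>b x\<bar> \<le> B * indicator (cball 0 r) x"
    and t: "0 \<le> t" and r: "0 \<le> r"
  shows "integrable (lborel \<Otimes>\<^sub>M lborel)
     (\<lambda>(s, x). (indicator {0..t} s * exp (c * s) * b x) *\<^sub>R q (exp s *\<^sub>R x))"
proof (rule integrableI_bounded)
  let ?K = "exp (\<bar>c\<bar> * t) * B"
  let ?Q = "\<integral>\<^sup>+y. ennreal (indicator (cball 0 (exp t * r)) y * norm (q y)) \<partial>lborel"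
  have "(\<integral>\<^sup>+y. ennreal (norm (indicator (cball 0 (exp t * r)) y *\<^sub>R q y)) \<partial>lborel) < \<infinity>"
    using qi[of "exp t * r"] unfolding set_integrable_def integrable_iff_bounded by blast
  then have Q: "?Q < \<infinity>" by simp
  have "0 \<le> B" using bb[of 0] r by (auto simp: order_trans[OF abs_ge_zero])
  have inner: "(\<integral>\<^sup>+x. ennreal (norm ((indicator {0..t} s * exp (c * s) * b x) *\<^sub>R q (exp s *\<^sub>R x))) \<partial>lborel)
      \<le> ennreal ?K * ?Q * indicator {0..t} s" for s
  proof (cases "s \<in> {0..t}")
    case True
    have "c * s \<le> \<bar>c\<bar> * t"
      using True by (intro mult_mono) auto
    then have e: "exp (c * s) \<le> exp (\<bar>c\<bar> * t)" by simp
    have "(\<integral>\<^sup>+x. ennreal (norm ((indicator {0..t} s * exp (c * s) * b x) *\<^sub>R q (exp s *\<^sub>R x))) \<partial>lborel)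
      \<le> (\<integral>\<^sup>+x. ennreal ?K * ennreal (indicator (cball 0 (exp t * r)) (exp s *\<^sub>R x) * norm (q (exp s *\<^sub>R x))) \<partial>lborel)"
    proof (rule nn_integral_mono)
      fix x :: 'a
      have "indicator (cball 0 r) x \<le> (indicator (cball 0 (exp t * r)) (exp s *\<^sub>R x) :: real)"
        using True by (auto simp: indicator_def intro!: mult_mono)
      then have "\<bar>b x\<bar> \<le> B * indicator (cball 0 (exp t * r)) (exp s *\<^sub>R x)"
        using bb[of x] \<open>0 \<le> B\<close> by (meson mult_left_mono order_trans)
      then have "exp (c * s) * \<bar>b x\<bar> * norm (q (exp s *\<^sub>R x))
        \<le> exp (\<bar>c\<bar> * t) * (B * indicator (cball 0 (exp t * r)) (exp s *\<^sub>R x)) * norm (q (exp s *\<^sub>R x))"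
        using e by (intro mult_right_mono mult_mono) auto
      then show "ennreal (norm ((indicator {0..t} s * exp (c * s) * b x) *\<^sub>R q (exp s *\<^sub>R x)))
        \<le> ennreal ?K * ennreal (indicator (cball 0 (exp t * r)) (exp s *\<^sub>R x) * norm (q (exp s *\<^sub>R x)))"
        using True \<open>0 \<le> B\<close> by (subst ennreal_mult[symmetric]) (auto simp: abs_mult ac_simps intro!: ennreal_leI)
    qed
    also have "\<dots> = ennreal ?K * (ennreal (inverse (exp s) ^ DIM('a)) * ?Q)"
      using measurable_compose[OF _ measurable_cutoff_norm[OF q], of "\<lambda>x. exp s *\<^sub>R x" lborel]
      by (subst nn_integral_cmult) (auto simp: nn_integral_dilation[OF _ measurable_cutoff_norm[OF q]])
    also have "\<dots> \<le> ennreal ?K * (1 * ?Q)"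
      using True by (intro mult_left_mono mult_right_mono)
        (auto simp: power_le_one inverse_le_1_iff)
    finally show ?thesis using True by simp
  qed auto
  have "(\<integral>\<^sup>+z. ennreal (norm (case z of (s, x) \<Rightarrow> (indicator {0..t} s * exp (c * s) * b x) *\<^sub>R q (exp s *\<^sub>R x))) \<partial>(lborel \<Otimes>\<^sub>M lborel))
    = (\<integral>\<^sup>+s. \<integral>\<^sup>+x. ennreal (norm ((indicator {0..t} s * exp (c * s) * b x) *\<^sub>R q (exp s *\<^sub>R x))) \<partial>lborel \<partial>lborel)"
    by (subst lborel.nn_integral_fst[symmetric]) (simp_all)
  also have "\<dots> \<le> (\<integral>\<^sup>+s. ennreal ?K * ?Q * indicator {0..t} s \<partial>lborel)"
    by (intro nn_integral_mono inner)
  also have "\<dots> = ennreal ?K * ?Q * ennreal t"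
    using t by (simp add: nn_integral_cmult)
  also have "\<dots> < \<infinity>"
    using Q by (simp add: ennreal_mult_less_top)
  finally show "(\<integral>\<^sup>+z. ennreal (norm (case z of (s, x) \<Rightarrow> (indicator {0..t} s * exp (c * s) * b x) *\<^sub>R q (exp s *\<^sub>R x))) \<partial>(lborel \<Otimes>\<^sub>M lborel)) < \<infinity>" .
qed measurable

lemma integrable_bounded_kernel:
  fixes h :: "'a::euclidean_space \<Rightarrow> complex" and a :: "real \<Rightarrow> 'a \<Rightarrow> real"
  assumes h[measurable]: "h \<in> borel_measurable borel" and hi: "set_integrable lborel (cball 0 r) h"
    and a[measurable]: "case_prod a \<in> borel_measurable (borel \<Otimes>\<^sub>M borel)"
    and ab: "\<And>s x. 0 \<le> s \<Longrightarrow> s \<le> t \<Longrightarrow> \<bar>a s x\<bar> \<le> B * indicator (cball 0 r) x"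
    and t: "0 \<le> t" and r: "0 \<le> r"
  shows "integrable (lborel \<Otimes>\<^sub>M lborel) (\<lambda>(s, x). (indicator {0..t} s * a s x) *\<^sub>R h x)"
proof (rule integrableI_bounded)
  let ?Q = "\<integral>\<^sup>+y. ennreal (indicator (cball 0 r) y * norm (h y)) \<partial>lborel"
  have "(\<integral>\<^sup>+y. ennreal (norm (indicator (cball 0 r) y *\<^sub>R h y)) \<partial>lborel) < \<infinity>"
    using hi unfolding set_integrable_def integrable_iff_bounded by blast
  then have Q: "?Q < \<infinity>" by simp
  have "0 \<le> B" using ab[of 0 0] r t by (auto simp: order_trans[OF abs_ge_zero])
  have inner: "(\<integral>\<^sup>+x. ennreal (norm ((indicator {0..t} s * a s x) *\<^sub>R h x)) \<partial>lborel)
      \<le> ennreal B * ?Q * indicator {0..t} s" for s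
  proof (cases "s \<in> {0..t}")
    case True
    have "(\<integral>\<^sup>+x. ennreal (norm ((indicator {0..t} s * a s x) *\<^sub>R h x)) \<partial>lborel)
      \<le> (\<integral>\<^sup>+x. ennreal B * ennreal (indicator (cball 0 r) x * norm (h x)) \<partial>lborel)"
    proof (rule nn_integral_mono)
      fix x :: 'a
      have "\<bar>a s x\<bar> * norm (h x) \<le> B * indicator (cball 0 r) x * norm (h x)"
        using ab[of s x] True by (intro mult_right_mono) auto
      then show "ennreal (norm ((indicator {0..t} s * a s x) *\<^sub>R h x))
        \<le> ennreal B * ennreal (indicator (cball 0 r) x * norm (h x))"
        using True \<open>0 \<le> B\<close> by (subst ennreal_mult[symmetric]) (auto simp: ac_simps intro!: ennreal_leI)
    qed
    also have "\<dots> = ennreal B * ?Q"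
      using measurable_cutoff_norm[OF h] by (subst nn_integral_cmult) auto
    finally show ?thesis using True by simp
  qed auto
  have "(\<integral>\<^sup>+z. ennreal (norm (case z of (s, x) \<Rightarrow> (indicator {0..t} s * a s x) *\<^sub>R h x)) \<partial>(lborel \<Otimes>\<^sub>M lborel))
    = (\<integral>\<^sup>+s. \<integral>\<^sup>+x. ennreal (norm ((indicator {0..t} s * a s x) *\<^sub>R h x)) \<partial>lborel \<partial>lborel)"
    by (subst lborel.nn_integral_fst[symmetric]) (simp_all)
  also have "\<dots> \<le> (\<integral>\<^sup>+s. ennreal B * ?Q * indicator {0..t} s \<partial>lborel)"
    by (intro nn_integral_mono inner)
  also have "\<dots> = ennreal B * ?Q * ennreal t"
    using t by (simp add: nn_integral_cmult)
  also have "\<dots> < \<infinity>"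
    using Q by (simp add: ennreal_mult_less_top)
  finally show "(\<integral>\<^sup>+z. ennreal (norm (case z of (s, x) \<Rightarrow> (indicator {0..t} s * a s x) *\<^sub>R h x)) \<partial>(lborel \<Otimes>\<^sub>M lborel)) < \<infinity>" .
qed measurable


lemma integral_test_function_times_dilated:
  fixes q :: "real ^ 'n \<Rightarrow> complex"
  assumes [measurable]: "q \<in> borel_measurable borel" and "continuous_on UNIV \<phi>"
  shows "(\<integral>x. \<phi> x *\<^sub>R q (exp s *\<^sub>R x) \<partial>lborel)
     = exp (- real CARD('n) * s) *\<^sub>R (\<integral>y. \<phi> (exp (- s) *\<^sub>R y) *\<^sub>R q y \<partial>lborel)"
proof -
  have [measurable]: "\<phi> \<in> borel_measurable borel"
    using assms(2) by (rule borel_measurable_continuous_onI)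
  have "inverse (exp s) ^ CARD('n) = exp (- real CARD('n) * s)"
    by (simp add: exp_minus[symmetric] exp_of_nat_mult[symmetric])
  then show ?thesis
    using integral_dilation[of "exp s" "\<lambda>y. \<phi> (exp (- s) *\<^sub>R y) *\<^sub>R q y"]
    by (simp add: exp_minus)
qed

lemma locally_integrableI:
  fixes w :: "real ^ 'n \<Rightarrow> complex"
  assumes "w \<in> borel_measurable borel" "\<And>r. set_integrable lborel (cball 0 r) w"
  shows "locally_integrable w"
  unfolding locally_integrable_def
proof (intro allI impI)
  fix K :: "(real ^ 'n) set"
  assume K: "compact K"
  then obtain \<rho> where "K \<subseteq> cball 0 \<rho>"
    using bounded_subset_ballD[OF compact_imp_bounded[OF K], of 0] ball_subset_cball by blast
  then have "set_integrable lborel K w"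
    using assms(2)[of \<rho>] K by (metis borel_compact set_integrable_subset sets_lborel)
  then show "set_integrable lebesgue K w"
    unfolding set_integrable_def by (subst integrable_completion) auto
qed

text \<open>Both sides are locally integrable in \<open>x\<close>, so it suffices to compare their integrals against a test
  function \<open>\<phi>\<close>. After moving the dilation from \<open>h\<close> to \<open>\<phi>\<close>, the left-hand side is the integral of \<open>h\<close> against
  \<open>u t - u 0\<close> with \<open>u s y = e\<^bsup>(c - n) s\<^esup> \<phi>(e\<^bsup>-s\<^esup> y)\<close>. The function \<open>u\<close> is smooth in \<open>s\<close>; writing the difference as
  the integral of its \<open>s\<close>-derivative and applying the weak equation for each \<open>s\<close> gives the right-hand side.\<close>

lemma weak_dilation_flow:
  fixes h k :: "real ^ 'n \<Rightarrow> complex"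
  assumes h[measurable]: "h \<in> borel_measurable borel" and hi: "\<And>r. set_integrable lborel (cball 0 r) h"
    and k[measurable]: "k \<in> borel_measurable borel" and ki: "\<And>r. set_integrable lborel (cball 0 r) k"
    and euler: "\<And>\<phi>. test_function \<phi> \<Longrightarrow>
        (\<integral>x. (real CARD('n) * \<phi> x + euler_deriv \<phi> x) *\<^sub>R h x \<partial>lborel) = - (\<integral>x. \<phi> x *\<^sub>R k x \<partial>lborel)"
    and t: "0 \<le> t"
  shows "AE x in lborel. exp (c * t) *\<^sub>R h (exp t *\<^sub>R x) - h x
     = (\<integral>s. (indicator {0..t} s * exp (c * s)) *\<^sub>R (c *\<^sub>R h (exp s *\<^sub>R x) + k (exp s *\<^sub>R x)) \<partial>lborel)"
proof -
  let ?n = "real CARD('n)"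
  define q where "q x = c *\<^sub>R h x + k x" for x
  have q[measurable]: "q \<in> borel_measurable borel"
    unfolding q_def[abs_def] by measurable
  have qi: "set_integrable lborel (cball 0 r) q" for r
    unfolding q_def[abs_def] using hi[of r] ki[of r] by (intro set_integral_add) auto
  \<comment> \<open>Weighting with \<open>b = \<phi>\<close> serves the test against \<open>\<phi>\<close>, weighting with the indicator of a box serves
    local integrability.\<close>
  define F where "F b = (\<lambda>s x. (indicator {0..t} s * exp (c * s) * b x) *\<^sub>R q (exp s *\<^sub>R x))" for b :: "real ^ 'n \<Rightarrow> real"
  define I where "I x = (\<integral>s. (indicator {0..t} s * exp (c * s)) *\<^sub>R q (exp s *\<^sub>R x) \<partial>lborel)" for x
  have FI: "(\<integral>s. F b s x \<partial>lborel) = b x *\<^sub>R I x" for b x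
    unfolding I_def F_def by (subst integral_scaleR_right[symmetric]) (simp add: ac_simps)
  have [measurable]: "I \<in> borel_measurable borel"
    unfolding I_def[abs_def] by measurable
  define f where "f x = exp (c * t) *\<^sub>R h (exp t *\<^sub>R x) - h x - I x" for x
  have "AE x in lborel. f x = 0"
  proof (rule AE_eq_0_if_orthogonal_to_test_functions)
    show "f \<in> borel_measurable borel" unfolding f_def[abs_def] by measurable
  next
    fix a b :: "real ^ 'n"
    obtain r where r: "0 < r" "box a b \<subseteq> cball 0 r"
      using bounded_subset_ballD[OF bounded_box[of a b], of 0] by (meson ball_subset_cball order_trans)
    let ?b = "indicator (box a b) :: real ^ 'n \<Rightarrow> real"
    have bb: "\<bar>?b x\<bar> \<le> 1 * indicator (cball 0 r) x" for x
      using r(2) by (auto simp: indicator_def)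
    have "integrable (lborel \<Otimes>\<^sub>M lborel) (\<lambda>(s, x). F ?b s x)"
      unfolding F_def by (rule integrable_dilated_kernel[OF q qi _ bb t]) (use r in auto)
    from lborel_pair.integrable_snd[OF this]
    have "integrable lborel (\<lambda>x. ?b x *\<^sub>R I x)" unfolding FI .
    moreover have "integrable lborel (\<lambda>x. ?b x *\<^sub>R h x)"
      using set_integrable_subset[OF hi[of r], of "box a b"] r by (simp add: set_integrable_def)
    moreover have "integrable lborel (\<lambda>x. ?b x *\<^sub>R h (exp t *\<^sub>R x))"
    proof (rule integrableI_bounded)
      have "(\<integral>\<^sup>+x. ennreal (norm (?b x *\<^sub>R h (exp t *\<^sub>R x))) \<partial>lborel)
        \<le> (\<integral>\<^sup>+x. ennreal (indicator (cball 0 (exp t * r)) (exp t *\<^sub>R x) * norm (h (exp t *\<^sub>R x))) \<partial>lborel)"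
        using r(2) by (intro nn_integral_mono) (auto simp: indicator_def)
      also have "\<dots> = ennreal (inverse (exp t) ^ DIM(real ^ 'n)) * (\<integral>\<^sup>+x. ennreal (indicator (cball 0 (exp t * r)) x * norm (h x)) \<partial>lborel)"
        by (rule nn_integral_dilation[OF _ measurable_cutoff_norm[OF h]]) simp
      also have "\<dots> < \<infinity>"
        using hi[of "exp t * r"] unfolding set_integrable_def integrable_iff_bounded
        by (simp add: ennreal_mult_less_top)
      finally show "(\<integral>\<^sup>+x. ennreal (norm (?b x *\<^sub>R h (exp t *\<^sub>R x))) \<partial>lborel) < \<infinity>" .
    qed measurable
    ultimately have "integrable lborel (\<lambda>x. exp (c * t) *\<^sub>R (?b x *\<^sub>R h (exp t *\<^sub>R x)) - ?b x *\<^sub>R h x - ?b x *\<^sub>R I x)"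
      by (intro Bochner_Integration.integrable_diff integrable_scaleR_right)
    then show "set_integrable lborel (box a b) f"
      by (simp add: set_integrable_def f_def algebra_simps)
  next
    fix \<phi> :: "real ^ 'n \<Rightarrow> real"
    assume tf: "test_function \<phi>"
    then have C: "C_order j \<phi>" for j by (simp add: test_function_def)
    obtain r where r: "r > 0" "\<And>x. x \<notin> cball 0 r \<Longrightarrow> \<phi> x = 0"
      "\<And>x i. x \<notin> cball 0 r \<Longrightarrow> partial_deriv i \<phi> x = 0"
      using test_function_support[OF tf] by metis
    note cphi = C_order_continuous[OF C[of 0]] and ceul = continuous_euler_deriv[OF C]
    note [measurable] = borel_measurable_continuous_onI[OF cphi] borel_measurable_continuous_onI[OF ceul]
    have reul: "euler_deriv \<phi> x = 0" if "x \<notin> cball 0 r" for x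
      using r(3)[OF that] by (simp add: euler_deriv_def)
    obtain B where B: "\<And>x. \<bar>\<phi> x\<bar> \<le> B * indicator (cball 0 r) x"
      "\<And>x. \<bar>euler_deriv \<phi> x\<bar> \<le> B * indicator (cball 0 r) x"
    proof -
      have "bounded (\<phi> ` cball 0 r)" "bounded (euler_deriv \<phi> ` cball 0 r)"
        using cphi ceul by (meson compact_cball compact_continuous_image compact_imp_bounded continuous_on_subset subset_UNIV)+
      then obtain B1 B2 where "\<And>x. x \<in> cball 0 r \<Longrightarrow> \<bar>\<phi> x\<bar> \<le> B1" "\<And>x. x \<in> cball 0 r \<Longrightarrow> \<bar>euler_deriv \<phi> x\<bar> \<le> B2"
        unfolding bounded_real by (metis imageI)
      then show ?thesis
        using r(2) reul by (intro that[of "max B1 B2"]) (fastforce simp: indicator_def le_max_iff_disj)+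
    qed
    \<comment> \<open>The factor \<open>e\<^bsup>-n s\<^esup>\<close> is the Jacobian of the substitution \<open>y = e\<^sup>s x\<close>.\<close>
    define u where "u s y = exp ((c - ?n) * s) * \<phi> (exp (- s) *\<^sub>R y)" for s y
    define u' where "u' s y = exp ((c - ?n) * s) * ((c - ?n) * \<phi> (exp (- s) *\<^sub>R y) - euler_deriv \<phi> (exp (- s) *\<^sub>R y))" for s y
    have deriv: "((\<lambda>s. u s y) has_real_derivative u' s y) (at s)" for s y
    proof -
      have 1: "((\<lambda>s. exp (- s) *\<^sub>R y) has_derivative (\<lambda>v. v *\<^sub>R (- exp (- s) *\<^sub>R y))) (at s)"
        by (auto intro!: derivative_eq_intros simp: algebra_simps)
      have "((\<lambda>s. \<phi> (exp (- s) *\<^sub>R y)) has_derivative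
          (\<lambda>v. frechet_derivative \<phi> (at (exp (- s) *\<^sub>R y)) (v *\<^sub>R (- exp (- s) *\<^sub>R y)))) (at s)"
        by (rule has_derivative_compose[OF 1 has_derivative_frechet[OF C]])
      also have "(\<lambda>v. frechet_derivative \<phi> (at (exp (- s) *\<^sub>R y)) (v *\<^sub>R (- exp (- s) *\<^sub>R y)))
          = (\<lambda>v. - euler_deriv \<phi> (exp (- s) *\<^sub>R y) * v)"
      proof
        fix v :: real
        have lin: "linear (frechet_derivative \<phi> (at (exp (- s) *\<^sub>R y)))"
          using C[of "Suc 0"] by (simp add: linear_frechet_derivative)
        have "v *\<^sub>R (- exp (- s) *\<^sub>R y) = (- v) *\<^sub>R (exp (- s) *\<^sub>R y)" by simp
        then show "frechet_derivative \<phi> (at (exp (- s) *\<^sub>R y)) (v *\<^sub>R (- exp (- s) *\<^sub>R y))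
            = - euler_deriv \<phi> (exp (- s) *\<^sub>R y) * v"
          by (simp only: linear_cmul[OF lin] frechet_derivative_eq_euler[OF C]) simp
      qed
      finally have "((\<lambda>s. \<phi> (exp (- s) *\<^sub>R y)) has_real_derivative - euler_deriv \<phi> (exp (- s) *\<^sub>R y)) (at s)"
        unfolding has_field_derivative_def .
      then show ?thesis
        unfolding u_def u'_def by (auto intro!: derivative_eq_intros simp: algebra_simps)
    qed
    have cont: "isCont (\<lambda>s. u' s y) s" for s y
    proof -
      have "continuous_on UNIV (\<lambda>s. u' s y)"
        unfolding u'_def
        by (intro continuous_intros continuous_on_compose2[OF cphi] continuous_on_compose2[OF ceul]) auto
      then show ?thesis by (simp add: continuous_on_eq_continuous_at)
    qed
    have ftc: "(\<integral>s. indicator {0..t} s * u' s y \<partial>lborel) = u t y - \<phi> y" for y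
      using integral_FTC_Icc_real[OF t deriv cont, of y] by (simp add: u_def mult.commute)
    let ?G = "\<lambda>s y. (indicator {0..t} s * u' s y) *\<^sub>R h y"
    have intG: "integrable (lborel \<Otimes>\<^sub>M lborel) (\<lambda>(s, y). ?G s y)"
    proof (rule integrable_bounded_kernel[where r="exp t * r", OF h hi _ _ t])
      show "case_prod u' \<in> borel_measurable (borel \<Otimes>\<^sub>M borel)"
        unfolding u'_def[abs_def] case_prod_unfold by measurable
      fix s :: real and x :: "real ^ 'n" assume s: "0 \<le> s" "s \<le> t"
      let ?z = "exp (- s) *\<^sub>R x"
      have "(c - ?n) * s \<le> \<bar>c - ?n\<bar> * t" using s by (intro mult_mono) auto
      then have e: "exp ((c - ?n) * s) \<le> exp (\<bar>c - ?n\<bar> * t)" by simp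
      have i: "indicator (cball 0 r) ?z \<le> (indicator (cball 0 (exp t * r)) x :: real)"
      proof -
        have "norm x \<le> exp t * r" if "norm ?z \<le> r"
        proof -
          have "norm x = exp s * norm ?z" by (simp add: exp_minus)
          also have "\<dots> \<le> exp t * r" using s that by (intro mult_mono) auto
          finally show ?thesis .
        qed
        then show ?thesis by (auto simp: indicator_def)
      qed
      have B0: "0 \<le> B" using B(1)[of 0] r(1) by (auto intro: order_trans[OF abs_ge_zero])
      have "\<bar>(c - ?n) * \<phi> ?z - euler_deriv \<phi> ?z\<bar> \<le> \<bar>c - ?n\<bar> * \<bar>\<phi> ?z\<bar> + \<bar>euler_deriv \<phi> ?z\<bar>"
        by (metis abs_mult abs_triangle_ineq4)
      also have "\<dots> \<le> \<bar>c - ?n\<bar> * (B * indicator (cball 0 r) ?z) + B * indicator (cball 0 r) ?z"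
        by (intro add_mono mult_left_mono B) auto
      also have "\<dots> = (\<bar>c - ?n\<bar> + 1) * B * indicator (cball 0 r) ?z"
        by (simp add: algebra_simps)
      also have "\<dots> \<le> (\<bar>c - ?n\<bar> + 1) * B * indicator (cball 0 (exp t * r)) x"
        using i B0 by (intro mult_left_mono) auto
      finally have "\<bar>u' s x\<bar> \<le> exp (\<bar>c - ?n\<bar> * t) * ((\<bar>c - ?n\<bar> + 1) * B * indicator (cball 0 (exp t * r)) x)"
        unfolding u'_def abs_mult using e by (intro mult_mono) auto
      then show "\<bar>u' s x\<bar> \<le> (exp (\<bar>c - ?n\<bar> * t) * (\<bar>c - ?n\<bar> + 1) * B) * indicator (cball 0 (exp t * r)) x"
        by (simp add: ac_simps)
    qed (use r(1) in auto)
    have intF: "integrable (lborel \<Otimes>\<^sub>M lborel) (\<lambda>(s, x). F \<phi> s x)"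
      unfolding F_def by (rule integrable_dilated_kernel[OF q qi _ B(1) t]) (use r in auto)
    \<comment> \<open>The weak equation enters here: with the dilated test function \<open>p\<close>, the derivative \<open>u' s\<close> is
      \<open>e\<^bsup>(c - n) s\<^esup> (c p - (n p + y \<cdot> \<nabla>p))\<close>, and \<open>h\<close> integrated against \<open>n p + y \<cdot> \<nabla>p\<close> is \<open>-\<integral> p k\<close>.\<close>
    have slice: "(\<integral>y. ?G s y \<partial>lborel) = (\<integral>x. F \<phi> s x \<partial>lborel)" for s
    proof -
      let ?p = "\<lambda>y. \<phi> (exp (- s) *\<^sub>R y)"
      have tp: "test_function ?p" by (rule test_function_dilation[OF tf]) simp
      obtain r' where r': "\<And>x. x \<notin> cball 0 r' \<Longrightarrow> ?p x = 0"
        "\<And>x i. x \<notin> cball 0 r' \<Longrightarrow> partial_deriv i ?p x = 0"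
        using test_function_support[OF tp] by metis
      have ep: "euler_deriv ?p y = euler_deriv \<phi> (exp (- s) *\<^sub>R y)" for y
        by (rule euler_deriv_dilation[OF C])
      have Cp: "C_order j ?p" for j using tp by (simp add: test_function_def)
      have rep: "euler_deriv ?p x = 0" if "x \<notin> cball 0 r'" for x
        using r'(2)[OF that] by (simp add: euler_deriv_def)
      have i1: "integrable lborel (\<lambda>y. ?p y *\<^sub>R h y)"
        by (rule integrable_continuous_times_locally_integrable[where K="cball 0 r'", OF locally_integrableI[OF h hi] h C_order_continuous[OF Cp[of 0]] r'(1)]) auto
      have i2: "integrable lborel (\<lambda>y. ?p y *\<^sub>R k y)"
        by (rule integrable_continuous_times_locally_integrable[where K="cball 0 r'", OF locally_integrableI[OF k ki] k C_order_continuous[OF Cp[of 0]] r'(1)]) auto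
      have i3: "integrable lborel (\<lambda>y. euler_deriv ?p y *\<^sub>R h y)"
        by (rule integrable_continuous_times_locally_integrable[where K="cball 0 r'", OF locally_integrableI[OF h hi] h continuous_euler_deriv[OF Cp] rep]) auto
      have i4: "integrable lborel (\<lambda>y. (?n * ?p y + euler_deriv ?p y) *\<^sub>R h y)"
        using Bochner_Integration.integrable_add[OF integrable_scaleR_right[OF i1, of ?n] i3]
        by (simp add: algebra_simps)
      have "(\<integral>y. u' s y *\<^sub>R h y \<partial>lborel)
          = (\<integral>y. exp ((c - ?n) * s) *\<^sub>R (c *\<^sub>R (?p y *\<^sub>R h y) - (?n * ?p y + euler_deriv ?p y) *\<^sub>R h y) \<partial>lborel)"
        unfolding u'_def ep by (intro Bochner_Integration.integral_cong) (auto simp: algebra_simps)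
      also have "\<dots> = exp ((c - ?n) * s) *\<^sub>R (c *\<^sub>R (\<integral>y. ?p y *\<^sub>R h y \<partial>lborel)
          - (\<integral>y. (?n * ?p y + euler_deriv ?p y) *\<^sub>R h y \<partial>lborel))"
        using i1 i4 by (simp del: scaleR_scaleR)
      also have "\<dots> = exp ((c - ?n) * s) *\<^sub>R (c *\<^sub>R (\<integral>y. ?p y *\<^sub>R h y \<partial>lborel) + (\<integral>y. ?p y *\<^sub>R k y \<partial>lborel))"
        by (simp only: euler[OF tp]) simp
      also have "\<dots> = exp ((c - ?n) * s) *\<^sub>R (\<integral>y. ?p y *\<^sub>R q y \<partial>lborel)"
      proof -
        have "(\<integral>y. ?p y *\<^sub>R q y \<partial>lborel) = (\<integral>y. c *\<^sub>R (?p y *\<^sub>R h y) + ?p y *\<^sub>R k y \<partial>lborel)"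
          by (intro Bochner_Integration.integral_cong) (auto simp: q_def algebra_simps)
        also have "\<dots> = c *\<^sub>R (\<integral>y. ?p y *\<^sub>R h y \<partial>lborel) + (\<integral>y. ?p y *\<^sub>R k y \<partial>lborel)"
          using i1 i2 by (simp del: scaleR_scaleR)
        finally show ?thesis by simp
      qed
      also have "\<dots> = exp (c * s) *\<^sub>R (\<integral>x. \<phi> x *\<^sub>R q (exp s *\<^sub>R x) \<partial>lborel)"
        by (subst integral_test_function_times_dilated[OF q cphi]) (simp add: left_diff_distrib exp_diff exp_minus field_simps)
      finally have "indicator {0..t} s *\<^sub>R (\<integral>y. u' s y *\<^sub>R h y \<partial>lborel)
          = indicator {0..t} s *\<^sub>R exp (c * s) *\<^sub>R (\<integral>x. \<phi> x *\<^sub>R q (exp s *\<^sub>R x) \<partial>lborel)" by simp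
      then show ?thesis
        unfolding F_def by (simp add: integral_scaleR_right[symmetric] scaleR_scaleR[symmetric] del: scaleR_scaleR integral_scaleR_right)
    qed
    have "(\<integral>x. \<phi> x *\<^sub>R I x \<partial>lborel) = (\<integral>s. (\<integral>x. F \<phi> s x \<partial>lborel) \<partial>lborel)"
      using lborel_pair.Fubini_integral[OF intF] by (simp add: FI)
    also have "\<dots> = (\<integral>s. (\<integral>y. ?G s y \<partial>lborel) \<partial>lborel)"
      by (simp only: slice)
    also have "\<dots> = (\<integral>y. (\<integral>s. ?G s y \<partial>lborel) \<partial>lborel)"
      using lborel_pair.Fubini_integral[OF intG] by simp
    also have "\<dots> = (\<integral>y. u t y *\<^sub>R h y - \<phi> y *\<^sub>R h y \<partial>lborel)"
    proof (intro Bochner_Integration.integral_cong refl)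
      fix y
      have "(\<integral>s. ?G s y \<partial>lborel) = (\<integral>s. indicator {0..t} s * u' s y \<partial>lborel) *\<^sub>R h y"
      proof (rule integral_scaleR_left)
        show "integrable lborel (\<lambda>s. indicator {0..t} s * u' s y)"
          using has_bochner_integral_FTC_Icc_real[OF t deriv cont, of y]
          by (simp add: has_bochner_integral_iff mult.commute)
      qed
      then show "(\<integral>s. ?G s y \<partial>lborel) = u t y *\<^sub>R h y - \<phi> y *\<^sub>R h y"
        by (simp only: ftc scaleR_diff_left)
    qed
    finally have main: "(\<integral>x. \<phi> x *\<^sub>R I x \<partial>lborel) = (\<integral>y. u t y *\<^sub>R h y - \<phi> y *\<^sub>R h y \<partial>lborel)" .
    have fin: "integrable lborel (\<lambda>x. \<phi> x *\<^sub>R I x)"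
      using lborel_pair.integrable_snd[OF intF] unfolding FI .
    have tp: "test_function (\<lambda>y. \<phi> (exp (- t) *\<^sub>R y))" by (rule test_function_dilation[OF tf]) simp
    obtain r' where r': "\<And>x. x \<notin> cball 0 r' \<Longrightarrow> \<phi> (exp (- t) *\<^sub>R x) = 0"
      using test_function_support[OF tp] by metis
    have ctp: "continuous_on UNIV (\<lambda>y. \<phi> (exp (- t) *\<^sub>R y))"
      using tp C_order_continuous unfolding test_function_def by blast
    have i0: "integrable lborel (\<lambda>y. \<phi> (exp (- t) *\<^sub>R y) *\<^sub>R h y)"
      by (rule integrable_continuous_times_locally_integrable[where K="cball 0 r'", OF locally_integrableI[OF h hi] h ctp r']) auto
    have iu: "integrable lborel (\<lambda>y. u t y *\<^sub>R h y)"
      using integrable_scaleR_right[OF i0, of "exp ((c - ?n) * t)"] by (simp add: u_def)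
    have ip: "integrable lborel (\<lambda>y. \<phi> y *\<^sub>R h y)"
      by (rule integrable_continuous_times_locally_integrable[where K="cball 0 r", OF locally_integrableI[OF h hi] h cphi r(2)]) auto
    have iht: "integrable lborel (\<lambda>x. \<phi> x *\<^sub>R h (exp t *\<^sub>R x))"
    proof -
      have "integrable (distr lborel lborel (\<lambda>x. exp t *\<^sub>R x)) (\<lambda>y. \<phi> (exp (- t) *\<^sub>R y) *\<^sub>R h y)"
        using integrable_scaleR_right[OF i0, of "inverse (exp t) ^ CARD('n)"]
        by (subst distr_dilation) (auto simp: integrable_density)
      from integrable_distr[OF _ this] show ?thesis by (simp add: exp_minus)
    qed
    have "(\<integral>x. \<phi> x *\<^sub>R f x \<partial>lborel)
        = (\<integral>x. exp (c * t) *\<^sub>R (\<phi> x *\<^sub>R h (exp t *\<^sub>R x)) - \<phi> x *\<^sub>R h x - \<phi> x *\<^sub>R I x \<partial>lborel)"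
      by (intro Bochner_Integration.integral_cong) (auto simp: f_def algebra_simps)
    also have "\<dots> = exp (c * t) *\<^sub>R (\<integral>x. \<phi> x *\<^sub>R h (exp t *\<^sub>R x) \<partial>lborel) - (\<integral>x. \<phi> x *\<^sub>R h x \<partial>lborel)
        - (\<integral>x. \<phi> x *\<^sub>R I x \<partial>lborel)"
      using iht ip fin by (simp del: scaleR_scaleR)
    also have "exp (c * t) *\<^sub>R (\<integral>x. \<phi> x *\<^sub>R h (exp t *\<^sub>R x) \<partial>lborel) = (\<integral>y. u t y *\<^sub>R h y \<partial>lborel)"
    proof -
      have "(\<integral>y. u t y *\<^sub>R h y \<partial>lborel) = exp ((c - ?n) * t) *\<^sub>R (\<integral>y. \<phi> (exp (- t) *\<^sub>R y) *\<^sub>R h y \<partial>lborel)"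
        unfolding u_def scaleR_scaleR[symmetric] by (rule integral_scaleR_right)
      then show ?thesis
        by (subst integral_test_function_times_dilated[OF h cphi])
           (simp add: exp_add[symmetric] algebra_simps)
    qed
    also have "(\<integral>x. \<phi> x *\<^sub>R I x \<partial>lborel) = (\<integral>y. u t y *\<^sub>R h y \<partial>lborel) - (\<integral>x. \<phi> x *\<^sub>R h x \<partial>lborel)"
      unfolding main using iu ip by simp
    finally show "(\<integral>x. \<phi> x *\<^sub>R f x \<partial>lborel) = 0" by simp
  qed
  then show ?thesis
    by eventually_elim (simp add: f_def I_def q_def)
qed

section \<open>Functions along a measure-preserving flow\<close>

text \<open>The Cauchy--Schwarz inequality against the constant 1 on \<open>A\<close>. If \<open>f\<close> is not integrable on \<open>A\<close>, the Bochner
  integral on the left is 0.\<close>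

lemma norm_set_integral_squared_le:
  fixes f :: "'a \<Rightarrow> 'b::{banach, second_countable_topology}"
  assumes [measurable]: "f \<in> borel_measurable M" "A \<in> sets M"
  shows "ennreal ((norm (\<integral>x. indicator A x *\<^sub>R f x \<partial>M))\<^sup>2)
     \<le> emeasure M A * (\<integral>\<^sup>+x. indicator A x * ennreal ((norm (f x))\<^sup>2) \<partial>M)"
proof (cases "integrable M (\<lambda>x. indicator A x *\<^sub>R f x)")
  case True
  have "ennreal ((norm (\<integral>x. indicator A x *\<^sub>R f x \<partial>M))\<^sup>2)
      = (ennreal (norm (\<integral>x. indicator A x *\<^sub>R f x \<partial>M)))\<^sup>2"
    by (simp add: ennreal_power)
  also have "\<dots> \<le> (\<integral>\<^sup>+x. ennreal (norm (indicator A x *\<^sub>R f x)) \<partial>M)\<^sup>2"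
    by (intro power_mono integral_norm_bound_ennreal True) auto
  also have "(\<integral>\<^sup>+x. ennreal (norm (indicator A x *\<^sub>R f x)) \<partial>M)
      = (\<integral>\<^sup>+x. (indicator A x * ennreal (norm (f x))) * indicator A x \<partial>M)"
    by (intro nn_integral_cong) (auto simp: indicator_def)
  also have "\<dots>\<^sup>2 \<le> (\<integral>\<^sup>+x. (indicator A x * ennreal (norm (f x)))\<^sup>2 \<partial>M) * (\<integral>\<^sup>+x. (indicator A x)\<^sup>2 \<partial>M)"
    by (rule Cauchy_Schwarz_nn_integral) measurable
  also have "(\<integral>\<^sup>+x. (indicator A x)\<^sup>2 \<partial>M) = (\<integral>\<^sup>+x. indicator A x \<partial>M)"
    by (intro nn_integral_cong) (auto simp: indicator_def)
  also have "(\<integral>\<^sup>+x. (indicator A x * ennreal (norm (f x)))\<^sup>2 \<partial>M)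
      = (\<integral>\<^sup>+x. indicator A x * ennreal ((norm (f x))\<^sup>2) \<partial>M)"
    by (intro nn_integral_cong) (auto simp: indicator_def ennreal_power)
  finally show ?thesis by (simp add: mult.commute)
qed (simp add: not_integrable_integral_eq)

lemma abs_inner_le_weighted:
  fixes u v :: "'a::real_inner"
  assumes "0 < e"
  shows "\<bar>inner u v\<bar> \<le> (inverse e * (norm u)\<^sup>2 + e * (norm v)\<^sup>2) / 2"
proof -
  have "0 \<le> (norm u - e * norm v)\<^sup>2" by simp
  then have "2 * e * (norm u * norm v) \<le> (norm u)\<^sup>2 + e\<^sup>2 * (norm v)\<^sup>2"
    by (simp add: power2_diff power_mult_distrib algebra_simps)
  then have "norm u * norm v \<le> (inverse e * (norm u)\<^sup>2 + e * (norm v)\<^sup>2) / 2"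
    using assms by (simp add: field_simps power2_eq_square)
  then show ?thesis using Cauchy_Schwarz_ineq2[of u v] by linarith
qed

lemma integrable_inner_square_integrable:
  fixes f g :: "'a \<Rightarrow> 'b::{real_inner, banach, second_countable_topology}"
  assumes [measurable]: "f \<in> borel_measurable M" "g \<in> borel_measurable M"
    and "integrable M (\<lambda>x. (norm (f x))\<^sup>2)" "integrable M (\<lambda>x. (norm (g x))\<^sup>2)"
  shows "integrable M (\<lambda>x. inner (f x) (g x))"
proof (rule Bochner_Integration.integrable_bound[OF Bochner_Integration.integrable_add[OF assms(3,4)]])
  show "AE x in M. norm (inner (f x) (g x)) \<le> norm ((norm (f x))\<^sup>2 + (norm (g x))\<^sup>2)"
  proof (rule AE_I2)
    fix x
    have "\<bar>inner (f x) (g x)\<bar> \<le> ((norm (f x))\<^sup>2 + (norm (g x))\<^sup>2) / 2"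
      using abs_inner_le_weighted[of 1 "f x" "g x"] by simp
    also have "\<dots> \<le> (norm (f x))\<^sup>2 + (norm (g x))\<^sup>2" by simp
    finally show "norm (inner (f x) (g x)) \<le> norm ((norm (f x))\<^sup>2 + (norm (g x))\<^sup>2)" by simp
  qed
qed measurable

lemma abs_integral_le:
  fixes f g :: "'a \<Rightarrow> real"
  assumes "integrable M f" "integrable M g" "\<And>x. \<bar>f x\<bar> \<le> g x"
  shows "\<bar>\<integral>x. f x \<partial>M\<bar> \<le> (\<integral>x. g x \<partial>M)"
  by (rule order_trans[OF integral_abs_bound integral_mono]) (use assms in auto)

text \<open>If \<open>V\<close> is the derivative of \<open>W\<close> along a flow that preserves \<open>M\<close>, then \<open>2 \<langle>W, V\<rangle>\<close> is the derivative of
  \<open>|W|\<^sup>2\<close>, whose integral is constant in time. Differentiability holds only in integrated form, so the argument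
  is quantitative. Write \<open>W\<^sub>s\<close> for \<open>W \<circ> T s\<close>, \<open>I\<close> for the integral of \<open>\<langle>W, V\<rangle>\<close> and \<open>N\<close> for that of
  \<open>|V|\<^sup>2\<close>. By invariance \<open>0 = 2 \<integral>\<langle>W, W\<^sub>s - W\<rangle> + \<integral>|W\<^sub>s - W|\<^sup>2\<close>; here the first term is
  \<open>2 s I\<close> up to an error of order \<open>s\<^sup>2 N\<close> and the second is at most \<open>s\<^sup>2 N\<close>. Dividing by \<open>s\<close> and letting
  it tend to 0 gives \<open>I = 0\<close>.\<close>

lemma integral_inner_flow_derivative_eq_0:
  fixes M :: "'a measure" and T :: "real \<Rightarrow> 'a \<Rightarrow> 'a"
    and W V :: "'a \<Rightarrow> 'b::{real_inner, banach, second_countable_topology}"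
  assumes "sigma_finite_measure M"
    and T[measurable]: "(\<lambda>(s, x). T s x) \<in> borel \<Otimes>\<^sub>M M \<rightarrow>\<^sub>M M"
    and T0: "\<And>x. T 0 x = x" and inv: "\<And>s. distr M M (T s) = M"
    and [measurable]: "W \<in> borel_measurable M" "V \<in> borel_measurable M"
    and W2: "integrable M (\<lambda>x. (norm (W x))\<^sup>2)" and V2: "integrable M (\<lambda>x. (norm (V x))\<^sup>2)"
    and flow: "\<And>s. 0 < s \<Longrightarrow>
        AE x in M. W (T s x) - W x = (\<integral>\<tau>. indicator {0..s} \<tau> *\<^sub>R V (T \<tau> x) \<partial>lborel)"
  shows "(\<integral>x. inner (W x) (V x) \<partial>M) = 0"
proof -
  interpret M: sigma_finite_measure M by fact
  interpret P: pair_sigma_finite lborel M ..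
  define N where "N = (\<integral>x. (norm (V x))\<^sup>2 \<partial>M)"
  define I where "I = (\<integral>x. inner (W x) (V x) \<partial>M)"
  define J where "J \<tau> = (\<integral>x. inner (W x) (V (T \<tau> x)) \<partial>M)" for \<tau>
  have N0: "0 \<le> N" unfolding N_def by simp
  have Ts[measurable]: "T s \<in> M \<rightarrow>\<^sub>M M" for s
    using measurable_Pair2[OF T, of s] by simp
  have inv_integrable: "integrable M (\<lambda>x. F (T s x))" if "integrable M F"
    for F :: "'a \<Rightarrow> real" and s
    using integrable_distr[OF Ts[of s], of F] that inv by simp
  have inv_integral: "(\<integral>x. F (T s x) \<partial>M) = (\<integral>x. F x \<partial>M)" if "F \<in> borel_measurable M"
    for F :: "'a \<Rightarrow> real" and s
    using integral_distr[OF Ts[of s] that] inv by simp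
  have inv_nn: "(\<integral>\<^sup>+x. F (T s x) \<partial>M) = (\<integral>\<^sup>+x. F x \<partial>M)" if "F \<in> borel_measurable M"
    for F :: "'a \<Rightarrow> ennreal" and s
    using nn_integral_distr[OF Ts[of s], of F] that inv by simp
  have Ws2: "integrable M (\<lambda>x. (norm (W (T s x)))\<^sup>2)" and Vs2: "integrable M (\<lambda>x. (norm (V (T s x)))\<^sup>2)" for s
    using inv_integrable W2 V2 by blast+
  have Vs2_eq: "(\<integral>x. (norm (V (T s x)))\<^sup>2 \<partial>M) = N" for s
    unfolding N_def by (rule inv_integral) measurable
  have nnV: "(\<integral>\<^sup>+x. ennreal ((norm (V (T s x)))\<^sup>2) \<partial>M) = ennreal N" for s
    using Vs2[of s] by (simp add: nn_integral_eq_integral Vs2_eq)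
  have D2: "integrable M (\<lambda>x. (norm (W (T s x) - W x))\<^sup>2)" for s
  proof (rule Bochner_Integration.integrable_bound)
    show "integrable M (\<lambda>x. 2 * (norm (W (T s x)))\<^sup>2 + 2 * (norm (W x))\<^sup>2)"
      using Ws2 W2 by simp
    show "AE x in M. norm ((norm (W (T s x) - W x))\<^sup>2) \<le> norm (2 * (norm (W (T s x)))\<^sup>2 + 2 * (norm (W x))\<^sup>2)"
    proof (rule AE_I2)
      fix x
      have "(norm (W (T s x) - W x))\<^sup>2 \<le> (norm (W (T s x)) + norm (W x))\<^sup>2"
        by (intro power_mono norm_triangle_ineq4) auto
      also have "\<dots> \<le> 2 * (norm (W (T s x)))\<^sup>2 + 2 * (norm (W x))\<^sup>2"
        using sum_squares_bound[of "norm (W (T s x))" "norm (W x)"] by (simp add: power2_sum)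
      finally show "norm ((norm (W (T s x) - W x))\<^sup>2) \<le> norm (2 * (norm (W (T s x)))\<^sup>2 + 2 * (norm (W x))\<^sup>2)"
        by simp
    qed
  qed measurable
  have tonelli: "(\<integral>\<^sup>+x. \<integral>\<^sup>+\<tau>. indicator {0..s} \<tau> * ennreal ((norm (V (T \<tau> x)))\<^sup>2) \<partial>lborel \<partial>M)
      = ennreal s * ennreal N" if "0 \<le> s" for s
  proof -
    have "(\<integral>\<^sup>+x. \<integral>\<^sup>+\<tau>. indicator {0..s} \<tau> * ennreal ((norm (V (T \<tau> x)))\<^sup>2) \<partial>lborel \<partial>M)
        = (\<integral>\<^sup>+\<tau>. \<integral>\<^sup>+x. indicator {0..s} \<tau> * ennreal ((norm (V (T \<tau> x)))\<^sup>2) \<partial>M \<partial>lborel)"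
      by (rule P.Fubini') measurable
    also have "\<dots> = (\<integral>\<^sup>+\<tau>. ennreal N * indicator {0..s} \<tau> \<partial>lborel)"
      by (intro nn_integral_cong) (simp add: nn_integral_cmult nnV mult.commute)
    also have "\<dots> = ennreal s * ennreal N"
      using that by (simp add: nn_integral_cmult mult.commute)
    finally show ?thesis .
  qed
  have lipschitz: "(\<integral>x. (norm (W (T s x) - W x))\<^sup>2 \<partial>M) \<le> s\<^sup>2 * N" if s: "0 < s" for s
  proof -
    have "(\<integral>\<^sup>+x. ennreal ((norm (W (T s x) - W x))\<^sup>2) \<partial>M)
      = (\<integral>\<^sup>+x. ennreal ((norm (\<integral>\<tau>. indicator {0..s} \<tau> *\<^sub>R V (T \<tau> x) \<partial>lborel))\<^sup>2) \<partial>M)"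
      by (rule nn_integral_cong_AE, use flow[OF s] in eventually_elim) simp
    also have "\<dots> \<le> (\<integral>\<^sup>+x. ennreal s * (\<integral>\<^sup>+\<tau>. indicator {0..s} \<tau> * ennreal ((norm (V (T \<tau> x)))\<^sup>2) \<partial>lborel) \<partial>M)"
    proof (rule nn_integral_mono)
      fix x assume "x \<in> space M"
      then have "(\<lambda>\<tau>. V (T \<tau> x)) \<in> borel_measurable lborel" by measurable
      from norm_set_integral_squared_le[OF this, of "{0..s}"]
      show "ennreal ((norm (\<integral>\<tau>. indicator {0..s} \<tau> *\<^sub>R V (T \<tau> x) \<partial>lborel))\<^sup>2)
        \<le> ennreal s * (\<integral>\<^sup>+\<tau>. indicator {0..s} \<tau> * ennreal ((norm (V (T \<tau> x)))\<^sup>2) \<partial>lborel)"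
        using s by simp
    qed
    also have "\<dots> = ennreal s * (\<integral>\<^sup>+x. \<integral>\<^sup>+\<tau>. indicator {0..s} \<tau> * ennreal ((norm (V (T \<tau> x)))\<^sup>2) \<partial>lborel \<partial>M)"
      by (rule nn_integral_cmult) measurable
    also have "\<dots> = ennreal (s\<^sup>2 * N)"
      using s N0 by (simp only: tonelli less_imp_le)
        (simp add: ennreal_mult[symmetric] power2_eq_square mult.assoc)
    finally have "ennreal (\<integral>x. (norm (W (T s x) - W x))\<^sup>2 \<partial>M) \<le> ennreal (s\<^sup>2 * N)"
      using D2[of s] by (simp add: nn_integral_eq_integral)
    then show ?thesis using N0 by (simp add: ennreal_le_iff)
  qed
  \<comment> \<open>By invariance \<open>I = \<integral>\<langle>W\<^sub>\<tau>, V\<^sub>\<tau>\<rangle>\<close>. The difference to \<open>J \<tau>\<close> thus pairs \<open>W\<^sub>\<tau> - W\<close>, whose norm is of order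
    \<open>\<tau>\<close>, with \<open>V\<^sub>\<tau>\<close>, whose norm is constant. The weight \<open>\<tau>\<close> balances the two squares.\<close>
  have J_close: "\<bar>J \<tau> - I\<bar> \<le> \<tau> * N" if \<tau>: "0 < \<tau>" for \<tau>
  proof -
    have i1: "integrable M (\<lambda>x. inner (W x) (V (T \<tau> x)))" and i2: "integrable M (\<lambda>x. inner (W (T \<tau> x)) (V (T \<tau> x)))"
      by (intro integrable_inner_square_integrable W2 Vs2 Ws2; measurable)+
    have "I = (\<integral>x. inner (W (T \<tau> x)) (V (T \<tau> x)) \<partial>M)"
      unfolding I_def by (rule inv_integral[symmetric]) measurable
    then have "I - J \<tau> = (\<integral>x. inner (W (T \<tau> x) - W x) (V (T \<tau> x)) \<partial>M)"
      using i1 i2 by (simp add: J_def inner_diff_left)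
    also have "\<bar>\<dots>\<bar> \<le> (\<integral>x. (inverse \<tau> * (norm (W (T \<tau> x) - W x))\<^sup>2 + \<tau> * (norm (V (T \<tau> x)))\<^sup>2) / 2 \<partial>M)"
    proof (rule abs_integral_le)
      show "integrable M (\<lambda>x. inner (W (T \<tau> x) - W x) (V (T \<tau> x)))"
        using i1 i2 by (simp add: inner_diff_left)
      show "integrable M (\<lambda>x. (inverse \<tau> * (norm (W (T \<tau> x) - W x))\<^sup>2 + \<tau> * (norm (V (T \<tau> x)))\<^sup>2) / 2)"
        using D2 Vs2 by simp
    qed (rule abs_inner_le_weighted[OF \<tau>])
    also have "\<dots> = (inverse \<tau> * (\<integral>x. (norm (W (T \<tau> x) - W x))\<^sup>2 \<partial>M) + \<tau> * N) / 2"
      using D2 Vs2 by (simp add: Vs2_eq)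
    also have "\<dots> \<le> (inverse \<tau> * (\<tau>\<^sup>2 * N) + \<tau> * N) / 2"
      using lipschitz[OF \<tau>] \<tau> by (intro divide_right_mono add_right_mono mult_left_mono) auto
    also have "\<dots> = \<tau> * N"
      using \<tau> by (simp add: power2_eq_square)
    finally show ?thesis by (simp add: abs_minus_commute)
  qed
  have bound: "\<bar>I\<bar> \<le> 2 * N * s" if s: "0 < s" for s
  proof -
    have i: "integrable lborel (indicator {0..s} :: real \<Rightarrow> real)"
      by (rule integrable_real_indicator) (use s in auto)
    let ?k = "\<lambda>\<tau> x. indicator {0..s} \<tau> * inner (W x) (V (T \<tau> x))"
    have int2: "integrable (lborel \<Otimes>\<^sub>M M) (\<lambda>(\<tau>, x). indicator {0..s} \<tau> * (norm (V (T \<tau> x)))\<^sup>2)"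
    proof (rule integrableI_bounded)
      have "(\<integral>\<^sup>+z. ennreal (norm (case z of (\<tau>, x) \<Rightarrow> indicator {0..s} \<tau> * (norm (V (T \<tau> x)))\<^sup>2)) \<partial>(lborel \<Otimes>\<^sub>M M))
        = (\<integral>\<^sup>+x. \<integral>\<^sup>+\<tau>. indicator {0..s} \<tau> * ennreal ((norm (V (T \<tau> x)))\<^sup>2) \<partial>lborel \<partial>M)"
        by (subst P.nn_integral_snd[symmetric])
           (auto intro!: nn_integral_cong simp: indicator_def)
      also have "\<dots> < \<infinity>" using s by (simp add: tonelli ennreal_mult_less_top)
      finally show "(\<integral>\<^sup>+z. ennreal (norm (case z of (\<tau>, x) \<Rightarrow> indicator {0..s} \<tau> * (norm (V (T \<tau> x)))\<^sup>2)) \<partial>(lborel \<Otimes>\<^sub>M M)) < \<infinity>" .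
    qed measurable
    have int1: "integrable (lborel \<Otimes>\<^sub>M M) (\<lambda>(\<tau>, x). indicator {0..s} \<tau> * (norm (W x))\<^sup>2)"
    proof (rule integrableI_bounded)
      have "(\<integral>\<^sup>+z. ennreal (norm (case z of (\<tau>, x) \<Rightarrow> indicator {0..s} \<tau> * (norm (W x))\<^sup>2)) \<partial>(lborel \<Otimes>\<^sub>M M))
        = (\<integral>\<^sup>+x. \<integral>\<^sup>+\<tau>. ennreal ((norm (W x))\<^sup>2) * indicator {0..s} \<tau> \<partial>lborel \<partial>M)"
        by (subst P.nn_integral_snd[symmetric])
           (auto intro!: nn_integral_cong simp: indicator_def)
      also have "\<dots> = (\<integral>\<^sup>+x. ennreal ((norm (W x))\<^sup>2) \<partial>M) * ennreal s"
        using s by (simp add: nn_integral_cmult nn_integral_multc)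
      also have "\<dots> < \<infinity>" using W2 by (simp add: nn_integral_eq_integral ennreal_mult_less_top)
      finally show "(\<integral>\<^sup>+z. ennreal (norm (case z of (\<tau>, x) \<Rightarrow> indicator {0..s} \<tau> * (norm (W x))\<^sup>2)) \<partial>(lborel \<Otimes>\<^sub>M M)) < \<infinity>" .
    qed measurable
    have intk: "integrable (lborel \<Otimes>\<^sub>M M) (\<lambda>(\<tau>, x). ?k \<tau> x)"
    proof (rule Bochner_Integration.integrable_bound[OF Bochner_Integration.integrable_add[OF int1 int2]])
      show "AE z in lborel \<Otimes>\<^sub>M M. norm (case z of (\<tau>, x) \<Rightarrow> ?k \<tau> x)
        \<le> norm ((case z of (\<tau>, x) \<Rightarrow> indicator {0..s} \<tau> * (norm (W x))\<^sup>2) + (case z of (\<tau>, x) \<Rightarrow> indicator {0..s} \<tau> * (norm (V (T \<tau> x)))\<^sup>2))"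
      proof (rule AE_I2, clarify)
        fix \<tau> x
        have "\<bar>inner (W x) (V (T \<tau> x))\<bar> \<le> ((norm (W x))\<^sup>2 + (norm (V (T \<tau> x)))\<^sup>2) / 2"
          using abs_inner_le_weighted[of 1 "W x" "V (T \<tau> x)"] by simp
        also have "\<dots> \<le> (norm (W x))\<^sup>2 + (norm (V (T \<tau> x)))\<^sup>2" by simp
        finally show "norm (?k \<tau> x) \<le> norm (indicator {0..s} \<tau> * (norm (W x))\<^sup>2 + indicator {0..s} \<tau> * (norm (V (T \<tau> x)))\<^sup>2)"
          by (auto simp: indicator_def)
      qed
    qed measurable
    have "AE x in M. integrable lborel (\<lambda>\<tau>. indicator {0..s} \<tau> * (norm (V (T \<tau> x)))\<^sup>2)"
      using P.AE_integrable_snd[OF int2] .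
    then have int_AE: "AE x in M. integrable lborel (\<lambda>\<tau>. indicator {0..s} \<tau> *\<^sub>R V (T \<tau> x))"
      using AE_space
    proof eventually_elim
      case (elim x)
      note [simp] = \<open>x \<in> space M\<close>
      show ?case
      proof (rule Bochner_Integration.integrable_bound[OF Bochner_Integration.integrable_add[OF elim(1) i]])
        show "AE \<tau> in lborel. norm (indicator {0..s} \<tau> *\<^sub>R V (T \<tau> x))
          \<le> norm (indicator {0..s} \<tau> * (norm (V (T \<tau> x)))\<^sup>2 + indicator {0..s} \<tau>)"
        proof (rule AE_I2)
          fix \<tau>
          have "0 \<le> (norm (V (T \<tau> x)) - 1)\<^sup>2" by simp
          then have "norm (V (T \<tau> x)) * 2 \<le> (norm (V (T \<tau> x)))\<^sup>2 + 1"
            by (simp add: power2_diff)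
          then have "norm (V (T \<tau> x)) \<le> (norm (V (T \<tau> x)))\<^sup>2 + 1"
            using norm_ge_zero[of "V (T \<tau> x)"] by linarith
          then show "norm (indicator {0..s} \<tau> *\<^sub>R V (T \<tau> x))
          \<le> norm (indicator {0..s} \<tau> * (norm (V (T \<tau> x)))\<^sup>2 + indicator {0..s} \<tau>)"
            by (auto simp: indicator_def)
        qed
        have "(\<lambda>\<tau>. V (T \<tau> x)) \<in> borel_measurable lborel" using \<open>x \<in> space M\<close> by measurable
        then show "(\<lambda>\<tau>. indicator {0..s} \<tau> *\<^sub>R V (T \<tau> x)) \<in> borel_measurable lborel" by measurable
      qed
    qed
    have mD: "(\<lambda>x. inner (W x) (W (T s x) - W x)) \<in> borel_measurable M" by measurable
    have "(\<integral>x. inner (W x) (W (T s x) - W x) \<partial>M) = (\<integral>x. (\<integral>\<tau>. ?k \<tau> x \<partial>lborel) \<partial>M)"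
    proof (rule integral_cong_AE[OF mD])
      show "AE x in M. inner (W x) (W (T s x) - W x) = (\<integral>\<tau>. ?k \<tau> x \<partial>lborel)"
        using flow[OF s] int_AE
      proof eventually_elim
        case (elim x)
        then show ?case by (simp flip: integral_inner_right)
      qed
    qed (use borel_measurable_integrable[OF P.integrable_snd[OF intk]] in simp)
    also have "\<dots> = (\<integral>\<tau>. indicator {0..s} \<tau> * J \<tau> \<partial>lborel)"
      using P.Fubini_integral[OF intk] by (simp add: J_def)
    finally have cross: "(\<integral>x. inner (W x) (W (T s x) - W x) \<partial>M) = (\<integral>\<tau>. indicator {0..s} \<tau> * J \<tau> \<partial>lborel)" .
    have intJ: "integrable lborel (\<lambda>\<tau>. indicator {0..s} \<tau> * J \<tau>)"
      using P.integrable_fst[OF intk] by (simp add: J_def)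
    have iD: "integrable M (\<lambda>x. inner (W x) (W (T s x) - W x))"
      by (intro integrable_inner_square_integrable W2 D2; measurable)
    have "(\<integral>x. (norm (W x))\<^sup>2 \<partial>M) = (\<integral>x. (norm (W (T s x)))\<^sup>2 \<partial>M)"
      by (rule inv_integral[symmetric]) measurable
    also have "\<dots> = (\<integral>x. (norm (W x))\<^sup>2 + 2 * inner (W x) (W (T s x) - W x) + (norm (W (T s x) - W x))\<^sup>2 \<partial>M)"
      by (intro Bochner_Integration.integral_cong refl)
         (simp add: power2_norm_eq_inner inner_diff_left inner_diff_right inner_commute)
    also have "\<dots> = (\<integral>x. (norm (W x))\<^sup>2 \<partial>M) + 2 * (\<integral>x. inner (W x) (W (T s x) - W x) \<partial>M)
        + (\<integral>x. (norm (W (T s x) - W x))\<^sup>2 \<partial>M)"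
      using W2 iD D2 by simp
    finally have zero: "2 * (\<integral>\<tau>. indicator {0..s} \<tau> * J \<tau> \<partial>lborel) + (\<integral>x. (norm (W (T s x) - W x))\<^sup>2 \<partial>M) = 0"
      unfolding cross by simp
    have "(\<integral>\<tau>. indicator {0..s} \<tau> * J \<tau> \<partial>lborel) - s * I = (\<integral>\<tau>. indicator {0..s} \<tau> * J \<tau> - indicator {0..s} \<tau> * I \<partial>lborel)"
      using intJ s integrable_mult_left[OF i, of I] by simp
    also have "\<bar>\<dots>\<bar> \<le> (\<integral>\<tau>. indicator {0..s} \<tau> * (s * N) \<partial>lborel)"
    proof (rule abs_integral_le)
      show "integrable lborel (\<lambda>\<tau>. indicator {0..s} \<tau> * J \<tau> - indicator {0..s} \<tau> * I)"
        using intJ integrable_mult_left[OF i, of I] by simp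
      show "integrable lborel (\<lambda>\<tau>. indicator {0..s} \<tau> * (s * N))"
        using integrable_mult_left[OF i] by simp
      fix \<tau> :: real
      have "\<bar>J \<tau> - I\<bar> \<le> s * N" if "0 \<le> \<tau>" "\<tau> \<le> s"
      proof (cases "\<tau> = 0")
        case True
        then show ?thesis using s N0 by (simp add: J_def I_def T0)
      next
        case False
        then have "\<bar>J \<tau> - I\<bar> \<le> \<tau> * N" using that by (intro J_close) simp
        also have "\<dots> \<le> s * N" using that N0 by (intro mult_right_mono) auto
        finally show ?thesis .
      qed
      then show "\<bar>indicator {0..s} \<tau> * J \<tau> - indicator {0..s} \<tau> * I\<bar> \<le> indicator {0..s} \<tau> * (s * N)"
        by (auto simp: indicator_def)
    qed
    also have "\<dots> = s * (s * N)" using s by simp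
    finally have "\<bar>(\<integral>\<tau>. indicator {0..s} \<tau> * J \<tau> \<partial>lborel) - s * I\<bar> \<le> s * (s * N)" .
    moreover have "(\<integral>x. (norm (W (T s x) - W x))\<^sup>2 \<partial>M) \<le> s * (s * N)"
      using lipschitz[OF s] by (simp add: power2_eq_square mult.assoc)
    moreover have "0 \<le> (\<integral>x. (norm (W (T s x) - W x))\<^sup>2 \<partial>M)" by simp
    moreover have "0 \<le> s * (s * N)" using s N0 by simp
    ultimately have "\<bar>s * I\<bar> \<le> 2 * (s * (s * N))"
      using zero by linarith
    then have "s * \<bar>I\<bar> \<le> s * (2 * N * s)"
      using s by (simp add: abs_mult ac_simps)
    then show ?thesis using s by simp
  qed
  have "\<bar>I\<bar> \<le> 0"
  proof (rule field_le_epsilon)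
    fix e :: real assume e: "0 < e"
    have "\<bar>I\<bar> \<le> 2 * N * (e / (2 * N + 1))"
      using e N0 by (intro bound) auto
    also have "\<dots> \<le> e" using e N0 by (simp add: field_simps)
    finally show "\<bar>I\<bar> \<le> 0 + e" by simp
  qed
  then show ?thesis by (simp add: I_def)
qed

section \<open>Polar coordinates\<close>

lemma normalize_measurable:
  "(\<lambda>x::'a::euclidean_space. x /\<^sub>R norm x)
     \<in> restrict_space lborel (ball 0 1 - {0}) \<rightarrow>\<^sub>M restrict_space borel (sphere 0 1)"
  by (rule measurable_restrict_space2)
     (auto simp: space_restrict_space intro!: measurable_restrict_space1)

lemma sets_sphere_measure: "sets (sphere_measure :: 'a::euclidean_space measure) = sets (restrict_space borel (sphere 0 1))"
  by (simp add: sphere_measure_def)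

lemma measurable_sphere_measureI:
  "f \<in> borel_measurable borel \<Longrightarrow> f \<in> borel_measurable (sphere_measure :: 'a::euclidean_space measure)"
  by (subst measurable_cong_sets[OF sets_sphere_measure refl]) (rule measurable_restrict_space1)

lemma nn_integral_sphere_measure:
  fixes f :: "'a::euclidean_space \<Rightarrow> ennreal"
  assumes [measurable]: "f \<in> borel_measurable borel"
  shows "(\<integral>\<^sup>+\<omega>. f \<omega> \<partial>sphere_measure)
    = of_nat DIM('a) * (\<integral>\<^sup>+x. indicator (ball 0 1 - {0}) x * f (x /\<^sub>R norm x) \<partial>lborel)"
proof -
  have f: "f \<in> borel_measurable (restrict_space borel (sphere 0 1))"
    by (rule measurable_restrict_space1) measurable
  show ?thesis
    unfolding sphere_measure_def
    by (subst nn_integral_scale_measure)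
       (use f in \<open>auto simp: nn_integral_distr[OF normalize_measurable] nn_integral_restrict_space mult.commute\<close>)
qed

lemma emeasure_sphere_measure_total:
  "emeasure sphere_measure (sphere (0::'a::euclidean_space) 1) = of_nat DIM('a) * emeasure lborel (ball 0 1 :: 'a set)"
proof -
  have "emeasure (sphere_measure :: 'a measure) (sphere 0 1)
      = of_nat DIM('a) * emeasure lborel (ball 0 1 - {0::'a})"
    using nn_integral_sphere_measure[of "\<lambda>_::'a. 1"] by (simp add: space_sphere_measure)
  also have "emeasure lborel (ball 0 1 - {0::'a}) = emeasure lborel (ball 0 1 :: 'a set)"
    by (rule emeasure_Diff_null_set) (auto simp: null_sets_def)
  finally show ?thesis .
qed

lemma finite_sphere_measure: "finite_measure (sphere_measure :: 'a::euclidean_space measure)"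
  using emeasure_lborel_ball_finite[of "0::'a" 1]
  by (intro finite_measureI)
     (simp add: space_sphere_measure emeasure_sphere_measure_total ennreal_mult_eq_top_iff less_top)

lemma measure_sphere_measure_pos: "0 < measure sphere_measure (sphere (0::'a::euclidean_space) 1)"
proof -
  have "emeasure sphere_measure (sphere (0::'a) 1) \<noteq> 0"
    unfolding emeasure_sphere_measure_total
    using content_ball_gt_0_iff[of "0::'a" 1] by (auto simp: measure_def simp del: content_ball_gt_0_iff)
  then show ?thesis
    using finite_measure.emeasure_eq_measure[OF finite_sphere_measure, of "sphere (0::'a) 1"]
    by (simp add: order.not_eq_order_implies_strict)
qed

lemma nn_integral_inverse_power_atLeast:
  assumes "0 < a" "0 < n"
  shows "of_nat n * (\<integral>\<^sup>+s. indicator {a<..} s * ennreal (inverse s ^ Suc n) \<partial>lborel) = ennreal (inverse a ^ n)"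
proof -
  have "(\<integral>\<^sup>+s. ennreal (real n * inverse s ^ Suc n) * indicator {a..} s \<partial>lborel) = ennreal (0 - (- (inverse a ^ n)))"
  proof (rule nn_integral_FTC_atLeast)
    show "((\<lambda>s. - (inverse s ^ n)) has_real_derivative real n * inverse s ^ Suc n) (at s)" if "a \<le> s" for s
    proof -
      have "((\<lambda>s. - (inverse s ^ n)) has_real_derivative
          - (real n * (- (inverse s ^ Suc (Suc 0)) * inverse s ^ (n - Suc 0)))) (at s)"
        using DERIV_inverse[of s] that assms(1) by (intro DERIV_minus DERIV_power) auto
      also have "- (real n * (- (inverse s ^ Suc (Suc 0)) * inverse s ^ (n - Suc 0)))
          = real n * inverse s ^ (Suc (Suc 0) + (n - Suc 0))"
        by (simp only: power_add)
      also have "Suc (Suc 0) + (n - Suc 0) = Suc n" using assms(2) by simp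
      finally show ?thesis .
    qed
    show "((\<lambda>s::real. - (inverse s ^ n)) \<longlongrightarrow> 0) at_top"
    proof -
      have "((\<lambda>s::real. - (inverse s ^ n)) \<longlongrightarrow> - (0 ^ n)) at_top"
        by (intro tendsto_minus tendsto_power tendsto_inverse_0_at_top filterlim_ident)
      then show ?thesis using assms(2) by (simp add: power_0_left)
    qed
  qed (use assms in auto)
  also have "(\<integral>\<^sup>+s. ennreal (real n * inverse s ^ Suc n) * indicator {a..} s \<partial>lborel)
      = (\<integral>\<^sup>+s. of_nat n * (indicator {a<..} s * ennreal (inverse s ^ Suc n)) \<partial>lborel)"
  proof (rule nn_integral_cong_AE)
    show "AE s in lborel. ennreal (real n * inverse s ^ Suc n) * indicator {a..} s
      = of_nat n * (indicator {a<..} s * ennreal (inverse s ^ Suc n))"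
      using AE_lborel_singleton[of a]
      by eventually_elim (use assms(1) in \<open>auto simp: indicator_def ennreal_mult ennreal_of_nat_eq_real_of_nat\<close>)
  qed
  also have "\<dots> = of_nat n * (\<integral>\<^sup>+s. indicator {a<..} s * ennreal (inverse s ^ Suc n) \<partial>lborel)"
    by (rule nn_integral_cmult) measurable
  finally show ?thesis by simp
qed

text \<open>By definition the integral over the sphere is \<open>n\<close> times the integral of \<open>f(r x / |x|)\<close> over the unit ball.
  Exchange the integrals, substitute \<open>r = |x| s\<close>, exchange again, and substitute \<open>y = s x\<close>: the ball
  condition becomes \<open>|y| < s\<close>, and what remains is \<open>\<integral> f(y) |y|\<^sup>n (n \<integral> s\<^bsup>-n-1\<^esup> ds) dy\<close> with \<open>s > |y|\<close>,
  where the inner integral cancels \<open>|y|\<^sup>n\<close>.\<close>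

lemma nn_integral_polar:
  fixes f :: "'a::euclidean_space \<Rightarrow> ennreal"
  assumes [measurable]: "f \<in> borel_measurable borel"
  shows "(\<integral>\<^sup>+x. f x \<partial>lborel) = (\<integral>\<^sup>+r. indicator {0<..} r * ennreal (r ^ (DIM('a) - 1)) *
     (\<integral>\<^sup>+\<omega>. f (r *\<^sub>R \<omega>) \<partial>sphere_measure) \<partial>lborel)"
proof -
  let ?n = "DIM('a)" and ?B = "ball 0 1 - {0} :: 'a set"
  have n: "?n = Suc (?n - 1)" using DIM_positive[where 'a='a] by simp
  have [measurable]: "?B \<in> sets borel" by simp
  have split: "r ^ ?n = r * r ^ (?n - 1)" for r :: real by (subst n) (rule power_Suc)
  have "(\<integral>\<^sup>+r. indicator {0<..} r * ennreal (r ^ (?n - 1)) * (\<integral>\<^sup>+\<omega>. f (r *\<^sub>R \<omega>) \<partial>sphere_measure) \<partial>lborel)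
      = (\<integral>\<^sup>+r. \<integral>\<^sup>+x. of_nat ?n * indicator ?B x * (indicator {0<..} r * ennreal (r ^ (?n - 1)) * f (r *\<^sub>R (x /\<^sub>R norm x))) \<partial>lborel \<partial>lborel)"
    by (intro nn_integral_cong) (subst nn_integral_sphere_measure, measurable, simp add: nn_integral_cmult[symmetric] ac_simps)
  also have "\<dots> = (\<integral>\<^sup>+x. \<integral>\<^sup>+r. of_nat ?n * indicator ?B x * (indicator {0<..} r * ennreal (r ^ (?n - 1)) * f (r *\<^sub>R (x /\<^sub>R norm x))) \<partial>lborel \<partial>lborel)"
    by (rule lborel_pair.Fubini'[symmetric]) measurable
  also have "\<dots> = (\<integral>\<^sup>+x. \<integral>\<^sup>+s. of_nat ?n * indicator ?B x * (ennreal (norm x ^ ?n) * indicator {0<..} s * ennreal (s ^ (?n - 1)) * f (s *\<^sub>R x)) \<partial>lborel \<partial>lborel)"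
  proof (rule nn_integral_cong)
    fix x :: 'a
    show "(\<integral>\<^sup>+r. of_nat ?n * indicator ?B x * (indicator {0<..} r * ennreal (r ^ (?n - 1)) * f (r *\<^sub>R (x /\<^sub>R norm x))) \<partial>lborel)
      = (\<integral>\<^sup>+s. of_nat ?n * indicator ?B x * (ennreal (norm x ^ ?n) * indicator {0<..} s * ennreal (s ^ (?n - 1)) * f (s *\<^sub>R x)) \<partial>lborel)"
    proof (cases "x = 0")
      case False
      then have x: "0 < norm x" by simp
      have "(\<integral>\<^sup>+r. of_nat ?n * indicator ?B x * (indicator {0<..} r * ennreal (r ^ (?n - 1)) * f (r *\<^sub>R (x /\<^sub>R norm x))) \<partial>lborel)
        = ennreal (norm x) * (\<integral>\<^sup>+s. of_nat ?n * indicator ?B x * (indicator {0<..} (norm x * s) * ennreal ((norm x * s) ^ (?n - 1)) * f ((norm x * s) *\<^sub>R (x /\<^sub>R norm x))) \<partial>lborel)"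
        using nn_integral_real_affine[of "\<lambda>r. of_nat ?n * indicator ?B x * (indicator {0<..} r * ennreal (r ^ (?n - 1)) * f (r *\<^sub>R (x /\<^sub>R norm x)))" "norm x" 0] x
        by simp
      also have "\<dots> = (\<integral>\<^sup>+s. ennreal (norm x) * (of_nat ?n * indicator ?B x * (indicator {0<..} (norm x * s) * ennreal ((norm x * s) ^ (?n - 1)) * f ((norm x * s) *\<^sub>R (x /\<^sub>R norm x)))) \<partial>lborel)"
        by (rule nn_integral_cmult[symmetric]) measurable
      also have "\<dots> = (\<integral>\<^sup>+s. of_nat ?n * indicator ?B x * (ennreal (norm x ^ ?n) * indicator {0<..} s * ennreal (s ^ (?n - 1)) * f (s *\<^sub>R x)) \<partial>lborel)"
      proof (rule nn_integral_cong)
        fix s :: real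
        show "ennreal (norm x) * (of_nat ?n * indicator ?B x * (indicator {0<..} (norm x * s) * ennreal ((norm x * s) ^ (?n - 1)) * f ((norm x * s) *\<^sub>R (x /\<^sub>R norm x))))
          = of_nat ?n * indicator ?B x * (ennreal (norm x ^ ?n) * indicator {0<..} s * ennreal (s ^ (?n - 1)) * f (s *\<^sub>R x))"
        proof (cases "0 < s")
          case True
          have "ennreal (norm x) * ennreal ((norm x * s) ^ (?n - 1)) = ennreal (norm x ^ ?n) * ennreal (s ^ (?n - 1))"
            using True x by (simp add: ennreal_mult[symmetric] power_mult_distrib split)
          then have "ennreal (norm x) * ennreal ((norm x * s) ^ (?n - 1)) * F = ennreal (norm x ^ ?n) * ennreal (s ^ (?n - 1)) * F" for F
            by simp
          note this[of "of_nat ?n * indicator ?B x * f (s *\<^sub>R x)"]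
          moreover have "(norm x * s) *\<^sub>R (x /\<^sub>R norm x) = s *\<^sub>R x" using x by simp
          moreover have "indicator {0<..} s = (1::ennreal)" "indicator {0<..} (norm x * s) = (1::ennreal)"
            using True x by auto
          ultimately show ?thesis by (simp only: ac_simps mult_1_left)
        qed (use x in \<open>simp add: zero_less_mult_iff\<close>)
      qed
      finally show ?thesis .
    qed simp
  qed
  also have "\<dots> = (\<integral>\<^sup>+s. \<integral>\<^sup>+x. of_nat ?n * indicator ?B x * (ennreal (norm x ^ ?n) * indicator {0<..} s * ennreal (s ^ (?n - 1)) * f (s *\<^sub>R x)) \<partial>lborel \<partial>lborel)"
    by (rule lborel_pair.Fubini') measurable
  also have "\<dots> = (\<integral>\<^sup>+s. \<integral>\<^sup>+y. f y * ennreal (norm y ^ ?n) * indicator (- {0}) y * (of_nat ?n * (indicator {norm y<..} s * ennreal (inverse s ^ Suc ?n))) \<partial>lborel \<partial>lborel)"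
  proof (rule nn_integral_cong)
    fix s :: real
    show "(\<integral>\<^sup>+x. of_nat ?n * indicator ?B x * (ennreal (norm x ^ ?n) * indicator {0<..} s * ennreal (s ^ (?n - 1)) * f (s *\<^sub>R x)) \<partial>lborel)
      = (\<integral>\<^sup>+y. f y * ennreal (norm y ^ ?n) * indicator (- {0}) y * (of_nat ?n * (indicator {norm y<..} s * ennreal (inverse s ^ Suc ?n))) \<partial>lborel)"
    proof (cases "0 < s")
      case True
      let ?g = "\<lambda>y. of_nat ?n * indicator ?B (inverse s *\<^sub>R y) * (ennreal (norm (inverse s *\<^sub>R y) ^ ?n) * ennreal (s ^ (?n - 1)) * f y)"
      have "(\<integral>\<^sup>+x. of_nat ?n * indicator ?B x * (ennreal (norm x ^ ?n) * indicator {0<..} s * ennreal (s ^ (?n - 1)) * f (s *\<^sub>R x)) \<partial>lborel)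
        = (\<integral>\<^sup>+x. ?g (s *\<^sub>R x) \<partial>lborel)"
        using True by (intro nn_integral_cong) simp
      also have "\<dots> = ennreal (inverse s ^ ?n) * (\<integral>\<^sup>+y. ?g y \<partial>lborel)"
        by (rule nn_integral_dilation[OF True]) measurable
      also have "\<dots> = (\<integral>\<^sup>+y. ennreal (inverse s ^ ?n) * ?g y \<partial>lborel)"
        by (rule nn_integral_cmult[symmetric]) measurable
      also have "\<dots> = (\<integral>\<^sup>+y. f y * ennreal (norm y ^ ?n) * indicator (- {0}) y * (of_nat ?n * (indicator {norm y<..} s * ennreal (inverse s ^ Suc ?n))) \<partial>lborel)"
      proof (rule nn_integral_cong)
        fix y :: 'a
        have ind: "indicator ?B (inverse s *\<^sub>R y) = (indicator (- {0}) y * indicator {norm y<..} s :: ennreal)"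
          using True by (auto simp: indicator_def field_simps)
        have "inverse s ^ ?n * (norm (inverse s *\<^sub>R y) ^ ?n * s ^ (?n - 1)) = norm y ^ ?n * inverse s ^ Suc ?n"
          using True by (simp add: power_mult_distrib split field_simps)
        then have "ennreal (inverse s ^ ?n) * (ennreal (norm (inverse s *\<^sub>R y) ^ ?n) * ennreal (s ^ (?n - 1)))
          = ennreal (norm y ^ ?n) * ennreal (inverse s ^ Suc ?n)"
          using True by (simp only: ennreal_mult[symmetric] zero_le_power norm_ge_zero less_imp_le inverse_nonnegative_iff_nonnegative mult_nonneg_nonneg)
        then have "ennreal (inverse s ^ ?n) * (ennreal (norm (inverse s *\<^sub>R y) ^ ?n) * ennreal (s ^ (?n - 1))) * F
          = ennreal (norm y ^ ?n) * ennreal (inverse s ^ Suc ?n) * F" for F by simp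
        note this[of "of_nat ?n * indicator (- {0}) y * indicator {norm y<..} s * f y"]
        then show "ennreal (inverse s ^ ?n) * ?g y = f y * ennreal (norm y ^ ?n) * indicator (- {0}) y * (of_nat ?n * (indicator {norm y<..} s * ennreal (inverse s ^ Suc ?n)))"
          unfolding ind by (simp only: ac_simps)
      qed
      finally show ?thesis .
    next
      case False
      then have "indicator {norm y<..} s = (0::ennreal)" for y :: 'a
        using norm_ge_zero[of y] by (auto simp: indicator_def simp del: norm_ge_zero)
      then show ?thesis using False by simp
    qed
  qed
  also have "\<dots> = (\<integral>\<^sup>+y. \<integral>\<^sup>+s. f y * ennreal (norm y ^ ?n) * indicator (- {0}) y * (of_nat ?n * (indicator {norm y<..} s * ennreal (inverse s ^ Suc ?n))) \<partial>lborel \<partial>lborel)"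
  proof (rule lborel_pair.Fubini'[symmetric])
    have [measurable]: "(\<lambda>p. indicator {norm (snd p)<..} (fst p) :: ennreal) \<in> borel_measurable (borel \<Otimes>\<^sub>M (borel :: 'a measure))"
      unfolding indicator_def greaterThan_def mem_Collect_eq by measurable
    show "(\<lambda>(s, y). f y * ennreal (norm y ^ ?n) * indicator (- {0}) y * (of_nat ?n * (indicator {norm y<..} s * ennreal (inverse s ^ Suc ?n))))
      \<in> borel_measurable (lborel \<Otimes>\<^sub>M lborel)"
      unfolding case_prod_unfold by measurable
  qed
  also have "\<dots> = (\<integral>\<^sup>+y. f y \<partial>lborel)"
  proof (rule nn_integral_cong_AE)
    show "AE y in lborel. (\<integral>\<^sup>+s. f y * ennreal (norm y ^ ?n) * indicator (- {0}) y * (of_nat ?n * (indicator {norm y<..} s * ennreal (inverse s ^ Suc ?n))) \<partial>lborel) = f y"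
      using AE_lborel_singleton[of "0::'a"]
    proof eventually_elim
      case (elim y)
      have "(\<integral>\<^sup>+s. f y * ennreal (norm y ^ ?n) * indicator (- {0}) y * (of_nat ?n * (indicator {norm y<..} s * ennreal (inverse s ^ Suc ?n))) \<partial>lborel)
        = f y * ennreal (norm y ^ ?n) * (of_nat ?n * (\<integral>\<^sup>+s. indicator {norm y<..} s * ennreal (inverse s ^ Suc ?n) \<partial>lborel))"
        using elim by (simp add: nn_integral_cmult)
      also have "\<dots> = f y * (ennreal (norm y ^ ?n) * ennreal (inverse (norm y) ^ ?n))"
        using elim by (subst nn_integral_inverse_power_atLeast) (auto simp: mult.assoc)
      also have "\<dots> = f y"
        using elim by (simp add: ennreal_mult[symmetric] power_mult_distrib[symmetric])
      finally show ?case .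
    qed
  qed
  finally show ?thesis ..
qed

section \<open>The conformal weight and the Hardy remainder\<close>

text \<open>The measure \<open>dx / |x|\<^sup>n\<close>. In the coordinates \<open>x = e\<^sup>t \<omega>\<close> it is the product of \<open>dt\<close> and the surface
  measure, so dilations act on it as translations in \<open>t\<close>.\<close>

definition conformal_measure :: "'a::euclidean_space measure" where
  "conformal_measure = density lborel (\<lambda>x. ennreal (inverse (norm x) ^ DIM('a)))"

lemma sets_conformal_measure[simp, measurable_cong]: "sets (conformal_measure :: 'a::euclidean_space measure) = sets borel"
  by (simp add: conformal_measure_def)

lemma space_conformal_measure[simp]: "space conformal_measure = UNIV"
  by (simp add: conformal_measure_def)

lemma sigma_finite_conformal_measure: "sigma_finite_measure (conformal_measure :: 'a::euclidean_space measure)"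
  unfolding conformal_measure_def by (subst sigma_finite_measure.sigma_finite_iff_density_finite[OF lborel.sigma_finite_measure_axioms]) auto

lemma AE_conformal_measure: "AE x in lborel. P x \<Longrightarrow> AE x in conformal_measure. P x"
  unfolding conformal_measure_def by (subst AE_density) auto

lemma nn_integral_conformal_measure:
  fixes f :: "'a::euclidean_space \<Rightarrow> ennreal"
  assumes "f \<in> borel_measurable borel"
  shows "(\<integral>\<^sup>+x. f x \<partial>conformal_measure) = (\<integral>\<^sup>+x. ennreal (inverse (norm x) ^ DIM('a)) * f x \<partial>lborel)"
  unfolding conformal_measure_def using assms by (subst nn_integral_density) auto

lemma distr_conformal_measure_dilation:
  assumes a: "0 < a"
  shows "distr conformal_measure conformal_measure (\<lambda>x::'a::euclidean_space. a *\<^sub>R x) = conformal_measure"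
proof (rule measure_eqI)
  fix A assume "A \<in> sets (distr conformal_measure conformal_measure (\<lambda>x::'a. a *\<^sub>R x))"
  then have A[measurable]: "A \<in> sets borel" by simp
  have vA: "(\<lambda>x. a *\<^sub>R x) -` A \<in> sets borel"
    using measurable_sets_borel[OF _ A, of "\<lambda>x. a *\<^sub>R x"] by simp
  let ?F = "\<lambda>y. ennreal (inverse (norm y) ^ DIM('a)) * indicator A y"
  have "emeasure (distr conformal_measure conformal_measure (\<lambda>x::'a. a *\<^sub>R x)) A
      = emeasure conformal_measure ((\<lambda>x. a *\<^sub>R x) -` A)"
    by (subst emeasure_distr) auto
  also have "\<dots> = (\<integral>\<^sup>+x. ennreal (inverse (norm x) ^ DIM('a)) * indicator ((\<lambda>x. a *\<^sub>R x) -` A) x \<partial>lborel)"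
    unfolding conformal_measure_def by (subst emeasure_density) (use vA in auto)
  also have "\<dots> = (\<integral>\<^sup>+x. ennreal (a ^ DIM('a)) * ?F (a *\<^sub>R x) \<partial>lborel)"
  proof (rule nn_integral_cong)
    fix x :: 'a
    have "inverse (norm x) ^ DIM('a) = a ^ DIM('a) * inverse (norm (a *\<^sub>R x)) ^ DIM('a)"
      using a by (simp add: power_mult_distrib[symmetric] mult.assoc[symmetric])
    then have "ennreal (inverse (norm x) ^ DIM('a)) = ennreal (a ^ DIM('a)) * ennreal (inverse (norm (a *\<^sub>R x)) ^ DIM('a))"
      using a by (simp only: ennreal_mult[symmetric] zero_le_power less_imp_le inverse_nonnegative_iff_nonnegative norm_ge_zero)
    moreover have "indicator ((\<lambda>x. a *\<^sub>R x) -` A) x = (indicator A (a *\<^sub>R x) :: ennreal)"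
      by (simp add: indicator_def)
    ultimately show "ennreal (inverse (norm x) ^ DIM('a)) * indicator ((\<lambda>x. a *\<^sub>R x) -` A) x
        = ennreal (a ^ DIM('a)) * ?F (a *\<^sub>R x)" by (simp only: mult.assoc)
  qed
  also have "\<dots> = ennreal (a ^ DIM('a)) * (\<integral>\<^sup>+x. ?F (a *\<^sub>R x) \<partial>lborel)"
    by (rule nn_integral_cmult) measurable
  also have "(\<integral>\<^sup>+x. ?F (a *\<^sub>R x) \<partial>lborel) = ennreal (inverse a ^ DIM('a)) * (\<integral>\<^sup>+x. ?F x \<partial>lborel)"
    by (rule nn_integral_dilation[OF a]) measurable
  also have "ennreal (a ^ DIM('a)) * \<dots> = (\<integral>\<^sup>+x. ?F x \<partial>lborel)"
    using a by (simp add: mult.assoc[symmetric] ennreal_mult[symmetric] power_mult_distrib[symmetric])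
  also have "\<dots> = emeasure conformal_measure A"
    unfolding conformal_measure_def by (subst emeasure_density) auto
  finally show "emeasure (distr conformal_measure conformal_measure (\<lambda>x::'a. a *\<^sub>R x)) A = emeasure conformal_measure A" .
qed simp

text \<open>The square of this number is the constant of the Hardy inequality.\<close>

definition hardy_exponent :: "'a::euclidean_space itself \<Rightarrow> real" where
  "hardy_exponent _ = (real DIM('a) - 2) / 2"

text \<open>This power of \<open>|x|\<close> turns \<open>|f|\<^sup>2 / |x|\<^sup>2 dx\<close> into \<open>|conformal_lift f|\<^sup>2\<close> integrated against the
  dilation-invariant measure.\<close>

definition conformal_lift :: "('a::euclidean_space \<Rightarrow> complex) \<Rightarrow> 'a \<Rightarrow> complex" where
  "conformal_lift f x = norm x powr hardy_exponent TYPE('a) *\<^sub>R f x"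

lemma measurable_conformal_lift[measurable]:
  "f \<in> borel_measurable borel \<Longrightarrow> conformal_lift f \<in> borel_measurable borel"
  unfolding conformal_lift_def[abs_def] by measurable

lemma power2_powr_hardy_exponent:
  assumes "0 < r"
  shows "(r powr hardy_exponent TYPE('a::euclidean_space))\<^sup>2 = r powr (real DIM('a) - 2)"
  using assms by (simp add: power2_eq_square powr_add[symmetric] hardy_exponent_def)

lemma conformal_weight:
  fixes x :: "'a::euclidean_space"
  shows "inverse (norm x) ^ DIM('a) * (norm (conformal_lift f x))\<^sup>2 = (norm (f x))\<^sup>2 / (norm x)\<^sup>2"
proof (cases "x = 0")
  case False
  then have r: "0 < norm x" by simp
  have "inverse (norm x) ^ DIM('a) * (norm x powr hardy_exponent TYPE('a))\<^sup>2
      = norm x powr (- real DIM('a)) * norm x powr (real DIM('a) - 2)"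
    using r by (simp add: power2_powr_hardy_exponent powr_minus powr_realpow power_inverse)
  also have "\<dots> = norm x powr (- 2)"
    by (simp add: powr_add[symmetric])
  also have "\<dots> = inverse ((norm x)\<^sup>2)"
    using r by (simp add: powr_minus)
  finally show ?thesis
    by (simp add: conformal_lift_def power_mult_distrib divide_inverse mult.assoc[symmetric])
qed (simp add: conformal_lift_def)

lemma conformal_lift_L2:
  fixes f :: "'a::euclidean_space \<Rightarrow> complex"
  assumes [measurable]: "f \<in> borel_measurable borel"
  shows "integrable conformal_measure (\<lambda>x. (norm (conformal_lift f x))\<^sup>2)
      \<longleftrightarrow> integrable lborel (\<lambda>x. (norm (f x))\<^sup>2 / (norm x)\<^sup>2)"
    and "(\<integral>x. (norm (conformal_lift f x))\<^sup>2 \<partial>conformal_measure) = (\<integral>x. (norm (f x))\<^sup>2 / (norm x)\<^sup>2 \<partial>lborel)"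
  unfolding conformal_measure_def
  by (subst integrable_density integral_density; simp add: conformal_weight)+

text \<open>Dilation by \<open>e\<^sup>s\<close> multiplies the weight \<open>|x|\<^sup>c\<close> by \<open>e\<^bsup>c s\<^esup>\<close>, which absorbs the exponential factors of
  \<open>weak_dilation_flow\<close>.\<close>

lemma conformal_lift_flow:
  fixes h k :: "'a::euclidean_space \<Rightarrow> complex"
  defines "c \<equiv> hardy_exponent TYPE('a)"
  assumes "AE x in lborel. exp (c * t) *\<^sub>R h (exp t *\<^sub>R x) - h x
     = (\<integral>s. (indicator {0..t} s * exp (c * s)) *\<^sub>R (c *\<^sub>R h (exp s *\<^sub>R x) + k (exp s *\<^sub>R x)) \<partial>lborel)"
  shows "AE x in lborel. conformal_lift h (exp t *\<^sub>R x) - conformal_lift h x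
     = (\<integral>s. indicator {0..t} s *\<^sub>R conformal_lift (\<lambda>x. c *\<^sub>R h x + k x) (exp s *\<^sub>R x) \<partial>lborel)"
  using assms(2)
proof eventually_elim
  case (elim x)
  have lift: "conformal_lift f (exp s *\<^sub>R x) = norm x powr c *\<^sub>R (exp (c * s) *\<^sub>R f (exp s *\<^sub>R x))" for f s
    by (simp add: conformal_lift_def c_def powr_mult powr_def[of "exp s"] mult.commute)
  have "conformal_lift h (exp t *\<^sub>R x) - conformal_lift h x
      = norm x powr c *\<^sub>R (exp (c * t) *\<^sub>R h (exp t *\<^sub>R x) - h x)"
    unfolding lift by (simp add: conformal_lift_def c_def scaleR_diff_right)
  also have "\<dots> = (\<integral>s. norm x powr c *\<^sub>R ((indicator {0..t} s * exp (c * s)) *\<^sub>R (c *\<^sub>R h (exp s *\<^sub>R x) + k (exp s *\<^sub>R x))) \<partial>lborel)"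
    unfolding elim by (rule integral_scaleR_right[symmetric])
  also have "\<dots> = (\<integral>s. indicator {0..t} s *\<^sub>R conformal_lift (\<lambda>x. c *\<^sub>R h x + k x) (exp s *\<^sub>R x) \<partial>lborel)"
    unfolding lift by (intro Bochner_Integration.integral_cong refl) (simp add: ac_simps)
  finally show ?case .
qed

text \<open>Writing \<open>W\<close>, \<open>K\<close> and \<open>V = c W + K\<close> for the lifts, \<open>\<integral>\<langle>W, V\<rangle> = 0\<close> says that the cross term
  \<open>\<integral>\<langle>W, K\<rangle>\<close> equals \<open>-c \<integral>|W|\<^sup>2\<close>. Expanding \<open>|V|\<^sup>2\<close> gives the identity. It contains the Hardy
  inequality with an explicit remainder.\<close>

lemma hardy_remainder_identity:
  fixes h k :: "'a::euclidean_space \<Rightarrow> complex"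
  defines "c \<equiv> hardy_exponent TYPE('a)"
  assumes [measurable]: "h \<in> borel_measurable borel" "k \<in> borel_measurable borel"
    and h2: "integrable lborel (\<lambda>x. (norm (h x))\<^sup>2 / (norm x)\<^sup>2)"
    and k2: "integrable lborel (\<lambda>x. (norm (k x))\<^sup>2 / (norm x)\<^sup>2)"
    and flow: "\<And>t. 0 < t \<Longrightarrow> AE x in lborel. conformal_lift h (exp t *\<^sub>R x) - conformal_lift h x
     = (\<integral>s. indicator {0..t} s *\<^sub>R conformal_lift (\<lambda>x. c *\<^sub>R h x + k x) (exp s *\<^sub>R x) \<partial>lborel)"
  shows "integrable conformal_measure (\<lambda>x. (norm (conformal_lift (\<lambda>x. c *\<^sub>R h x + k x) x))\<^sup>2)"
    and "(\<integral>x. (norm (conformal_lift (\<lambda>x. c *\<^sub>R h x + k x) x))\<^sup>2 \<partial>conformal_measure)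
      = (\<integral>x. (norm (k x))\<^sup>2 / (norm x)\<^sup>2 \<partial>lborel) - c\<^sup>2 * (\<integral>x. (norm (h x))\<^sup>2 / (norm x)\<^sup>2 \<partial>lborel)"
proof -
  let ?M = "conformal_measure :: 'a measure"
  let ?W = "conformal_lift h" and ?K = "conformal_lift k" and ?V = "conformal_lift (\<lambda>x. c *\<^sub>R h x + k x)"
  have V: "?V x = c *\<^sub>R ?W x + ?K x" for x
    by (simp add: conformal_lift_def scaleR_add_right mult.commute)
  have W2: "integrable ?M (\<lambda>x. (norm (?W x))\<^sup>2)" and K2: "integrable ?M (\<lambda>x. (norm (?K x))\<^sup>2)"
    using h2 k2 by (simp_all add: conformal_lift_L2)
  have V_sq: "(norm (?V x))\<^sup>2 = c\<^sup>2 * (norm (?W x))\<^sup>2 + 2 * c * inner (?W x) (?K x) + (norm (?K x))\<^sup>2" for x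
    unfolding V power2_norm_eq_inner by (simp add: inner_add_left inner_add_right inner_commute power2_eq_square)
  have WK: "integrable ?M (\<lambda>x. inner (?W x) (?K x))"
    by (intro integrable_inner_square_integrable W2 K2; measurable)
  show V2: "integrable ?M (\<lambda>x. (norm (?V x))\<^sup>2)"
    unfolding V_sq using W2 K2 WK by simp
  have "(\<integral>x. inner (?W x) (?V x) \<partial>?M) = 0"
  proof (rule integral_inner_flow_derivative_eq_0[where T="\<lambda>s x. exp s *\<^sub>R x"])
    show "(\<lambda>(s, x). exp s *\<^sub>R x) \<in> borel \<Otimes>\<^sub>M ?M \<rightarrow>\<^sub>M ?M"
      by (subst measurable_cong_sets[OF refl sets_conformal_measure]) measurable
    show "AE x in ?M. ?W (exp s *\<^sub>R x) - ?W x = (\<integral>\<tau>. indicator {0..s} \<tau> *\<^sub>R ?V (exp \<tau> *\<^sub>R x) \<partial>lborel)" if "0 < s" for s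
      using flow[OF that] by (rule AE_conformal_measure)
  qed (use W2 V2 in \<open>auto simp: distr_conformal_measure_dilation sigma_finite_conformal_measure\<close>)
  then have "(\<integral>x. c * (norm (?W x))\<^sup>2 + inner (?W x) (?K x) \<partial>?M) = 0"
    by (simp add: V inner_add_right power2_norm_eq_inner)
  then have cross: "(\<integral>x. inner (?W x) (?K x) \<partial>?M) = - c * (\<integral>x. (norm (?W x))\<^sup>2 \<partial>?M)"
    using W2 WK by simp
  have "(\<integral>x. (norm (?V x))\<^sup>2 \<partial>?M)
      = c\<^sup>2 * (\<integral>x. (norm (?W x))\<^sup>2 \<partial>?M) + 2 * c * (\<integral>x. inner (?W x) (?K x) \<partial>?M) + (\<integral>x. (norm (?K x))\<^sup>2 \<partial>?M)"
    unfolding V_sq using W2 K2 WK by simp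
  also have "\<dots> = (\<integral>x. (norm (?K x))\<^sup>2 \<partial>?M) - c\<^sup>2 * (\<integral>x. (norm (?W x))\<^sup>2 \<partial>?M)"
    unfolding cross by (simp add: power2_eq_square)
  finally show "(\<integral>x. (norm (?V x))\<^sup>2 \<partial>?M)
      = (\<integral>x. (norm (k x))\<^sup>2 / (norm x)\<^sup>2 \<partial>lborel) - c\<^sup>2 * (\<integral>x. (norm (h x))\<^sup>2 / (norm x)\<^sup>2 \<partial>lborel)"
    by (simp add: conformal_lift_L2)
qed

section \<open>Square integrals over spheres\<close>

lemma measurable_sphere_measure_id:
  "(\<lambda>\<omega>. \<omega>) \<in> (sphere_measure :: 'a::euclidean_space measure) \<rightarrow>\<^sub>M borel"
  by (rule measurable_sphere_measureI) simp

lemma measurable_polar_map: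
  "(\<lambda>(r, \<omega>). r *\<^sub>R \<omega>) \<in> borel \<Otimes>\<^sub>M (sphere_measure :: 'a::euclidean_space measure) \<rightarrow>\<^sub>M borel"
  using measurable_compose[OF measurable_snd measurable_sphere_measure_id]
  unfolding case_prod_unfold by (intro borel_measurable_scaleR) (auto intro: measurable_fst)

lemma sigma_finite_sphere_measure: "sigma_finite_measure (sphere_measure :: 'a::euclidean_space measure)"
  using finite_sphere_measure by (rule finite_measure.axioms(1))

lemma measurable_nn_integral_sphere:
  fixes f :: "'a::euclidean_space \<Rightarrow> ennreal"
  assumes [measurable]: "f \<in> borel_measurable borel"
  shows "(\<lambda>r. \<integral>\<^sup>+\<omega>. f (r *\<^sub>R \<omega>) \<partial>sphere_measure) \<in> borel_measurable borel"
proof -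
  interpret sigma_finite_measure "sphere_measure :: 'a measure" by (rule sigma_finite_sphere_measure)
  have "(\<lambda>(r, \<omega>). f (r *\<^sub>R \<omega>)) \<in> borel_measurable (borel \<Otimes>\<^sub>M sphere_measure)"
    using measurable_compose[OF measurable_polar_map assms] by (simp add: case_prod_unfold)
  then show ?thesis by (rule borel_measurable_nn_integral)
qed

text \<open>A Borel null set that contains the exceptional points has integral 0 in polar coordinates, hence it meets
  almost every sphere in a null set.\<close>

lemma AE_polar:
  fixes P :: "'a::euclidean_space \<Rightarrow> bool"
  assumes "AE x in lborel. P x"
  shows "AE r in lborel. 0 < r \<longrightarrow> (AE \<omega> in sphere_measure. P (r *\<^sub>R \<omega>))"
proof -
  obtain N where N: "N \<in> null_sets lborel" "\<And>x. x \<notin> N \<Longrightarrow> P x"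
    using assms by (auto elim!: AE_E3)
  have Nb[measurable]: "N \<in> sets borel" using N(1) by auto
  let ?J = "\<lambda>r. \<integral>\<^sup>+\<omega>. indicator N (r *\<^sub>R \<omega>) \<partial>(sphere_measure :: 'a measure)"
  have [measurable]: "?J \<in> borel_measurable borel"
    by (rule measurable_nn_integral_sphere) measurable
  have "(\<integral>\<^sup>+r. indicator {0<..} r * ennreal (r ^ (DIM('a) - 1)) * ?J r \<partial>lborel) = (\<integral>\<^sup>+x. indicator N x \<partial>lborel)"
    by (rule nn_integral_polar[symmetric]) measurable
  also have "\<dots> = 0" using N(1) by auto
  finally have "AE r in lborel. indicator {0<..} r * ennreal (r ^ (DIM('a) - 1)) * ?J r = 0"
    by (subst (asm) nn_integral_0_iff_AE) auto
  then show ?thesis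
  proof eventually_elim
    case (elim r)
    show ?case
    proof
      assume r: "0 < r"
      then have "ennreal (r ^ (DIM('a) - 1)) \<noteq> 0"
        using zero_less_power[OF r] by (simp only: ennreal_eq_0_iff not_le)
      then have J0: "?J r = 0"
        using elim r by (simp only: mult_eq_0_iff) simp
      have m: "(\<lambda>\<omega>. indicator N (r *\<^sub>R \<omega>) :: ennreal) \<in> borel_measurable (sphere_measure :: 'a measure)"
        by (rule measurable_sphere_measureI) measurable
      have "AE \<omega> in (sphere_measure :: 'a measure). indicator N (r *\<^sub>R \<omega>) = (0 :: ennreal)"
        using J0 nn_integral_0_iff_AE[OF m] by simp
      then show "AE \<omega> in sphere_measure. P (r *\<^sub>R \<omega>)"
        by eventually_elim (use N(2) in \<open>auto simp: indicator_def split: if_splits\<close>)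
    qed
  qed
qed

text \<open>The substitution \<open>\<rho> = r e\<^sup>s\<close>, which turns \<open>ds\<close> into \<open>d\<rho> / \<rho>\<close>, followed by enlarging the domain to the whole ray.
  The resulting bound is uniform in the starting radius.\<close>

lemma nn_integral_exp_ray_le:
  fixes F :: "real \<Rightarrow> ennreal"
  assumes [measurable]: "F \<in> borel_measurable borel" and "0 < r" "0 < T"
  shows "(\<integral>\<^sup>+s. indicator {0..T} s * F (exp s * r) \<partial>lborel)
     \<le> (\<integral>\<^sup>+\<rho>. indicator {0<..} \<rho> * (ennreal (inverse \<rho>) * F \<rho>) \<partial>lborel)"
proof -
  have "(\<integral>\<^sup>+s. indicator {0..T} s * F (exp s * r) \<partial>lborel)
      = (\<integral>\<^sup>+s. (ennreal (inverse (exp s * r)) * F (exp s * r)) * ennreal (exp s * r) * indicator {0..T} s \<partial>lborel)"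
  proof (rule nn_integral_cong)
    fix s :: real
    have "ennreal (inverse (exp s * r)) * ennreal (exp s * r) = 1"
      using assms(2) by (simp add: ennreal_mult[symmetric] del: inverse_mult_distrib)
    then have "ennreal (inverse (exp s * r)) * ennreal (exp s * r) * (F (exp s * r) * indicator {0..T} s) = F (exp s * r) * indicator {0..T} s"
      by (simp only: mult_1_left)
    then show "indicator {0..T} s * F (exp s * r)
        = (ennreal (inverse (exp s * r)) * F (exp s * r)) * ennreal (exp s * r) * indicator {0..T} s"
      by (simp only: ac_simps)
  qed
  also have "\<dots> = (\<integral>\<^sup>+\<rho>. (ennreal (inverse \<rho>) * F \<rho>) * indicator {exp 0 * r..exp T * r} \<rho> \<partial>lborel)"
    by (rule nn_integral_substitution_aux[symmetric, where g="\<lambda>s. exp s * r"])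
       (use assms in \<open>auto intro!: derivative_eq_intros continuous_intros\<close>)
  also have "\<dots> \<le> (\<integral>\<^sup>+\<rho>. indicator {0<..} \<rho> * (ennreal (inverse \<rho>) * F \<rho>) \<partial>lborel)"
    using assms(2) by (intro nn_integral_mono) (auto simp: indicator_def)
  finally show ?thesis .
qed

text \<open>Where \<open>W\<close> does not vanish it is minus the integral of \<open>V\<close> along the ray over a time interval of length \<open>T\<close>. The
  Cauchy--Schwarz inequality bounds \<open>|W|\<^sup>2\<close> by \<open>T\<close> times the integral of \<open>|V|\<^sup>2 d\<rho> / \<rho>\<close> over the whole ray; integrating
  over the directions turns this into an integral over the whole space, which no longer depends on \<open>r\<close>.\<close>

lemma sphere_L2_bound:
  fixes W V :: "'a::euclidean_space \<Rightarrow> complex"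
  assumes [measurable]: "W \<in> borel_measurable borel" and V[measurable]: "V \<in> borel_measurable borel"
    and T: "0 < T" and supp: "\<And>x. W x \<noteq> 0 \<Longrightarrow> W (exp T *\<^sub>R x) = 0"
    and flow: "AE x in lborel. W (exp T *\<^sub>R x) - W x = (\<integral>s. indicator {0..T} s *\<^sub>R V (exp s *\<^sub>R x) \<partial>lborel)"
  shows "AE r in lborel. 0 < r \<longrightarrow> (\<integral>\<^sup>+\<omega>. ennreal ((norm (W (r *\<^sub>R \<omega>)))\<^sup>2) \<partial>sphere_measure)
     \<le> ennreal T * (\<integral>\<^sup>+x. ennreal ((norm (V x))\<^sup>2) \<partial>conformal_measure)"
proof -
  let ?S = "sphere_measure :: 'a measure"
  let ?v = "\<lambda>x. ennreal ((norm (V x))\<^sup>2)"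
  interpret S: sigma_finite_measure ?S by (rule sigma_finite_sphere_measure)
  interpret P: pair_sigma_finite lborel ?S ..
  have "AE x in lborel. ennreal ((norm (W x))\<^sup>2) \<le> ennreal T * (\<integral>\<^sup>+s. indicator {0..T} s * ?v (exp s *\<^sub>R x) \<partial>lborel)"
    using flow
  proof eventually_elim
    case (elim x)
    show ?case
    proof (cases "W x = 0")
      case False
      then have "norm (W x) = norm (\<integral>s. indicator {0..T} s *\<^sub>R V (exp s *\<^sub>R x) \<partial>lborel)"
        using elim supp by (metis diff_0 norm_minus_cancel)
      then show ?thesis
        using norm_set_integral_squared_le[of "\<lambda>s. V (exp s *\<^sub>R x)" lborel "{0..T}"] T by simp
    qed simp
  qed
  then have "AE r in lborel. 0 < r \<longrightarrow> (AE \<omega> in ?S. ennreal ((norm (W (r *\<^sub>R \<omega>)))\<^sup>2)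
      \<le> ennreal T * (\<integral>\<^sup>+s. indicator {0..T} s * ?v (exp s *\<^sub>R (r *\<^sub>R \<omega>)) \<partial>lborel))"
    by (rule AE_polar)
  then show ?thesis
  proof eventually_elim
    case (elim r)
    show ?case
    proof
      assume r: "0 < r"
      let ?q = "\<lambda>\<rho> \<omega>. indicator {0<..} \<rho> * (ennreal (inverse \<rho>) * ?v (\<rho> *\<^sub>R \<omega>))"
      have vp: "(\<lambda>(\<rho>, \<omega>). ?v (\<rho> *\<^sub>R \<omega>)) \<in> borel_measurable (borel \<Otimes>\<^sub>M ?S)"
      proof -
        have "?v \<in> borel_measurable borel" by measurable
        from measurable_compose[OF measurable_polar_map this] show ?thesis
          by (simp only: case_prod_unfold)
      qed
      have qm[measurable]: "(\<lambda>(\<rho>, \<omega>). ?q \<rho> \<omega>) \<in> borel_measurable (lborel \<Otimes>\<^sub>M ?S)"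
        using vp unfolding case_prod_unfold by measurable
      have "(\<integral>\<^sup>+\<omega>. ennreal ((norm (W (r *\<^sub>R \<omega>)))\<^sup>2) \<partial>?S) \<le> (\<integral>\<^sup>+\<omega>. ennreal T * (\<integral>\<^sup>+\<rho>. ?q \<rho> \<omega> \<partial>lborel) \<partial>?S)"
      proof (rule nn_integral_mono_AE)
        show "AE \<omega> in ?S. ennreal ((norm (W (r *\<^sub>R \<omega>)))\<^sup>2) \<le> ennreal T * (\<integral>\<^sup>+\<rho>. ?q \<rho> \<omega> \<partial>lborel)"
          using elim[rule_format, OF r]
        proof eventually_elim
          case (elim \<omega>)
          have "(\<integral>\<^sup>+s. indicator {0..T} s * ?v (exp s *\<^sub>R (r *\<^sub>R \<omega>)) \<partial>lborel) \<le> (\<integral>\<^sup>+\<rho>. ?q \<rho> \<omega> \<partial>lborel)"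
            using nn_integral_exp_ray_le[of "\<lambda>\<rho>. ?v (\<rho> *\<^sub>R \<omega>)" r T] r T by simp
          then show ?case using elim by (meson mult_left_mono order_trans zero_le)
        qed
      qed
      also have "\<dots> = ennreal T * (\<integral>\<^sup>+\<omega>. \<integral>\<^sup>+\<rho>. ?q \<rho> \<omega> \<partial>lborel \<partial>?S)"
        by (rule nn_integral_cmult) measurable
      also have "(\<integral>\<^sup>+\<omega>. \<integral>\<^sup>+\<rho>. ?q \<rho> \<omega> \<partial>lborel \<partial>?S) = (\<integral>\<^sup>+\<rho>. \<integral>\<^sup>+\<omega>. ?q \<rho> \<omega> \<partial>?S \<partial>lborel)"
        by (rule P.Fubini') measurable
      also have "\<dots> = (\<integral>\<^sup>+\<rho>. indicator {0<..} \<rho> * ennreal (\<rho> ^ (DIM('a) - 1)) *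
          (\<integral>\<^sup>+\<omega>. ennreal (inverse (norm (\<rho> *\<^sub>R \<omega>)) ^ DIM('a)) * ?v (\<rho> *\<^sub>R \<omega>) \<partial>?S) \<partial>lborel)"
      proof (rule nn_integral_cong)
        fix \<rho> :: real
        show "(\<integral>\<^sup>+\<omega>. ?q \<rho> \<omega> \<partial>?S) = indicator {0<..} \<rho> * ennreal (\<rho> ^ (DIM('a) - 1)) *
          (\<integral>\<^sup>+\<omega>. ennreal (inverse (norm (\<rho> *\<^sub>R \<omega>)) ^ DIM('a)) * ?v (\<rho> *\<^sub>R \<omega>) \<partial>?S)"
        proof (cases "0 < \<rho>")
          case True
          have m: "(\<lambda>\<omega>. ennreal (inverse (norm (\<rho> *\<^sub>R \<omega>)) ^ DIM('a)) * ?v (\<rho> *\<^sub>R \<omega>)) \<in> borel_measurable ?S"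
            by (rule measurable_sphere_measureI) measurable
          have "(\<integral>\<^sup>+\<omega>. ?q \<rho> \<omega> \<partial>?S) = (\<integral>\<^sup>+\<omega>. ennreal (\<rho> ^ (DIM('a) - 1)) * (ennreal (inverse (norm (\<rho> *\<^sub>R \<omega>)) ^ DIM('a)) * ?v (\<rho> *\<^sub>R \<omega>)) \<partial>?S)"
          proof (rule nn_integral_cong)
            fix \<omega> :: 'a assume "\<omega> \<in> space ?S"
            then have n: "norm (\<rho> *\<^sub>R \<omega>) = \<rho>" using True by (simp add: space_sphere_measure)
            obtain m where d: "DIM('a) = Suc m" using DIM_positive[where 'a='a] gr0_implies_Suc by blast
            have "\<rho> ^ (DIM('a) - 1) * inverse \<rho> ^ DIM('a) = inverse \<rho>"
              using True by (simp add: d field_simps)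
            then have "ennreal (\<rho> ^ (DIM('a) - 1)) * ennreal (inverse \<rho> ^ DIM('a)) = ennreal (inverse \<rho>)"
              using True by (simp only: ennreal_mult[symmetric] zero_le_power less_imp_le inverse_nonnegative_iff_nonnegative)
            then show "?q \<rho> \<omega> = ennreal (\<rho> ^ (DIM('a) - 1)) * (ennreal (inverse (norm (\<rho> *\<^sub>R \<omega>)) ^ DIM('a)) * ?v (\<rho> *\<^sub>R \<omega>))"
              unfolding n mult.assoc[symmetric] using True by simp
          qed
          also have "\<dots> = ennreal (\<rho> ^ (DIM('a) - 1)) * (\<integral>\<^sup>+\<omega>. ennreal (inverse (norm (\<rho> *\<^sub>R \<omega>)) ^ DIM('a)) * ?v (\<rho> *\<^sub>R \<omega>) \<partial>?S)"
            by (rule nn_integral_cmult[OF m])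
          finally show ?thesis using True by simp
        qed simp
      qed
      also have "\<dots> = (\<integral>\<^sup>+x. ennreal (inverse (norm x) ^ DIM('a)) * ?v x \<partial>lborel)"
        by (rule nn_integral_polar[symmetric]) measurable
      also have "\<dots> = (\<integral>\<^sup>+x. ?v x \<partial>conformal_measure)"
        by (rule nn_integral_conformal_measure[symmetric]) measurable
      finally show "(\<integral>\<^sup>+\<omega>. ennreal ((norm (W (r *\<^sub>R \<omega>)))\<^sup>2) \<partial>?S) \<le> ennreal T * (\<integral>\<^sup>+x. ?v x \<partial>conformal_measure)" .
    qed
  qed
qed

section \<open>Borel representatives and essential supports\<close>

lemma measurable_completion_cong_AE:
  assumes "AE x in M. f x = g x" "g \<in> M \<rightarrow>\<^sub>M N" "\<And>x. x \<in> space M \<Longrightarrow> f x \<in> space N"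
  shows "f \<in> completion M \<rightarrow>\<^sub>M N"
proof (rule measurableI)
  fix A assume A: "A \<in> sets N"
  show "f -` A \<inter> space (completion M) \<in> sets (completion M)"
  proof (rule completion.in_sets_AE)
    show "AE x in completion M. x \<in> g -` A \<inter> space M \<longleftrightarrow> x \<in> f -` A \<inter> space (completion M)"
      using AE_completion[OF assms(1)] by eventually_elim auto
    show "g -` A \<inter> space M \<in> sets (completion M)"
      using measurable_sets[OF assms(2) A] by simp
  qed auto
qed (use assms(3) in auto)

lemma ex_borel_representative:
  fixes f :: "'a::euclidean_space \<Rightarrow> 'b::euclidean_space"
  assumes "f \<in> borel_measurable lebesgue"
  obtains f' where "f' \<in> borel_measurable borel" "AE x in lborel. f x = f' x"
proof -
  have "\<exists>g\<in>borel_measurable lborel. AE x in lborel. f x \<bullet> b = g x" for b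
    by (intro completion_ex_borel_measurable_real borel_measurable_inner assms) simp
  then have "\<forall>b. \<exists>g. g \<in> borel_measurable borel \<and> (AE x in lborel. f x \<bullet> b = g x)"
    by auto
  from choice[OF this] obtain g where g: "\<And>b. g b \<in> borel_measurable borel" "\<And>b. AE x in lborel. f x \<bullet> b = g b x"
    by blast
  show thesis
  proof (rule that[of "\<lambda>x. \<Sum>b\<in>Basis. g b x *\<^sub>R b"])
    show "(\<lambda>x. \<Sum>b\<in>Basis. g b x *\<^sub>R b) \<in> borel_measurable borel"
      using g(1) by measurable
    have "AE x in lborel. \<forall>b\<in>(Basis :: 'b set). f x \<bullet> b = g b x"
      using g(2) by (intro AE_finite_allI) auto
    then show "AE x in lborel. f x = (\<Sum>b\<in>Basis. g b x *\<^sub>R b)"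
    proof eventually_elim
      case (elim x)
      then show ?case using euclidean_representation[of "f x"] by simp
    qed
  qed
qed

text \<open>The complement of the support is a union of open sets on each of which \<open>h\<close> vanishes almost everywhere; by
  the Lindelof property countably many of them suffice.\<close>

lemma AE_eq_0_outside_ess_support:
  fixes h :: "'a::euclidean_space \<Rightarrow> 'b::zero"
  shows "AE x in lebesgue. x \<notin> ess_support h \<longrightarrow> h x = 0"
proof -
  let ?F = "{U. open U \<and> (AE x in lebesgue. x \<in> U \<longrightarrow> h x = 0)}"
  obtain F' where F': "F' \<subseteq> ?F" "countable F'" "\<Union>F' = \<Union>?F"
    using Lindelof[of ?F] by auto
  then have "AE x in lebesgue. \<forall>U\<in>F'. x \<in> U \<longrightarrow> h x = 0"
    by (subst AE_ball_countable) auto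
  then show ?thesis
    by eventually_elim (use F' in \<open>auto simp: ess_support_def\<close>)
qed

section \<open>Spherical means\<close>

lemma spherical_mean_borel:
  fixes h :: "'a::euclidean_space \<Rightarrow> complex"
  assumes [measurable]: "h \<in> borel_measurable borel"
  shows "spherical_mean h r = (1 / measure sphere_measure (sphere (0::'a) 1)) *\<^sub>R (\<integral>\<omega>. h (r *\<^sub>R \<omega>) \<partial>sphere_measure)"
proof -
  have "(\<lambda>\<omega>. h (r *\<^sub>R \<omega>)) \<in> borel_measurable (sphere_measure :: 'a measure)"
    by (rule measurable_sphere_measureI) measurable
  then show ?thesis
    unfolding spherical_mean_def by (simp add: integral_completion)
qed

lemma measurable_spherical_mean:
  fixes h :: "'a::euclidean_space \<Rightarrow> complex"
  assumes [measurable]: "h \<in> borel_measurable borel"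
  shows "spherical_mean h \<in> borel_measurable borel"
proof -
  interpret sigma_finite_measure "sphere_measure :: 'a measure" by (rule sigma_finite_sphere_measure)
  have "(\<lambda>(r, \<omega>). h (r *\<^sub>R \<omega>)) \<in> borel_measurable (borel \<Otimes>\<^sub>M sphere_measure)"
    using measurable_compose[OF measurable_polar_map assms] by (simp add: case_prod_unfold)
  then have "(\<lambda>r. \<integral>\<omega>. h (r *\<^sub>R \<omega>) \<partial>sphere_measure) \<in> borel_measurable borel"
    by (rule borel_measurable_lebesgue_integral)
  then show ?thesis
    unfolding spherical_mean_borel[OF assms, abs_def] by measurable
qed

text \<open>This passage to a Borel representative is possible because the mean is taken with the completed surface
  measure: on almost every sphere the two functions agree almost everywhere.\<close>

lemma spherical_mean_cong_AE:
  fixes h h' :: "'a::euclidean_space \<Rightarrow> complex"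
  assumes "AE x in lborel. h x = h' x" and [measurable]: "h' \<in> borel_measurable borel"
  shows "AE r in lborel. 0 < r \<longrightarrow> spherical_mean h r = spherical_mean h' r"
  using AE_polar[OF assms(1)]
proof eventually_elim
  case (elim r)
  have m: "(\<lambda>\<omega>. h' (r *\<^sub>R \<omega>)) \<in> borel_measurable (sphere_measure :: 'a measure)"
    by (rule measurable_sphere_measureI) measurable
  show ?case
  proof
    assume r: "0 < r"
    have "(\<integral>\<omega>. h (r *\<^sub>R \<omega>) \<partial>(completion sphere_measure)) = (\<integral>\<omega>. h' (r *\<^sub>R \<omega>) \<partial>(completion sphere_measure))"
      using elim r m
      by (intro integral_cong_AE AE_completion measurable_completion measurable_completion_cong_AE[OF _ m]) auto
    then show "spherical_mean h r = spherical_mean h' r"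
      by (simp add: spherical_mean_def)
  qed
qed

text \<open>The square of a mean is at most the mean of the squares, and on the sphere of radius \<open>r\<close> the lift is \<open>h\<close> times a power of \<open>r\<close>.\<close>

lemma spherical_mean_squared_le:
  fixes h :: "'a::euclidean_space \<Rightarrow> complex"
  assumes [measurable]: "h \<in> borel_measurable borel" and r: "0 < r"
    and B: "0 \<le> B" "(\<integral>\<^sup>+\<omega>. ennreal ((norm (conformal_lift h (r *\<^sub>R \<omega>)))\<^sup>2) \<partial>sphere_measure) \<le> ennreal B"
  shows "(norm (spherical_mean h r))\<^sup>2 \<le> r powr (2 - real DIM('a)) * (B / measure sphere_measure (sphere (0::'a) 1))"
proof -
  let ?S = "sphere_measure :: 'a measure"
  let ?A = "sphere (0::'a) 1"
  define s where "s = measure ?S ?A"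
  have s: "0 < s" unfolding s_def by (rule measure_sphere_measure_pos)
  have e: "emeasure ?S ?A = ennreal s"
    unfolding s_def by (rule finite_measure.emeasure_eq_measure[OF finite_sphere_measure])
  have A: "?A \<in> sets ?S" using sets.top[of ?S] by (simp add: space_sphere_measure)
  let ?I = "\<integral>\<omega>. h (r *\<^sub>R \<omega>) \<partial>?S"
  have m: "(\<lambda>\<omega>. h (r *\<^sub>R \<omega>)) \<in> borel_measurable ?S"
    by (rule measurable_sphere_measureI) measurable
  have m2: "(\<lambda>\<omega>. ennreal ((norm (conformal_lift h (r *\<^sub>R \<omega>)))\<^sup>2)) \<in> borel_measurable ?S"
    by (rule measurable_sphere_measureI) measurable
  let ?w = "r powr (2 - real DIM('a))"
  have "?I = (\<integral>\<omega>. indicator ?A \<omega> *\<^sub>R h (r *\<^sub>R \<omega>) \<partial>?S)"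
    by (intro Bochner_Integration.integral_cong) (auto simp: space_sphere_measure)
  then have "ennreal ((norm ?I)\<^sup>2) \<le> ennreal s * (\<integral>\<^sup>+\<omega>. indicator ?A \<omega> * ennreal ((norm (h (r *\<^sub>R \<omega>)))\<^sup>2) \<partial>?S)"
    using norm_set_integral_squared_le[OF m A] by (simp add: e)
  also have "(\<integral>\<^sup>+\<omega>. indicator ?A \<omega> * ennreal ((norm (h (r *\<^sub>R \<omega>)))\<^sup>2) \<partial>?S)
      = (\<integral>\<^sup>+\<omega>. ennreal ?w * ennreal ((norm (conformal_lift h (r *\<^sub>R \<omega>)))\<^sup>2) \<partial>?S)"
  proof (rule nn_integral_cong)
    fix \<omega> assume "\<omega> \<in> space ?S"
    then have \<omega>: "\<omega> \<in> ?A" and n: "norm (r *\<^sub>R \<omega>) = r" using r by (auto simp: space_sphere_measure)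
    have "?w * (norm (conformal_lift h (r *\<^sub>R \<omega>)))\<^sup>2 = ?w * r powr (real DIM('a) - 2) * (norm (h (r *\<^sub>R \<omega>)))\<^sup>2"
      unfolding conformal_lift_def n
      by (simp add: power_mult_distrib power2_powr_hardy_exponent[OF r] del: scaleR_scaleR)
    also have "\<dots> = (norm (h (r *\<^sub>R \<omega>)))\<^sup>2"
      using r by (simp add: powr_add[symmetric])
    finally show "indicator ?A \<omega> * ennreal ((norm (h (r *\<^sub>R \<omega>)))\<^sup>2)
        = ennreal ?w * ennreal ((norm (conformal_lift h (r *\<^sub>R \<omega>)))\<^sup>2)"
      using \<omega> by (simp add: ennreal_mult[symmetric])
  qed
  also have "\<dots> = ennreal ?w * (\<integral>\<^sup>+\<omega>. ennreal ((norm (conformal_lift h (r *\<^sub>R \<omega>)))\<^sup>2) \<partial>?S)"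
    by (rule nn_integral_cmult[OF m2])
  also have "ennreal s * \<dots> \<le> ennreal s * (ennreal ?w * ennreal B)"
    by (intro mult_left_mono B) auto
  also have "\<dots> = ennreal (s * (?w * B))"
    using s B by (simp add: ennreal_mult)
  finally have "(norm ?I)\<^sup>2 \<le> s * (?w * B)"
    using s B by (simp add: ennreal_le_iff)
  then have "(norm ?I)\<^sup>2 / s\<^sup>2 \<le> s * (?w * B) / s\<^sup>2"
    by (intro divide_right_mono) auto
  moreover have "(norm (spherical_mean h r))\<^sup>2 = (norm ?I)\<^sup>2 / s\<^sup>2"
    using s by (simp add: spherical_mean_borel s_def[symmetric] power_divide)
  moreover have "s * (?w * B) / s\<^sup>2 = ?w * (B / s)"
    using s by (simp add: power2_eq_square)
  ultimately show ?thesis by (simp add: s_def)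
qed

section \<open>From pointwise bounds to radial norms\<close>

lemma nn_integral_inverse_symmetric:
  assumes R: "1 < R"
  shows "(\<integral>\<^sup>+r. indicator {1 / R..R} r * ennreal (inverse r) \<partial>lborel) = ennreal (2 * ln R)"
proof -
  have le: "1 / R \<le> R" using R by (simp add: divide_le_eq less_imp_le mult_mono[of 1 R 1 R, simplified])
  let ?f = "\<lambda>r. if 0 < r then inverse r else (0::real)"
  have "(\<integral>\<^sup>+r. ennreal (?f r) * indicator {1 / R..R} r \<partial>lborel) = ennreal (ln R - ln (1 / R))"
  proof (rule nn_integral_FTC_Icc)
    fix x assume x: "x \<in> {1 / R..R}"
    have "0 < 1 / R" using R by simp
    then have "0 < x" using x by (meson atLeastAtMost_iff less_le_trans)
    then show "DERIV ln x :> ?f x" "0 \<le> ?f x"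
      by (auto intro!: derivative_eq_intros simp: divide_inverse)
  qed (use le in \<open>auto\<close>)
  also have "ln R - ln (1 / R) = 2 * ln R"
    using R by (simp add: ln_div)
  also have "(\<integral>\<^sup>+r. ennreal (?f r) * indicator {1 / R..R} r \<partial>lborel)
      = (\<integral>\<^sup>+r. indicator {1 / R..R} r * ennreal (inverse r) \<partial>lborel)"
  proof (rule nn_integral_cong)
    fix r :: real
    have "0 < 1 / R" using R by simp
    then show "ennreal (?f r) * indicator {1 / R..R} r = indicator {1 / R..R} r * ennreal (inverse r)"
      by (auto simp: indicator_def ennreal_neg not_less)
  qed
  finally show ?thesis .
qed

text \<open>The critical exponent \<open>p\<close> satisfies \<open>(2 - n) p / 2 = -n\<close>, so the bound on \<open>|m'|\<^sup>p\<close> multiplied by the density \<open>r\<^bsup>n - 1\<^esup>\<close>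
  is a constant times \<open>1 / r\<close>, which has integral \<open>2 ln R\<close> over \<open>[1/R, R]\<close>.\<close>

lemma radial_Lp_bound:
  fixes m m' :: "real \<Rightarrow> complex"
  assumes n: "3 \<le> n" and R: "1 < R" and A: "0 \<le> A"
    and m'[measurable]: "m' \<in> borel_measurable borel"
    and eq: "AE r in lborel. 0 < r \<longrightarrow> m r = m' r"
    and bound: "AE r in lborel. 0 < r \<longrightarrow> (norm (m' r))\<^sup>2 \<le> r powr (2 - real n) * A"
    and supp: "\<And>r. 0 < r \<Longrightarrow> r \<notin> {1 / R..R} \<Longrightarrow> m' r = 0"
  shows "in_Lp (radial_measure n) (sobolev_exponent n) m"
    and "(Lp_norm (radial_measure n) (sobolev_exponent n) m)\<^sup>2 \<le> A * (2 * ln R) powr ((real n - 2) / real n)"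
proof -
  define p where "p = sobolev_exponent n"
  define L where "L = 2 * ln R"
  have p: "0 < p" "2 / p = (real n - 2) / real n" "(2 - real n) * (p / 2) = - real n"
    using n by (simp_all add: p_def sobolev_exponent_def divide_simps) (simp_all add: algebra_simps)
  have L: "0 < L" using R by (simp add: L_def)
  have restr: "m \<in> borel_measurable (restrict_space lebesgue {0<..})"
  proof (subst borel_measurable_restrict_space_iff)
    have "AE r in lborel. indicator {0<..} r *\<^sub>R m r = indicator {0<..} r *\<^sub>R m' r"
      using eq by eventually_elim (auto simp: indicator_def)
    then show "(\<lambda>r. indicator {0<..} r *\<^sub>R m r) \<in> borel_measurable lebesgue"
      by (rule measurable_completion_cong_AE) auto
  qed simp
  have meas: "m \<in> borel_measurable (radial_measure n)"
    using restr by (simp add: radial_measure_def)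
  have [measurable]: "(\<lambda>r. norm (m r) powr p) \<in> borel_measurable (restrict_space lebesgue {0<..})"
    using restr by measurable
  have w: "(\<lambda>r. ennreal (r ^ (n - 1))) \<in> borel_measurable (restrict_space lebesgue {0<..})"
    by (intro measurable_restrict_space1 measurable_completion) measurable
  have point: "norm z powr p * r ^ (n - 1) \<le> A powr (p / 2) * inverse r"
    if r: "0 < r" and z: "(norm z)\<^sup>2 \<le> r powr (2 - real n) * A" for r :: real and z :: complex
  proof -
    have "norm z powr p = ((norm z)\<^sup>2) powr (p / 2)"
      by (cases "z = 0") (simp_all add: powr_powr flip: powr_numeral)
    also have "\<dots> \<le> (r powr (2 - real n) * A) powr (p / 2)"
      using z p(1) by (intro powr_mono2) auto
    also have "\<dots> = r powr (- real n) * A powr (p / 2)"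
      using r A by (simp only: powr_mult powr_ge_zero powr_powr p(3))
    finally have "norm z powr p * r ^ (n - 1) \<le> r powr (- real n) * A powr (p / 2) * r ^ (n - 1)"
      using r by (intro mult_right_mono) auto
    also have "\<dots> = A powr (p / 2) * (r powr (- real n) * r powr real (n - 1))"
      using r by (simp add: powr_realpow)
    also have "r powr (- real n) * r powr real (n - 1) = r powr (- 1)"
      using n by (simp add: powr_add[symmetric] of_nat_diff)
    also have "\<dots> = inverse r" using r by (simp add: powr_minus)
    finally show ?thesis .
  qed
  have "(\<integral>\<^sup>+r. ennreal (norm (m r) powr p) \<partial>(radial_measure n))
      = (\<integral>\<^sup>+r. ennreal (r ^ (n - 1)) * ennreal (norm (m r) powr p) \<partial>(restrict_space lebesgue {0<..}))"
    unfolding radial_measure_def using w by (subst nn_integral_density) auto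
  also have "\<dots> = (\<integral>\<^sup>+r. ennreal (r ^ (n - 1)) * ennreal (norm (m r) powr p) * indicator {0<..} r \<partial>lborel)"
    by (subst nn_integral_restrict_space) (auto simp: nn_integral_completion)
  also have "\<dots> \<le> (\<integral>\<^sup>+r. ennreal (A powr (p / 2)) * (indicator {1 / R..R} r * ennreal (inverse r)) \<partial>lborel)"
  proof (rule nn_integral_mono_AE)
    show "AE r in lborel. ennreal (r ^ (n - 1)) * ennreal (norm (m r) powr p) * indicator {0<..} r
      \<le> ennreal (A powr (p / 2)) * (indicator {1 / R..R} r * ennreal (inverse r))"
      using eq bound
    proof eventually_elim
      case (elim r)
      show ?case
      proof (cases "0 < r \<and> r \<in> {1 / R..R}")
        case True
        then have "norm (m r) powr p * r ^ (n - 1) \<le> A powr (p / 2) * inverse r"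
          using elim by (intro point) auto
        then have "ennreal (r ^ (n - 1)) * ennreal (norm (m r) powr p) \<le> ennreal (A powr (p / 2)) * ennreal (inverse r)"
          using True by (simp add: ennreal_mult[symmetric] mult.commute)
        then show ?thesis using True by simp
      next
        case False
        then have "0 < r \<Longrightarrow> m r = 0" using elim supp by auto
        then show ?thesis by (cases "0 < r") auto
      qed
    qed
  qed
  also have "\<dots> = ennreal (A powr (p / 2)) * ennreal L"
    by (subst nn_integral_cmult) (auto simp: nn_integral_inverse_symmetric[OF R] L_def)
  finally have le: "(\<integral>\<^sup>+r. ennreal (norm (m r) powr p) \<partial>(radial_measure n)) \<le> ennreal (A powr (p / 2) * L)"
    using L by (simp add: ennreal_mult)
  have int: "integrable (radial_measure n) (\<lambda>r. norm (m r) powr p)"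
  proof (rule integrableI_bounded)
    show "(\<lambda>r. norm (m r) powr p) \<in> borel_measurable (radial_measure n)"
      using meas by measurable
    show "(\<integral>\<^sup>+r. ennreal (norm (norm (m r) powr p)) \<partial>(radial_measure n)) < \<infinity>"
      using le_less_trans[OF le ennreal_less_top] by simp
  qed
  show "in_Lp (radial_measure n) (sobolev_exponent n) m"
    using meas int by (simp add: in_Lp_def p_def)
  let ?X = "\<integral>r. norm (m r) powr p \<partial>(radial_measure n)"
  have "ennreal ?X \<le> ennreal (A powr (p / 2) * L)"
    using le int by (subst nn_integral_eq_integral[symmetric]) auto
  then have X: "?X \<le> A powr (p / 2) * L"
    using L by (subst (asm) ennreal_le_iff) auto
  have X0: "0 \<le> ?X" by simp
  have "(Lp_norm (radial_measure n) (sobolev_exponent n) m)\<^sup>2 = ?X powr (2 / p)"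
    by (simp add: Lp_norm_def p_def[symmetric] power2_eq_square powr_add[symmetric])
  also have "\<dots> \<le> (A powr (p / 2) * L) powr (2 / p)"
    using X X0 p(1) by (intro powr_mono2) auto
  also have "\<dots> = A * L powr (2 / p)"
    using A L p(1) by (simp add: powr_mult powr_powr)
  finally show "(Lp_norm (radial_measure n) (sobolev_exponent n) m)\<^sup>2 \<le> A * (2 * ln R) powr ((real n - 2) / real n)"
    by (simp add: p(2) L_def)
qed

section \<open>The pointwise bound on spherical means\<close>

lemma norm_dot_complex_le: "norm (dot_complex x v) \<le> norm x * norm v"
proof -
  have "norm (dot_complex x v) \<le> (\<Sum>i\<in>UNIV. \<bar>norm (x $ i)\<bar> * \<bar>norm (v $ i)\<bar>)"
    unfolding dot_complex_def by (rule order_trans[OF norm_sum]) simp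
  also have "\<dots> \<le> norm x * norm v"
    unfolding norm_vec_def by (rule L2_set_mult_ineq)
  finally show ?thesis .
qed

lemma measurable_dot_complex:
  fixes g :: "real ^ 'n \<Rightarrow> complex ^ 'n"
  assumes "g \<in> borel_measurable borel"
  shows "(\<lambda>x. dot_complex x (g x)) \<in> borel_measurable borel"
proof -
  have [measurable]: "(\<lambda>x::real ^ 'n. x $ i) \<in> borel_measurable borel" for i
    by (intro borel_measurable_continuous_onI linear_continuous_on bounded_linear_vec_nth)
  have "(\<lambda>v::complex ^ 'n. v $ i) \<in> borel_measurable borel" for i
    by (intro borel_measurable_continuous_onI linear_continuous_on bounded_linear_vec_nth)
  from measurable_compose[OF assms this]
  have [measurable]: "(\<lambda>x. g x $ i) \<in> borel_measurable borel" for i .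
  show ?thesis
    unfolding dot_complex_def by measurable
qed

text \<open>Combines the integrated flow along dilations with the Hardy remainder, which is bounded by \<open>D\<close> since
  \<open>|x \<cdot> g| \<le> |x| |g|\<close>, and with the bound on spheres.\<close>

lemma spherical_mean_pointwise_bound:
  fixes h :: "real ^ 'n \<Rightarrow> complex" and g :: "real ^ 'n \<Rightarrow> complex ^ 'n"
  defines "D \<equiv> (\<integral>x. (norm (g x))\<^sup>2 \<partial>lborel)
      - (real CARD('n) - 2)\<^sup>2 / 4 * (\<integral>x. (norm (h x))\<^sup>2 / (norm x)\<^sup>2 \<partial>lborel)"
  assumes R: "1 < R" and w: "has_weak_gradient h g"
    and h[measurable]: "h \<in> borel_measurable borel" and g[measurable]: "g \<in> borel_measurable borel"
    and h2: "integrable lborel (\<lambda>x. (norm (h x))\<^sup>2)" and g2: "integrable lborel (\<lambda>x. (norm (g x))\<^sup>2)"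
    and supp: "\<And>x. x \<notin> annulus (1 / R) R \<Longrightarrow> h x = 0"
  shows "0 \<le> D"
    and "AE r in lborel. 0 < r \<longrightarrow> (norm (spherical_mean h r))\<^sup>2
      \<le> r powr (2 - real CARD('n)) * (4 * ln R * D / measure sphere_measure (sphere (0::real ^ 'n) 1))"
proof -
  define k where "k x = dot_complex x (g x)" for x
  define c where "c = hardy_exponent TYPE(real ^ 'n)"
  let ?V = "conformal_lift (\<lambda>x. c *\<^sub>R h x + k x)"
  define N where "N = (\<integral>x. (norm (?V x))\<^sup>2 \<partial>conformal_measure)"
  have k[measurable]: "k \<in> borel_measurable borel"
    unfolding k_def[abs_def] by (rule measurable_dot_complex) measurable
  have k_le: "norm (k x) \<le> norm x * norm (g x)" for x
    unfolding k_def by (rule norm_dot_complex_le)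
  have cb: "indicator (cball (0::real ^ 'n) r) \<in> borel_measurable borel" for r :: real
    by (intro borel_measurable_indicator) simp
  have hi: "set_integrable lborel (cball 0 r) h" for r
  proof -
    have "set_integrable lebesgue (cball 0 r) h"
      using w by (simp add: has_weak_gradient_def locally_integrable_def)
    then show ?thesis
      unfolding set_integrable_def
      by (subst (asm) integrable_completion) (use cb in \<open>auto intro!: borel_measurable_scaleR\<close>)
  qed
  have gi: "set_integrable lborel (cball 0 r) g" for r
  proof -
    have "set_integrable lebesgue (cball 0 r) g"
      using w by (simp add: has_weak_gradient_def locally_integrable_def)
    then show ?thesis
      unfolding set_integrable_def
      by (subst (asm) integrable_completion) (use cb in \<open>auto intro!: borel_measurable_scaleR\<close>)
  qed
  have ki: "set_integrable lborel (cball 0 r) k" for r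
    unfolding set_integrable_def
  proof (rule Bochner_Integration.integrable_bound)
    show "integrable lborel (\<lambda>x. r *\<^sub>R (indicator (cball 0 r) x *\<^sub>R g x))"
      using gi[of r] unfolding set_integrable_def by (rule integrable_scaleR_right)
    show "AE x in lborel. norm (indicator (cball 0 r) x *\<^sub>R k x) \<le> norm (r *\<^sub>R (indicator (cball 0 r) x *\<^sub>R g x))"
    proof (rule AE_I2)
      fix x :: "real ^ 'n"
      show "norm (indicator (cball 0 r) x *\<^sub>R k x) \<le> norm (r *\<^sub>R (indicator (cball 0 r) x *\<^sub>R g x))"
      proof (cases "x \<in> cball 0 r")
        case True
        then have "norm x * norm (g x) \<le> \<bar>r\<bar> * norm (g x)"
          by (intro mult_right_mono) auto
        then show ?thesis using True k_le[of x] by simp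
      qed simp
    qed
    show "(\<lambda>x. indicator (cball 0 r) x *\<^sub>R k x) \<in> borel_measurable lborel"
      using cb[of r] by (auto intro!: borel_measurable_scaleR)
  qed
  have euler: "(\<integral>x. (real CARD('n) * \<phi> x + euler_deriv \<phi> x) *\<^sub>R h x \<partial>lborel) = - (\<integral>x. \<phi> x *\<^sub>R k x \<partial>lborel)"
    if "test_function \<phi>" for \<phi>
    unfolding k_def by (rule weak_euler_equation[OF w h g that])
  have flow: "AE x in lborel. conformal_lift h (exp t *\<^sub>R x) - conformal_lift h x
     = (\<integral>s. indicator {0..t} s *\<^sub>R ?V (exp s *\<^sub>R x) \<partial>lborel)" if "0 < t" for t
    unfolding c_def
    by (rule conformal_lift_flow, rule weak_dilation_flow[OF h hi k ki euler]) (use that in auto)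
  have h2': "integrable lborel (\<lambda>x. (norm (h x))\<^sup>2 / (norm x)\<^sup>2)"
  proof (rule Bochner_Integration.integrable_bound[OF integrable_mult_right[OF h2, of "R\<^sup>2"]])
    show "AE x in lborel. norm ((norm (h x))\<^sup>2 / (norm x)\<^sup>2) \<le> norm (R\<^sup>2 * (norm (h x))\<^sup>2)"
    proof (rule AE_I2)
      fix x
      show "norm ((norm (h x))\<^sup>2 / (norm x)\<^sup>2) \<le> norm (R\<^sup>2 * (norm (h x))\<^sup>2)"
      proof (cases "h x = 0")
        case False
        then have "1 / R \<le> norm x" using supp by (auto simp: annulus_def)
        then have "1 \<le> R * norm x" using R by (simp add: divide_le_eq mult.commute)
        then have "1 \<le> (R * norm x)\<^sup>2" by (simp add: one_le_power)
        then have "(norm (h x))\<^sup>2 * 1 \<le> (norm (h x))\<^sup>2 * (R * norm x)\<^sup>2"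
          by (intro mult_left_mono) auto
        moreover have "0 < norm x" using \<open>1 \<le> R * norm x\<close> R by (cases "x = 0") auto
        ultimately show ?thesis
          by (simp add: divide_le_eq power_mult_distrib ac_simps)
      qed simp
    qed
  qed measurable
  have k_sq: "(norm (k x))\<^sup>2 / (norm x)\<^sup>2 \<le> (norm (g x))\<^sup>2" for x
  proof (cases "x = 0")
    case False
    have "(norm (k x))\<^sup>2 \<le> (norm x * norm (g x))\<^sup>2"
      by (intro power_mono k_le) auto
    then show ?thesis using False by (simp add: divide_le_eq power_mult_distrib mult.commute)
  qed simp
  have k2': "integrable lborel (\<lambda>x. (norm (k x))\<^sup>2 / (norm x)\<^sup>2)"
    by (rule Bochner_Integration.integrable_bound[OF g2]) (use k_sq in auto)
  note remainder = hardy_remainder_identity[OF h k h2' k2', folded c_def, OF flow]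
  have c2: "c\<^sup>2 = (real CARD('n) - 2)\<^sup>2 / 4"
    by (simp add: c_def hardy_exponent_def power_divide)
  have "(\<integral>x. (norm (k x))\<^sup>2 / (norm x)\<^sup>2 \<partial>lborel) \<le> (\<integral>x. (norm (g x))\<^sup>2 \<partial>lborel)"
    by (intro integral_mono k2' g2 k_sq)
  then have ND: "N \<le> D"
    using remainder(2) by (simp add: N_def D_def c2)
  have N0: "0 \<le> N" by (simp add: N_def)
  then show D0: "0 \<le> D" using ND by linarith
  \<comment> \<open>Any time above \<open>2 ln R\<close> moves every point of the annulus out of it; \<open>4 ln R\<close> is the choice
    that keeps the bound proportional to \<open>ln R\<close>.\<close>
  define T where "T = 4 * ln R"
  have T: "0 < T" using R by (simp add: T_def)
  have eT: "exp T = R ^ 4"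
    using R by (simp add: T_def exp_of_nat_mult[of 4, simplified])
  have far: "conformal_lift h (exp T *\<^sub>R x) = 0" if "conformal_lift h x \<noteq> 0" for x
  proof -
    have "h x \<noteq> 0" using that by (auto simp: conformal_lift_def)
    then have "1 / R \<le> norm x" using supp by (auto simp: annulus_def)
    then have "R ^ 4 * (1 / R) \<le> norm (exp T *\<^sub>R x)"
      using mult_left_mono[OF \<open>1 / R \<le> norm x\<close>, of "R ^ 4"] R by (simp add: eT)
    moreover have "R < R ^ 4 * (1 / R)"
      using R power_strict_increasing[of 1 3 R] by (simp add: power_numeral_reduce)
    ultimately have "exp T *\<^sub>R x \<notin> annulus (1 / R) R" by (auto simp: annulus_def)
    then show ?thesis using supp by (simp add: conformal_lift_def)
  qed
  have nnN: "(\<integral>\<^sup>+x. ennreal ((norm (?V x))\<^sup>2) \<partial>conformal_measure) = ennreal N"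
    unfolding N_def using remainder(1) by (intro nn_integral_eq_integral) auto
  have Vm: "?V \<in> borel_measurable borel" by measurable
  have "AE r in lborel. 0 < r \<longrightarrow> (\<integral>\<^sup>+\<omega>. ennreal ((norm (conformal_lift h (r *\<^sub>R \<omega>)))\<^sup>2) \<partial>sphere_measure)
     \<le> ennreal T * ennreal N"
    using sphere_L2_bound[OF measurable_conformal_lift[OF h] Vm T far flow[OF T]] by (simp add: nnN)
  then show "AE r in lborel. 0 < r \<longrightarrow> (norm (spherical_mean h r))\<^sup>2
      \<le> r powr (2 - real CARD('n)) * (4 * ln R * D / measure sphere_measure (sphere (0::real ^ 'n) 1))"
  proof eventually_elim
    case (elim r)
    show ?case
    proof
      assume r: "0 < r"
      have "ennreal T * ennreal N \<le> ennreal (T * D)"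
        using T N0 ND by (simp add: ennreal_mult[symmetric] mult_left_mono)
      then have "(\<integral>\<^sup>+\<omega>. ennreal ((norm (conformal_lift h (r *\<^sub>R \<omega>)))\<^sup>2) \<partial>sphere_measure) \<le> ennreal (T * D)"
        using elim r by (meson order_trans)
      from spherical_mean_squared_le[OF h r _ this]
      show "(norm (spherical_mean h r))\<^sup>2
        \<le> r powr (2 - real CARD('n)) * (4 * ln R * D / measure sphere_measure (sphere (0::real ^ 'n) 1))"
        using T D0 by (simp add: T_def)
    qed
  qed
qed

lemma spherical_mean_eq_0_outside:
  fixes h :: "'a::euclidean_space \<Rightarrow> complex"
  assumes "\<And>x. x \<notin> annulus a b \<Longrightarrow> h x = 0" "0 < r" "r \<notin> {a..b}"
  shows "spherical_mean h r = 0"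
proof -
  have "(\<integral>\<omega>. h (r *\<^sub>R \<omega>) \<partial>(completion sphere_measure)) = (\<integral>\<omega>. 0 \<partial>(completion sphere_measure :: 'a measure))"
    using assms by (intro Bochner_Integration.integral_cong refl) (auto simp: space_sphere_measure annulus_def intro!: assms(1))
  then show ?thesis by (simp add: spherical_mean_def)
qed

section \<open>The inequality for almost-everywhere classes\<close>

lemma locally_integrable_cong_AE:
  fixes f f' :: "real ^ 'n \<Rightarrow> 'b::{banach, second_countable_topology}"
  assumes "locally_integrable f" "AE x in lebesgue. f x = f' x" and [measurable]: "f' \<in> borel_measurable lebesgue"
  shows "locally_integrable f'"
  unfolding locally_integrable_def set_integrable_def
proof (intro allI impI)
  fix K :: "(real ^ 'n) set"
  assume K: "compact K"
  then have [measurable]: "K \<in> sets lebesgue"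
    by (simp add: borel_compact sets_completionI_sets)
  show "integrable lebesgue (\<lambda>x. indicator K x *\<^sub>R f' x)"
  proof (rule integrable_cong_AE_imp)
    show "integrable lebesgue (\<lambda>x. indicator K x *\<^sub>R f x)"
      using assms(1) K by (simp add: locally_integrable_def set_integrable_def)
    show "AE x in lebesgue. indicator K x *\<^sub>R f x = indicator K x *\<^sub>R f' x"
      using assms(2) by eventually_elim simp
  qed measurable
qed

lemma has_weak_gradient_cong_AE:
  fixes h h' :: "real ^ 'n \<Rightarrow> complex" and g g' :: "real ^ 'n \<Rightarrow> complex ^ 'n"
  assumes w: "has_weak_gradient h g"
    and eq: "AE x in lebesgue. h x = h' x" "AE x in lebesgue. g x = g' x"
    and [measurable]: "h \<in> borel_measurable lebesgue" "g \<in> borel_measurable lebesgue"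
      "h' \<in> borel_measurable lebesgue" "g' \<in> borel_measurable lebesgue"
  shows "has_weak_gradient h' g'"
  unfolding has_weak_gradient_def
proof (intro conjI allI impI)
  show "locally_integrable h'" "locally_integrable g'"
    using w eq by (auto simp: has_weak_gradient_def intro: locally_integrable_cong_AE)
  fix \<phi> :: "real ^ 'n \<Rightarrow> real" and i
  assume t: "test_function \<phi>"
  then have C: "C_order k \<phi>" for k by (simp add: test_function_def)
  have [measurable]: "\<phi> \<in> borel_measurable lebesgue" "partial_deriv i \<phi> \<in> borel_measurable lebesgue"
    using borel_measurable_continuous_onI[OF C_order_continuous[OF C[of 0]]]
      borel_measurable_continuous_onI[OF continuous_partial_deriv[OF C]]
    by (auto intro: measurable_completion)
  have c: "(\<lambda>v::complex ^ 'n. v $ i) \<in> borel_measurable borel"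
    by (intro borel_measurable_continuous_onI linear_continuous_on bounded_linear_vec_nth)
  have [measurable]: "(\<lambda>x. g x $ i) \<in> borel_measurable lebesgue" "(\<lambda>x. g' x $ i) \<in> borel_measurable lebesgue"
    by (rule measurable_compose[OF _ c], measurable)+
  have "(\<integral>x. partial_deriv i \<phi> x *\<^sub>R h' x \<partial>lebesgue) = (\<integral>x. partial_deriv i \<phi> x *\<^sub>R h x \<partial>lebesgue)"
  proof (rule integral_cong_AE)
    show "AE x in lebesgue. partial_deriv i \<phi> x *\<^sub>R h' x = partial_deriv i \<phi> x *\<^sub>R h x"
      using eq(1) by eventually_elim simp
  qed measurable
  also have "\<dots> = - (\<integral>x. \<phi> x *\<^sub>R (g x $ i) \<partial>lebesgue)"
    using w t by (simp add: has_weak_gradient_def)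
  also have "(\<integral>x. \<phi> x *\<^sub>R (g x $ i) \<partial>lebesgue) = (\<integral>x. \<phi> x *\<^sub>R (g' x $ i) \<partial>lebesgue)"
  proof (rule integral_cong_AE)
    show "AE x in lebesgue. \<phi> x *\<^sub>R (g x $ i) = \<phi> x *\<^sub>R (g' x $ i)"
      using eq(2) by eventually_elim simp
  qed measurable
  finally show "(\<integral>x. partial_deriv i \<phi> x *\<^sub>R h' x \<partial>lebesgue) = - (\<integral>x. \<phi> x *\<^sub>R (g' x $ i) \<partial>lebesgue)" .
qed

lemma Lp_norm_2_squared: "(Lp_norm M 2 f)\<^sup>2 = (\<integral>x. (norm (f x))\<^sup>2 \<partial>M)"
  by (simp add: Lp_norm_def powr_half_sqrt)

lemma square_integrable_borel_representative:
  fixes f :: "'a::euclidean_space \<Rightarrow> 'b::euclidean_space"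
  assumes f: "f \<in> borel_measurable lebesgue" and [measurable]: "f' \<in> borel_measurable borel"
    and eq: "AE x in lebesgue. f x = f' x"
  shows "(\<integral>x. (norm (f x))\<^sup>2 \<partial>lebesgue) = (\<integral>x. (norm (f' x))\<^sup>2 \<partial>lborel)"
    and "integrable lebesgue (\<lambda>x. (norm (f x))\<^sup>2) \<Longrightarrow> integrable lborel (\<lambda>x. (norm (f' x))\<^sup>2)"
proof -
  have m: "(\<lambda>x. (norm (f x))\<^sup>2) \<in> borel_measurable lebesgue" "(\<lambda>x. (norm (f' x))\<^sup>2) \<in> borel_measurable lebesgue"
    using f by (measurable, auto intro!: measurable_completion)
  have ae: "AE x in lebesgue. (norm (f x))\<^sup>2 = (norm (f' x))\<^sup>2"
    using eq by eventually_elim simp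
  have "(\<integral>x. (norm (f x))\<^sup>2 \<partial>lebesgue) = (\<integral>x. (norm (f' x))\<^sup>2 \<partial>lebesgue)"
    by (rule integral_cong_AE[OF m ae])
  then show "(\<integral>x. (norm (f x))\<^sup>2 \<partial>lebesgue) = (\<integral>x. (norm (f' x))\<^sup>2 \<partial>lborel)"
    by (simp add: integral_completion)
  assume "integrable lebesgue (\<lambda>x. (norm (f x))\<^sup>2)"
  then have "integrable lebesgue (\<lambda>x. (norm (f' x))\<^sup>2)"
    using integrable_cong_AE[OF m ae] by simp
  then show "integrable lborel (\<lambda>x. (norm (f' x))\<^sup>2)"
    by (simp add: integrable_completion)
qed

lemma spherical_mean_Lp_bound:
  fixes h :: "real ^ 'n \<Rightarrow> complex" and g :: "real ^ 'n \<Rightarrow> complex ^ 'n"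
  assumes n: "3 \<le> CARD('n)" and R: "1 < R"
    and h: "in_Lp lebesgue 2 h" and w: "has_weak_gradient h g" and g: "in_Lp lebesgue 2 g"
    and supp: "ess_support h \<subseteq> annulus (1 / R) R"
  defines "D \<equiv> (Lp_norm lebesgue 2 g)\<^sup>2
            - (real CARD('n) - 2)\<^sup>2 / 4 * (Lp_norm lebesgue 2 (\<lambda>x. h x /\<^sub>R norm x))\<^sup>2"
  shows "in_Lp (radial_measure CARD('n)) (sobolev_exponent CARD('n)) (spherical_mean h)"
    and "(Lp_norm (radial_measure CARD('n)) (sobolev_exponent CARD('n)) (spherical_mean h))\<^sup>2
      \<le> (4 * ln R * D / measure sphere_measure (sphere (0::real ^ 'n) 1)) * (2 * ln R) powr ((real CARD('n) - 2) / real CARD('n))"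
proof -
  have hm: "h \<in> borel_measurable lebesgue" and hi: "integrable lebesgue (\<lambda>x. (norm (h x))\<^sup>2)"
    and gm: "g \<in> borel_measurable lebesgue" and gi: "integrable lebesgue (\<lambda>x. (norm (g x))\<^sup>2)"
    using h g by (simp_all add: in_Lp_def)
  obtain h0 where h0[measurable]: "h0 \<in> borel_measurable borel" and h0_eq: "AE x in lborel. h x = h0 x"
    using ex_borel_representative[OF hm] by metis
  obtain g' where g'[measurable]: "g' \<in> borel_measurable borel" and g'_eq: "AE x in lborel. g x = g' x"
    using ex_borel_representative[OF gm] by metis
  let ?A = "annulus (1 / R) R :: (real ^ 'n) set"
  have A[measurable]: "?A \<in> sets borel"
    unfolding annulus_def by measurable
  \<comment> \<open>The cutoff makes \<open>h'\<close> vanish everywhere outside the annulus, not just almost everywhere.\<close>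
  define h' where "h' x = indicator ?A x *\<^sub>R h0 x" for x
  have h'[measurable]: "h' \<in> borel_measurable borel"
    unfolding h'_def[abs_def] by (intro borel_measurable_scaleR borel_measurable_indicator A h0)
  have h'_0: "h' x = 0" if "x \<notin> ?A" for x using that by (simp add: h'_def)
  have "AE x in lborel. x \<notin> ess_support h \<longrightarrow> h x = 0"
    using AE_eq_0_outside_ess_support[of h] by (simp add: AE_completion_iff)
  with h0_eq have h'_eq: "AE x in lborel. h x = h' x"
    by eventually_elim (use supp in \<open>auto simp: h'_def indicator_def\<close>)
  have h'_eql: "AE x in lebesgue. h x = h' x" and g'_eql: "AE x in lebesgue. g x = g' x"
    using h'_eq g'_eq by (auto intro: AE_completion)
  have w': "has_weak_gradient h' g'"
    by (rule has_weak_gradient_cong_AE[OF w h'_eql g'_eql hm gm]) (auto intro: measurable_completion)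
  have D: "D = (\<integral>x. (norm (g' x))\<^sup>2 \<partial>lborel)
      - (real CARD('n) - 2)\<^sup>2 / 4 * (\<integral>x. (norm (h' x))\<^sup>2 / (norm x)\<^sup>2 \<partial>lborel)"
  proof -
    have 1: "(\<integral>x. (norm (g x))\<^sup>2 \<partial>lebesgue) = (\<integral>x. (norm (g' x))\<^sup>2 \<partial>lborel)"
      by (rule square_integrable_borel_representative[OF gm g' g'_eql])
    have id: "(\<lambda>x::real ^ 'n. inverse (norm x)) \<in> borel_measurable lebesgue"
      by (intro measurable_completion) measurable
    have "(\<integral>x. (norm (h x /\<^sub>R norm x))\<^sup>2 \<partial>lebesgue) = (\<integral>x. (norm (h' x /\<^sub>R norm x))\<^sup>2 \<partial>lborel)"
    proof (rule square_integrable_borel_representative)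
      show "(\<lambda>x. h x /\<^sub>R norm x) \<in> borel_measurable lebesgue"
        by (intro borel_measurable_scaleR id hm)
      show "AE x in lebesgue. h x /\<^sub>R norm x = h' x /\<^sub>R norm x"
        using h'_eql by eventually_elim simp
    qed measurable
    also have "(\<lambda>x. (norm (h' x /\<^sub>R norm x))\<^sup>2) = (\<lambda>x. (norm (h' x))\<^sup>2 / (norm x)\<^sup>2)"
      by (simp add: power_mult_distrib divide_inverse mult.commute power_inverse fun_eq_iff)
    finally show ?thesis
      unfolding D_def Lp_norm_2_squared 1 by simp
  qed
  have h'2: "integrable lborel (\<lambda>x. (norm (h' x))\<^sup>2)" and g'2: "integrable lborel (\<lambda>x. (norm (g' x))\<^sup>2)"
    using square_integrable_borel_representative(2)[OF hm h' h'_eql hi]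
      square_integrable_borel_representative(2)[OF gm g' g'_eql gi] by auto
  note pw = spherical_mean_pointwise_bound[OF R w' h' g' h'2 g'2 h'_0, folded D]
  let ?B = "4 * ln R * D / measure sphere_measure (sphere (0::real ^ 'n) 1)"
  have B: "0 \<le> ?B"
    using pw(1) R measure_sphere_measure_pos[where 'a="real ^ 'n"] by simp
  note bound = radial_Lp_bound[OF n R B measurable_spherical_mean[OF h'] spherical_mean_cong_AE[OF h'_eq h'] pw(2)
      spherical_mean_eq_0_outside[OF h'_0]]
  show "in_Lp (radial_measure CARD('n)) (sobolev_exponent CARD('n)) (spherical_mean h)"
    by (rule bound(1))
  show "(Lp_norm (radial_measure CARD('n)) (sobolev_exponent CARD('n)) (spherical_mean h))\<^sup>2
      \<le> ?B * (2 * ln R) powr ((real CARD('n) - 2) / real CARD('n))"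
    by (rule bound(2))
qed

theorem corollary7:
  assumes "3 \<le> CARD('n::finite)"
  shows "\<exists>C>0. \<forall>R>1. \<forall>(h :: real ^ 'n \<Rightarrow> complex) (g :: real ^ 'n \<Rightarrow> complex ^ 'n).
    in_Lp lebesgue 2 h \<longrightarrow> has_weak_gradient h g \<longrightarrow> in_Lp lebesgue 2 g \<longrightarrow>
    ess_support h \<subseteq> annulus (1 / R) R \<longrightarrow>
      in_Lp (radial_measure CARD('n)) (sobolev_exponent CARD('n)) (spherical_mean h) \<and>
      (Lp_norm (radial_measure CARD('n)) (sobolev_exponent CARD('n)) (spherical_mean h))\<^sup>2
        \<le> C * (ln R) powr (2 * (real CARD('n) - 1) / real CARD('n)) *
          ((Lp_norm lebesgue 2 g)\<^sup>2
            - (real CARD('n) - 2)\<^sup>2 / 4 * (Lp_norm lebesgue 2 (\<lambda>x. h x /\<^sub>R norm x))\<^sup>2)"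
proof -
  let ?n = "real CARD('n)"
  define s where "s = measure sphere_measure (sphere (0::real ^ 'n) 1)"
  define C where "C = 4 / s * 2 powr ((?n - 2) / ?n)"
  have s: "0 < s" unfolding s_def by (rule measure_sphere_measure_pos)
  have C: "0 < C" using s by (simp add: C_def)
  have const: "(4 * ln R * D / s) * (2 * ln R) powr ((?n - 2) / ?n)
      = C * (ln R) powr (2 * (?n - 1) / ?n) * D" if R: "1 < R" for R D :: real
  proof -
    have l: "0 < ln R" using R by simp
    have e: "2 * (?n - 1) / ?n = 1 + (?n - 2) / ?n"
      using assms by (simp add: field_simps)
    show ?thesis
      unfolding e C_def using l by (simp add: powr_add powr_mult)
  qed
  show ?thesis
  proof (intro exI[of _ C] conjI C allI impI)
    fix R :: real and h :: "real ^ 'n \<Rightarrow> complex" and g :: "real ^ 'n \<Rightarrow> complex ^ 'n"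
    assume a: "1 < R" "in_Lp lebesgue 2 h" "has_weak_gradient h g" "in_Lp lebesgue 2 g"
      "ess_support h \<subseteq> annulus (1 / R) R"
    note bound = spherical_mean_Lp_bound[OF assms a]
    show "in_Lp (radial_measure CARD('n)) (sobolev_exponent CARD('n)) (spherical_mean h)"
      by (rule bound(1))
    show "(Lp_norm (radial_measure CARD('n)) (sobolev_exponent CARD('n)) (spherical_mean h))\<^sup>2
        \<le> C * (ln R) powr (2 * (real CARD('n) - 1) / real CARD('n)) *
          ((Lp_norm lebesgue 2 g)\<^sup>2
            - (real CARD('n) - 2)\<^sup>2 / 4 * (Lp_norm lebesgue 2 (\<lambda>x. h x /\<^sub>R norm x))\<^sup>2)"
      using bound(2) unfolding s_def[symmetric] const[OF a(1)] .
  qed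
qed

end
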